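(* Let $k$ be an algebraically closed field of characteristic $p>0$, let $G$ be a finite group with an injective homomorphism $\phi:G\to\mathrm{Aut}_k(k[[t]])$, and write $G=P.C$ as the semi-direct product of its normal Sylow $p$-subgroup $P$ and a cyclic group $C$ of order prime to $p$. The Bertin obstruction of $\phi$ vanishes if and only if all of the following conditions hold: (a) The Bertin obstruction of the restriction $\phi_P$ of $\phi$ to $P$ vanishes. (b) If $t$ is a non-trivial element of $C$, the centralizer $C_G(t)$ of $t$ in $G$ is cyclic and equal to the product group $C_P(t)\times C=C_P(C)\times C$. (c) For each non-trivial cyclic subgroup $T$ of $P$, both of the following are true: (i) $b'_{T,G}\equiv 0 \bmod [N_P(T):T]\mathbb{Z}$; (ii) $[N_P(T):T]\,b_{T,P}\ge -b'_{T,G}$. (d) For each non-trivial cyclic subgroup $T$ of $P$, one of the following is true: (i) the centralizer $C_C(T)$ of $T$ in $C$ is non-trivial, and $b''_{T,G}\equiv 0\bmod \#N_C(T)\mathbb{Z}$; (ii) the centralizer $C_C(T)$ is trivial, the restriction of $\theta$ to $N_C(T)$ is faithful, takes values in $(\mathbb{Z}/p)^*$ and has Teichmüller lift $\chi_T^{-1}$, and $b'_{T,G}\equiv 0\bmod \#N_C(T)\mathbb{Z}$.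
   Context: $\mathrm{Aut}_k(k[[t]])$ is the group of continuous $k$-algebra automorphisms of $k[[t]]$. For a finite group $J$ and an injection $\psi:J\to\mathrm{Aut}_k(k[[t]])$, the Artin character is $a_\psi(\sigma)=-\mathrm{ord}_t(\psi(\sigma)(t)-t)$ for $\sigma\neq e$ and $a_\psi(e)=-\sum_{\sigma\ne e}a_\psi(\sigma)$. The Bertin obstruction of $\psi$ vanishes if there is a finite $J$-set $S$ with all stabilizers non-trivial and cyclic whose permutation character satisfies $\chi_S=m\cdot\mathrm{reg}_J-a_\psi$ for some integer $m$. $C_X(Y)$ and $N_X(Y)$ denote the centralizer and normalizer of $Y$ in $X$; $\mu$ is the Möbius function. For a non-trivial cyclic subgroup $T$ of $G$, $S_G(T)$ is the set of cyclic subgroups of $G$ containing $T$, and $$b'_{T,G}=\sum_{\Gamma\in S_G(T),\ \Gamma\not\subset P}\mu([\Gamma:T]),\qquad b''_{T,G}=\sum_{\Gamma\in S_G(T)}\mu([\Gamma:T]).$$ The rational numbers $b_{T,P}$ are the unique ones such that $-a_{\phi_P}=\sum_T b_{T,P}\,1_T^P$, the sum being over a set of representatives for the conjugacy classes of cyclic subgroups $T$ of $P$, where $1_T^P=\mathrm{Ind}_T^P 1_T$; $b_{T,P}$ depends only on the $P$-conjugacy class of $T$, hence is defined for all cyclic $T\subset P$. $\theta:C\to k^*$ is the faithful character defined by $\phi(\sigma)(u)/u\equiv\theta(\sigma)\bmod uk[[u]]$ for $\sigma\in C$, where $u$ is a uniformizer of $k[[t]]^{\phi(P)}=k[[u]]$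 (independent of the choice of $u$). If a character of a subgroup $C_1\subset C$ takes values in $(\mathbb{Z}/p)^*\subset k^*$, its Teichmüller lift is the unique character $C_1\to\mathbb{Z}_p^*$ reducing to it mod $p$ (of the same order, prime to $p$). For a cyclic subgroup $T$ of $P$, $\chi_T:N_C(T)\to\mathbb{Z}_p^*$ is the unique character (taking values in roots of unity of order prime to $p$) such that $xyx^{-1}=y^{\chi_T(x)}$ for $x\in N_C(T)$, $y\in T$. *)

theory Defs
  imports
    "HOL-Algebra.Algebra"
    "HOL-Computational_Algebra.Computational_Algebra"
    "HOL-Number_Theory.Number_Theory"
begin

definition centralizer_in :: "('g, 'b) monoid_scheme \<Rightarrow> 'g set \<Rightarrow> 'g set \<Rightarrow> 'g set" where
  "centralizer_in G A B = {x \<in> A. \<forall>y \<in> B. x \<otimes>\<^bsub>G\<^esub> y = y \<otimes>\<^bsub>G\<^esub> x}"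

definition normalizer_in :: "('g, 'b) monoid_scheme \<Rightarrow> 'g set \<Rightarrow> 'g set \<Rightarrow> 'g set" where
  "normalizer_in G A B = A \<inter> normalizer G B"

definition cyclic_subgroup :: "'g set \<Rightarrow> ('g, 'b) monoid_scheme \<Rightarrow> bool" where
  "cyclic_subgroup H G \<longleftrightarrow> subgroup H G \<and> cyclic_group (G\<lparr>carrier := H\<rparr>)"

definition subgroup_index :: "('g, 'b) monoid_scheme \<Rightarrow> 'g set \<Rightarrow> 'g set \<Rightarrow> nat" where
  "subgroup_index G K H = card (rcosets\<^bsub>G\<lparr>carrier := K\<rparr>\<^esub> H)"

definition is_internal_direct_product ::
    "('g, 'b) monoid_scheme \<Rightarrow> 'g set \<Rightarrow> 'g set \<Rightarrow> 'g set \<Rightarrow> bool" where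
  "is_internal_direct_product G H A B \<longleftrightarrow> subgroup A G \<and> subgroup B G \<and>
     (\<lambda>(x, y). x \<otimes>\<^bsub>G\<^esub> y) \<in>
       iso (G\<lparr>carrier := A\<rparr> \<times>\<times> G\<lparr>carrier := B\<rparr>) (G\<lparr>carrier := H\<rparr>)"

definition moebius :: "nat \<Rightarrow> int" where
  "moebius n = (if squarefree n then (-1) ^ card (prime_factors n) else 0)"

text \<open>Frobenius' formula, summing over the whole group instead of over coset representatives.\<close>

definition induced_class_fun ::
    "('g, 'b) monoid_scheme \<Rightarrow> 'g set \<Rightarrow> ('g \<Rightarrow> rat) \<Rightarrow> 'g \<Rightarrow> rat" where
  "induced_class_fun J H f x =
     (\<Sum>g \<in> {g \<in> carrier J. inv\<^bsub>J\<^esub> g \<otimes>\<^bsub>J\<^esub> x \<otimes>\<^bsub>J\<^esub> g \<in> H}. f (inv\<^bsub>J\<^esub> g \<otimes>\<^bsub>J\<^esub> x \<otimes>\<^bsub>J\<^esub> g))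
       / of_nat (card H)"

definition conjugate_subgroups :: "('g, 'b) monoid_scheme \<Rightarrow> 'g set \<Rightarrow> 'g set \<Rightarrow> bool" where
  "conjugate_subgroups J T U \<longleftrightarrow> (\<exists>g \<in> carrier J. U = g <#\<^bsub>J\<^esub> T #>\<^bsub>J\<^esub> inv\<^bsub>J\<^esub> g)"

definition cyclic_class_representatives ::
    "('g, 'b) monoid_scheme \<Rightarrow> 'g set set \<Rightarrow> bool" where
  "cyclic_class_representatives J R \<longleftrightarrow> (\<forall>T \<in> R. cyclic_subgroup T J) \<and>
     (\<forall>T. cyclic_subgroup T J \<longrightarrow> (\<exists>!U. U \<in> R \<and> conjugate_subgroups J T U))"

text \<open>The topology on \<open>'k fps\<close> is the adic one given by the library metric.\<close>

definition fps_aut :: "('k::field fps \<Rightarrow> 'k fps) monoid" where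
  "fps_aut =
     \<lparr>carrier = {f. bij f \<and> (\<forall>x y. f (x + y) = f x + f y) \<and> (\<forall>x y. f (x * y) = f x * f y) \<and>
                   (\<forall>c. f (fps_const c) = fps_const c) \<and> continuous_on UNIV f},
      monoid.mult = (\<circ>), one = id\<rparr>"

text \<open>In the branch for the identity the two minus signs, of the definition of the value there and
  of the other values, have been cancelled.\<close>

definition artin_character ::
    "('g, 'b) monoid_scheme \<Rightarrow> ('g \<Rightarrow> 'k::field fps \<Rightarrow> 'k fps) \<Rightarrow> 'g \<Rightarrow> int" where
  "artin_character J \<psi> \<sigma> =
     (if \<sigma> = \<one>\<^bsub>J\<^esub>
      then (\<Sum>\<tau> \<in> carrier J - {\<one>\<^bsub>J\<^esub>}. int (subdegree (\<psi> \<tau> fps_X - fps_X)))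
      else - int (subdegree (\<psi> \<sigma> fps_X - fps_X)))"

definition regular_character :: "('g, 'b) monoid_scheme \<Rightarrow> 'g \<Rightarrow> int" where
  "regular_character J \<sigma> = (if \<sigma> = \<one>\<^bsub>J\<^esub> then int (Coset.order J) else 0)"

text \<open>Every finite set being in bijection with a set of natural numbers, it is enough to let the
  \<open>J\<close>-set range over finite sets of naturals.  The library's \<open>invariants S act \<sigma>\<close> is the set of
  points of \<open>S\<close> fixed by the single element \<open>\<sigma>\<close>.\<close>

definition bertin_obstruction_vanishes ::
    "('g, 'b) monoid_scheme \<Rightarrow> ('g \<Rightarrow> 'k::field fps \<Rightarrow> 'k fps) \<Rightarrow> bool" where
  "bertin_obstruction_vanishes J \<psi> \<longleftrightarrow>
     (\<exists>(S :: nat set) act. finite S \<and> group_action J S act \<and>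
        (\<forall>s \<in> S. stabilizer J act s \<noteq> {\<one>\<^bsub>J\<^esub>} \<and> cyclic_subgroup (stabilizer J act s) J) \<and>
        (\<exists>m::int. \<forall>\<sigma> \<in> carrier J.
           int (card (invariants S act \<sigma>)) = m * regular_character J \<sigma> - artin_character J \<psi> \<sigma>))"

text \<open>The coefficient function is normalized to be zero off the cyclic subgroups, so that it is
  unique as a function on all sets.\<close>

definition artin_coeff ::
    "('g, 'b) monoid_scheme \<Rightarrow> ('g \<Rightarrow> 'k::field fps \<Rightarrow> 'k fps) \<Rightarrow> 'g set \<Rightarrow> rat" where
  "artin_coeff J \<psi> = (THE b.
     (\<forall>T. \<not> cyclic_subgroup T J \<longrightarrow> b T = 0) \<and>
     (\<forall>T U. cyclic_subgroup T J \<and> conjugate_subgroups J T U \<longrightarrow> b T = b U) \<and>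
     (\<forall>R. cyclic_class_representatives J R \<longrightarrow>
        (\<forall>\<sigma> \<in> carrier J. - of_int (artin_character J \<psi> \<sigma>) =
           (\<Sum>T \<in> R. b T * induced_class_fun J T (\<lambda>_. 1) \<sigma>))))"

definition cyclic_over :: "('g, 'b) monoid_scheme \<Rightarrow> 'g set \<Rightarrow> 'g set set" where
  "cyclic_over G T = {\<Gamma>. cyclic_subgroup \<Gamma> G \<and> T \<subseteq> \<Gamma>}"

definition b_prime :: "('g, 'b) monoid_scheme \<Rightarrow> 'g set \<Rightarrow> 'g set \<Rightarrow> int" where
  "b_prime G P T =
     (\<Sum>\<Gamma> \<in> {\<Gamma> \<in> cyclic_over G T. \<not> \<Gamma> \<subseteq> P}. moebius (subgroup_index G \<Gamma> T))"

definition b_double_prime :: "('g, 'b) monoid_scheme \<Rightarrow> 'g set \<Rightarrow> int" where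
  "b_double_prime G T = (\<Sum>\<Gamma> \<in> cyclic_over G T. moebius (subgroup_index G \<Gamma> T))"

definition fixed_fps :: "('g \<Rightarrow> 'k::field fps \<Rightarrow> 'k fps) \<Rightarrow> 'g set \<Rightarrow> 'k fps set" where
  "fixed_fps \<phi> P = {f. \<forall>\<sigma> \<in> P. \<phi> \<sigma> f = f}"

text \<open>\<open>u\<close> is a uniformizer of the invariant ring if the latter is \<open>k[[u]]\<close>, the image of the
  substitution \<open>g(t) \<mapsto> g(u)\<close>.\<close>

definition is_uniformizer ::
    "('g \<Rightarrow> 'k::field fps \<Rightarrow> 'k fps) \<Rightarrow> 'g set \<Rightarrow> 'k fps \<Rightarrow> bool" where
  "is_uniformizer \<phi> P u \<longleftrightarrow>
     u \<noteq> 0 \<and> fps_nth u 0 = 0 \<and> fixed_fps \<phi> P = range (\<lambda>g. fps_compose g u)"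

definition theta_char :: "('g \<Rightarrow> 'k::field fps \<Rightarrow> 'k fps) \<Rightarrow> 'g set \<Rightarrow> 'g \<Rightarrow> 'k" where
  "theta_char \<phi> P \<sigma> = (THE c. \<exists>u. is_uniformizer \<phi> P u \<and>
     (\<exists>h \<in> fixed_fps \<phi> P. \<phi> \<sigma> u / u - fps_const c = u * h))"

text \<open>A $p$-adic integer is a coherent sequence of least non-negative residues, its \<open>n\<close>-th term
  being taken modulo \<open>p ^ n\<close>; in particular the term with index 1 is its residue in the prime
  field.\<close>

definition padic_int_ring :: "nat \<Rightarrow> (nat \<Rightarrow> int) ring" where
  "padic_int_ring p =
     \<lparr>carrier = {x. \<forall>n. 0 \<le> x n \<and> x n < int p ^ n \<and> x (Suc n) mod int p ^ n = x n},
      monoid.mult = (\<lambda>x y n. (x n * y n) mod int p ^ n),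
      one = (\<lambda>n. 1 mod int p ^ n),
      ring.zero = (\<lambda>n. 0),
      ring.add = (\<lambda>x y n. (x n + y n) mod int p ^ n)\<rparr>"

abbreviation padic_units :: "nat \<Rightarrow> (nat \<Rightarrow> int) monoid" where
  "padic_units p \<equiv> units_of (padic_int_ring p)"

text \<open>\<open>y ^ z\<close> for \<open>y\<close> of \<open>p\<close>-power order and a $p$-adic integer \<open>z\<close>: the power with exponent any
  residue of \<open>z\<close> modulo a power of \<open>p\<close> killing \<open>y\<close>.\<close>

definition padic_pow ::
    "('g, 'b) monoid_scheme \<Rightarrow> nat \<Rightarrow> 'g \<Rightarrow> (nat \<Rightarrow> int) \<Rightarrow> 'g" where
  "padic_pow G p y z = y [^]\<^bsub>G\<^esub> z (LEAST n. y [^]\<^bsub>G\<^esub> (p ^ n) = \<one>\<^bsub>G\<^esub>)"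

text \<open>Characters are made extensional, that is \<open>undefined\<close> outside their domain, to be unique as
  functions.\<close>

definition padic_characters ::
    "('g, 'b) monoid_scheme \<Rightarrow> nat \<Rightarrow> 'g set \<Rightarrow> ('g \<Rightarrow> nat \<Rightarrow> int) set" where
  "padic_characters G p H =
     hom (G\<lparr>carrier := H\<rparr>) (padic_units p) \<inter> extensional H"

text \<open>The last clause says that the lift has the same order as \<open>\<eta>\<close>.\<close>

definition teichmueller_lift ::
    "('g, 'b) monoid_scheme \<Rightarrow> nat \<Rightarrow> 'g set \<Rightarrow> ('g \<Rightarrow> 'k::field) \<Rightarrow> 'g \<Rightarrow> nat \<Rightarrow> int" where
  "teichmueller_lift G p H \<eta> = (THE \<tau>. \<tau> \<in> padic_characters G p H \<and>
     (\<forall>x \<in> H. of_int (\<tau> x 1) = \<eta> x) \<and>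
     (\<forall>n::nat. (\<forall>x \<in> H. \<tau> x [^]\<^bsub>padic_units p\<^esub> n = \<one>\<^bsub>padic_units p\<^esub>)
        \<longleftrightarrow> (\<forall>x \<in> H. \<eta> x ^ n = 1)))"

definition chi_char ::
    "('g, 'b) monoid_scheme \<Rightarrow> nat \<Rightarrow> 'g set \<Rightarrow> 'g set \<Rightarrow> 'g \<Rightarrow> nat \<Rightarrow> int" where
  "chi_char G p C T = (THE \<chi>. \<chi> \<in> padic_characters G p (normalizer_in G C T) \<and>
     (\<forall>x \<in> normalizer_in G C T. \<exists>n::nat. n > 0 \<and> coprime n p \<and>
        \<chi> x [^]\<^bsub>padic_units p\<^esub> n = \<one>\<^bsub>padic_units p\<^esub>) \<and>
     (\<forall>x \<in> normalizer_in G C T. \<forall>y \<in> T.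
        x \<otimes>\<^bsub>G\<^esub> y \<otimes>\<^bsub>G\<^esub> inv\<^bsub>G\<^esub> x = padic_pow G p y (\<chi> x)))"

end

theory Submission
  imports Defs
begin

text \<open>For \<open>\<sigma> \<noteq> 1\<close> let \<open>i(\<sigma>) = ord (\<sigma>(t) - t)\<close>. This number depends only on the cyclic group generated
  by \<open>\<sigma>\<close> and is invariant under conjugation, so Moebius inversion on the cyclic subgroups shows that
  the Bertin obstruction for a group \<open>J\<close> vanishes if and only if for each non-trivial cyclic \<open>T\<close> the
  integer \<open>B(T) = \<Sum> \<mu>([\<Gamma> : T]) i(\<Gamma>)\<close>, summed over the cyclic \<open>\<Gamma> \<supseteq> T\<close> in \<open>J\<close>, is non-negative and
  divisible by \<open>[N_J(T) : T]\<close>: in a \<open>J\<close>-set with cyclic stabilizers whose fixed point numbers are the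
  \<open>i(\<Gamma>)\<close>, it counts the points with stabilizer \<open>T\<close>. Since \<open>i = 1\<close> outside \<open>P\<close>, the integer for \<open>G\<close> is
  the one for \<open>P\<close> plus \<open>b'\<close> when \<open>T \<subseteq> P\<close>, and \<open>\<Sum> \<mu>([\<Gamma> : T])\<close> otherwise.

  In a \<open>G\<close>-set realizing \<open>- a\<close> modulo the regular character, a non-trivial \<open>t \<in> C\<close> has exactly one
  fixed point, whence (b); and if \<open>C_C(T) = 1\<close>, then \<open>N_C(T)\<close> acts freely on the \<open>i(T)\<close> fixed points
  of \<open>T\<close>, whence \<open>#N_C(T)\<close> divides \<open>i(T)\<close>. Let \<open>\<theta>\<^sub>0(x)\<close> be the linear coefficient of \<open>x(t)\<close>. If
  \<open>x \<sigma> x\<inverse> = \<sigma> ^ r\<close> with \<open>\<sigma> \<in> P\<close> non-trivial, comparing leading coefficients gives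
  \<open>\<theta>\<^sub>0(x) ^ (i(\<sigma>) - 1) = r\<close> in \<open>k\<close>. This turns the divisibility into the condition on the Teichmueller
  lift, and it shows that \<open>i\<close> is constant modulo the order of the stabilizer in \<open>N_C(T)\<close> along the
  cyclic \<open>\<Gamma> \<supseteq> T\<close> in \<open>P\<close>, which gives the congruences in (d).\<close>

subsection \<open>The Moebius function on intervals of cyclic subgroups\<close>

text \<open>For the converse, conditions (a), (c) and (d) give divisibility of the integer at
  \<open>T\<close> by \<open>[N_P(T) : T]\<close> and by \<open>#N_C(T)\<close>, whereas
  \<open>[N_G(T) : T]\<close> is required. The gap is closed one prime power at a time: a
  \<open>p\<close>-subgroup of \<open>N_G(T)\<close> lies in \<open>P\<close>, and a
  \<open>q\<close>-subgroup with q \<noteq> p can be conjugated into \<open>C\<close>. That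
  conjugation moves \<open>T\<close> to another subgroup of \<open>P\<close>, so the congruence
  modulo \<open>#N_C\<close> has to be known at every cyclic subgroup and not just at
  \<open>T\<close>. A cyclic \<open>T\<close> outside \<open>P\<close> has no condition of its own;
  after conjugation it contains a non-trivial \<open>t\<close> of \<open>C\<close>, all cyclic
  groups above it lie in the cyclic centralizer of \<open>t\<close>, and the integer collapses to 0
  or 1. Condition (d) speaks of \<theta>, defined on the invariant ring, whereas the ramification
  argument yields \<open>theta_0\<close>, defined on k[[t]]. They are related by \<theta> =
  \<open>theta_0 ^ e\<close>, with \<open>e\<close> the least positive order of an invariant series.
  It is enough to know that \<open>e\<close> is a power of \<open>p\<close>: such a power map is
  injective on \<open>k\<close> and the identity on the prime field.\<close>

lemma moebius_mult_prime:
  assumes q: "Factorial_Ring.prime q" and d: "\<not> q dvd d"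
  shows "moebius (d * q) = - moebius d"
proof (cases "squarefree d")
  case True
  have d0: "d \<noteq> 0" using d by (metis dvd_0_right)
  have "coprime d q" using q d by (metis coprime_commute prime_imp_coprime)
  then have "squarefree (d * q)"
    using True q by (simp add: squarefree_mult_coprime squarefree_prime)
  moreover have "prime_factors (d * q) = insert q (prime_factors d)"
    using d0 q by (simp add: prime_factors_product prime_prime_factors prime_gt_0_nat)
  moreover have "q \<notin> prime_factors d" using d by auto
  ultimately show ?thesis using True by (simp add: moebius_def)
next
  case False
  then have "\<not> squarefree (d * q)" using squarefree_mono[of d "d * q"] by auto
  with False show ?thesis by (simp add: moebius_def)
qed

text \<open>Only squarefree divisors contribute. For a fixed prime \<open>q\<close> dividing
  \<open>n\<close>, multiplication by \<open>q\<close> pairs those prime to \<open>q\<close> with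
  those divisible by \<open>q\<close>, and the paired terms have opposite signs.\<close>

lemma sum_moebius_divisors:
  assumes "n > 0"
  shows "(\<Sum>d | d dvd n. moebius d) = (if n = 1 then 1 else 0)"
proof (cases "n = 1")
  case True
  then show ?thesis by (simp add: moebius_def)
next
  case False
  then obtain q where q: "Factorial_Ring.prime q" "q dvd n" using prime_factor_nat by blast
  define A where "A = {d. d dvd n \<and> squarefree d \<and> \<not> q dvd d}"
  define B where "B = {d. d dvd n \<and> squarefree d \<and> q dvd d}"
  have fin: "finite {d. d dvd n}" using assms by simp
  have AB: "finite A" "finite B" "A \<inter> B = {}" by (auto simp: A_def B_def assms)
  have B: "B = (\<lambda>d. d * q) ` A"
  proof (intro equalityI subsetI)
    fix d assume d: "d \<in> B"
    then have "q dvd d" by (simp add: B_def)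
    then obtain e where e: "d = e * q" unfolding dvd_def by (metis mult.commute)
    have "\<not> q dvd e"
    proof
      assume "q dvd e"
      then have "q ^ 2 dvd d" by (auto simp: e power2_eq_square mult.commute)
      then have "is_unit q" using d unfolding B_def squarefree_def by blast
      then show False using q(1) by auto
    qed
    moreover have "squarefree e" using d squarefree_mono[of e d] by (auto simp: B_def e)
    ultimately show "d \<in> (\<lambda>d. d * q) ` A" using d by (auto simp: A_def B_def e intro: dvd_mult_left)
  next
    fix x assume "x \<in> (\<lambda>d. d * q) ` A"
    then obtain d where d: "x = d * q" "d dvd n" "squarefree d" "\<not> q dvd d" by (auto simp: A_def)
    have cop: "coprime d q" using q d by (metis coprime_commute prime_imp_coprime)
    then show "x \<in> B"
      using d q by (auto simp: B_def squarefree_mult_coprime squarefree_prime divides_mult)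
  qed
  have "inj_on (\<lambda>d. d * q) A" using q(1) by (auto simp: inj_on_def)
  then have "sum moebius B = (\<Sum>d\<in>A. moebius (d * q))"
    unfolding B by (simp add: sum.reindex)
  also have "\<dots> = - sum moebius A"
    by (simp add: moebius_mult_prime[OF q(1)] A_def sum_negf)
  finally have "sum moebius (A \<union> B) = 0"
    using AB by (simp add: sum.union_disjoint)
  moreover have "sum moebius (A \<union> B) = (\<Sum>d | d dvd n. moebius d)"
    by (rule sum.mono_neutral_left) (use fin in \<open>auto simp: A_def B_def moebius_def\<close>)
  ultimately show ?thesis using False by simp
qed

section \<open>Subgroups of finite cyclic groups and Moebius sums over intervals\<close>

context group
begin

lemma finite_subgroupD:
  assumes "finite (carrier G)" "subgroup H G"
  shows "finite H" "H \<subseteq> carrier G" "card H > 0"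
proof -
  show "H \<subseteq> carrier G" by (rule subgroup.subset) fact
  with assms(1) show "finite H" by (rule finite_subset[rotated])
  then show "card H > 0" using subgroup.one_closed[OF assms(2)] by (auto simp: card_gt_0_iff)
qed

lemma subgroup_card_dvd:
  assumes "subgroup H G" "subgroup K G" "H \<subseteq> K"
  shows "card H dvd card K"
proof -
  interpret K: group "G\<lparr>carrier := K\<rparr>" using assms(2) by (rule subgroup_imp_group)
  have "subgroup H (G\<lparr>carrier := K\<rparr>)" using assms by (simp add: subgroup_incl)
  from K.lagrange[OF this] have "card (rcosets\<^bsub>G\<lparr>carrier := K\<rparr>\<^esub> H) * card H = card K"
    by (simp add: Coset.order_def)
  then show ?thesis by (metis dvd_triv_right)
qed

lemma subgroup_index_eq:
  assumes "subgroup H G" "subgroup K G" "H \<subseteq> K" "finite H"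
  shows "subgroup_index G K H = card K div card H"
proof -
  interpret K: group "G\<lparr>carrier := K\<rparr>" using assms(2) by (rule subgroup_imp_group)
  have "subgroup H (G\<lparr>carrier := K\<rparr>)" using assms by (simp add: subgroup_incl)
  from K.lagrange[OF this] have "subgroup_index G K H * card H = card K"
    by (simp add: subgroup_index_def Coset.order_def)
  moreover have "card H > 0" using assms(4) subgroup.one_closed[OF assms(1)] by (auto simp: card_gt_0_iff)
  ultimately show ?thesis by (metis div_mult_self_is_m)
qed

lemma cyclic_subgroup_iff:
  "cyclic_subgroup H G \<longleftrightarrow> (\<exists>x\<in>carrier G. H = generate G {x})"
proof
  assume H: "cyclic_subgroup H G"
  then have sub: "subgroup H G" by (simp add: cyclic_subgroup_def)
  interpret H: group "G\<lparr>carrier := H\<rparr>" using sub by (rule subgroup_imp_group)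
  obtain x where x: "x \<in> H" "H = range (\<lambda>n::int. x [^]\<^bsub>G\<lparr>carrier := H\<rparr>\<^esub> n)"
    using H H.cyclic_group by (auto simp: cyclic_subgroup_def)
  have xc: "x \<in> carrier G" using sub x(1) by (rule subgroup.mem_carrier)
  have "H = generate G {x}"
    unfolding generate_pow[OF xc] using x(2) int_pow_consistent[OF sub x(1)] by auto
  with xc show "\<exists>x\<in>carrier G. H = generate G {x}" by blast
next
  assume "\<exists>x\<in>carrier G. H = generate G {x}"
  then obtain x where x: "x \<in> carrier G" "H = generate G {x}" by blast
  have sub: "subgroup H G" using x by (simp add: generate_is_subgroup)
  interpret H: group "G\<lparr>carrier := H\<rparr>" using sub by (rule subgroup_imp_group)
  have xH: "x \<in> H" using x by (simp add: generate.incl)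
  have "range (\<lambda>n::int. x [^]\<^bsub>G\<lparr>carrier := H\<rparr>\<^esub> n) = generate G {x}"
    unfolding generate_pow[OF x(1)] using int_pow_consistent[OF sub xH] by auto
  then show "cyclic_subgroup H G"
    using sub xH H.cyclic_group x(2) by (auto simp: cyclic_subgroup_def)
qed

lemma cyclic_subgroup_generate: "x \<in> carrier G \<Longrightarrow> cyclic_subgroup (generate G {x}) G"
  using cyclic_subgroup_iff by blast

lemma cyclic_subgroup_imp_subgroup: "cyclic_subgroup H G \<Longrightarrow> subgroup H G"
  by (simp add: cyclic_subgroup_def)

lemma generate_subset_iff:
  assumes "x \<in> carrier G" "subgroup H G"
  shows "generate G {x} \<subseteq> H \<longleftrightarrow> x \<in> H"
  using assms generate_subgroup_incl[of "{x}" H] by (auto intro: generate.incl)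

lemma generate_eq_one_iff: "x \<in> carrier G \<Longrightarrow> generate G {x} = {\<one>} \<longleftrightarrow> x = \<one>"
  by (metis generate.incl generate_one singletonD singletonI)

lemma cyclic_subgroup_comm:
  assumes "cyclic_subgroup Z G" "x \<in> Z" "y \<in> Z"
  shows "x \<otimes> y = y \<otimes> x"
proof -
  interpret Z: group "G\<lparr>carrier := Z\<rparr>" using assms(1) by (simp add: cyclic_subgroup_def subgroup_imp_group)
  interpret Z: comm_group "G\<lparr>carrier := Z\<rparr>"
    using Z.cyclic_imp_abelian_group assms(1) by (simp add: cyclic_subgroup_def)
  show ?thesis using Z.m_comm[of x y] assms by simp
qed

text \<open>If \<open>H\<close> has order \<open>d\<close>, each of its elements
  \<open>z ^ k\<close> is killed by \<open>d\<close>, so \<open>k\<close> is a multiple of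
  \<open>ord z div d\<close>. Hence \<open>H\<close> lies in the group generated by that power of
  \<open>z\<close>, which has order \<open>d\<close> as well. The subgroup is thereby expressed
  through its order alone.\<close>

lemma subgroup_of_generate:
  assumes fin: "finite (carrier G)" and z: "z \<in> carrier G" and H: "subgroup H G" "H \<subseteq> generate G {z}"
  shows "H = generate G {z [^] (ord z div card H)}"
proof -
  define d where "d = card H"
  have Z: "subgroup (generate G {z}) G" using z by (simp add: generate_is_subgroup)
  have dpos: "d > 0" using finite_subgroupD[OF fin H(1)] by (simp add: d_def)
  have "d dvd ord z"
    using subgroup_card_dvd[OF H(1) Z H(2)] generate_pow_card[OF z] by (simp add: d_def)
  then obtain e where e: "ord z = d * e" by auto
  have n0: "ord z > 0" using ord_ge_1[OF fin z] by simp
  then have e0: "e > 0" using e by simp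
  have ze: "z [^] e \<in> carrier G" using z by simp
  have "ord (z [^] e) = d" using ord_pow[OF z, of e] e e0 by simp
  then have card: "card (generate G {z [^] e}) = d" using generate_pow_card[OF ze] by simp
  have "H \<subseteq> generate G {z [^] e}"
  proof
    fix x assume x: "x \<in> H"
    then obtain k :: int where k: "x = z [^] k" using H(2) unfolding generate_pow[OF z] by auto
    interpret H: group "G\<lparr>carrier := H\<rparr>" using H(1) by (rule subgroup_imp_group)
    have "x [^]\<^bsub>G\<lparr>carrier := H\<rparr>\<^esub> d = \<one>"
      using H.pow_order_eq_1[of x] x by (simp add: Coset.order_def d_def)
    then have "x [^] d = \<one>" by (simp flip: nat_pow_consistent)
    then have "z [^] (k * int d) = \<one>" by (simp add: k z int_pow_pow flip: int_pow_int)
    then have "int (d * e) dvd k * int d" using int_pow_eq_id[OF z] e by simp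
    then have "int e dvd k" using dpos by (simp add: mult.commute)
    then obtain j where "k = int e * j" by auto
    then have "x = (z [^] e) [^] j" by (simp add: k z int_pow_pow flip: int_pow_int)
    then show "x \<in> generate G {z [^] e}" unfolding generate_pow[OF ze] by blast
  qed
  moreover have "finite (generate G {z [^] e})"
    using card dpos card_ge_0_finite by metis
  ultimately have "H = generate G {z [^] e}" using card by (simp add: card_subset_eq d_def)
  then show ?thesis using e dpos by (simp add: d_def)
qed

lemma subgroup_of_cyclic:
  assumes "finite (carrier G)" "cyclic_subgroup Z G" "subgroup H G" "H \<subseteq> Z"
  shows "cyclic_subgroup H G"
proof -
  obtain z where z: "z \<in> carrier G" "Z = generate G {z}" using assms(2) cyclic_subgroup_iff by blast
  then have "H = generate G {z [^] (ord z div card H)}"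
    using subgroup_of_generate[OF assms(1) z(1) assms(3)] assms(4) by simp
  with z(1) show ?thesis unfolding cyclic_subgroup_iff by blast
qed

lemma subgroup_of_cyclic_unique:
  assumes "finite (carrier G)" "cyclic_subgroup Z G" "subgroup H G" "H \<subseteq> Z" "subgroup K G" "K \<subseteq> Z"
    and "card H = card K"
  shows "H = K"
proof -
  obtain z where z: "z \<in> carrier G" "Z = generate G {z}" using assms(2) cyclic_subgroup_iff by blast
  then have "H = generate G {z [^] (ord z div card H)}" "K = generate G {z [^] (ord z div card K)}"
    using subgroup_of_generate[OF assms(1) z(1)] assms(3-6) by simp_all
  with assms(7) show ?thesis by argo
qed

text \<open>The subgroups between \<open>T\<close> and \<open>Z\<close> are classified by their
  index over \<open>T\<close>, which takes each divisor of \<open>[Z : T]\<close> exactly once; the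
  interval is a divisor lattice.\<close>

lemma sum_cyclic_interval:
  fixes f :: "nat \<Rightarrow> int"
  assumes fin: "finite (carrier G)" and Z: "cyclic_subgroup Z G" and T: "subgroup T G" "T \<subseteq> Z"
  shows "(\<Sum>\<Gamma> | subgroup \<Gamma> G \<and> T \<subseteq> \<Gamma> \<and> \<Gamma> \<subseteq> Z. f (card \<Gamma> div card T)) = (\<Sum>d | d dvd card Z div card T. f d)"
proof -
  obtain z where z: "z \<in> carrier G" "Z = generate G {z}" using Z cyclic_subgroup_iff by blast
  have Zs: "subgroup Z G" using Z by (rule cyclic_subgroup_imp_subgroup)
  have n: "ord z = card Z" using generate_pow_card[OF z(1)] z(2) by simp
  have t: "card T > 0" using finite_subgroupD(3)[OF fin T(1)] .
  obtain m where m: "card Z = card T * m" using subgroup_card_dvd[OF T(1) Zs T(2)] by auto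
  have m0: "m > 0" using finite_subgroupD(3)[OF fin Zs] m by (metis mult_0_right neq0_conv)
  have div: "card Z div card T = m" using m t by simp
  \<comment> \<open>The inverse of the index map: the subgroup of order \<open>d * card T\<close>,
    generated by the matching power of the generator of \<open>Z\<close>.\<close>
  define S where "S d = generate G {z [^] (card Z div (d * card T))}" for d
  have S: "subgroup (S d) G" "T \<subseteq> S d" "S d \<subseteq> Z" "card (S d) = d * card T" if d: "d dvd m" for d
  proof -
    obtain e where e: "m = d * e" using d by auto
    have d0: "d > 0" and e0: "e > 0" using e m0 by auto
    have exp: "card Z div (d * card T) = e" using e m t d0 by (simp add: mult.left_commute)
    have Sd: "S d = generate G {z [^] e}" by (simp add: S_def exp)
    show sub: "subgroup (S d) G" using z by (simp add: S_def generate_is_subgroup)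
    have zZ: "z [^] e \<in> Z" using z Zs by (metis generate.incl insertI1 subgroup_int_pow_closed int_pow_int)
    then show "S d \<subseteq> Z" using generate_subset_iff[OF _ Zs] z by (simp add: Sd)
    have "ord (z [^] e) = d * card T"
      using ord_pow[OF z(1), of e] e0 by (simp add: n m e)
    then show "card (S d) = d * card T" using generate_pow_card z(1) by (simp add: Sd)
    have "T = generate G {z [^] (ord z div card T)}"
      using subgroup_of_generate[OF fin z(1) T(1)] T(2) z(2) by simp
    also have "z [^] (ord z div card T) = (z [^] e) [^] d"
      using z(1) by (simp add: nat_pow_pow n div e mult.commute)
    finally have T_eq: "T = generate G {(z [^] e) [^] d}" .
    have "(z [^] e) [^] d \<in> S d"
      using sub z(1) unfolding Sd by (metis generate.incl insertI1 nat_pow_closed subgroup_int_pow_closed int_pow_int)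
    then show "T \<subseteq> S d" unfolding T_eq using generate_subset_iff[OF _ sub] z(1) by simp
  qed
  show ?thesis unfolding div
  proof (rule sum.reindex_bij_witness[where i = S and j = "\<lambda>\<Gamma>. card \<Gamma> div card T"])
    fix \<Gamma> assume "\<Gamma> \<in> {\<Gamma>. subgroup \<Gamma> G \<and> T \<subseteq> \<Gamma> \<and> \<Gamma> \<subseteq> Z}"
    then have \<Gamma>: "subgroup \<Gamma> G" "T \<subseteq> \<Gamma>" "\<Gamma> \<subseteq> Z" by auto
    obtain d where d: "card \<Gamma> = card T * d" using subgroup_card_dvd[OF T(1) \<Gamma>(1,2)] by auto
    have "card T * d dvd card T * m" using subgroup_card_dvd[OF \<Gamma>(1) Zs \<Gamma>(3)] d m by simp
    then have dm: "d dvd m" using t by simp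
    then show "card \<Gamma> div card T \<in> {d. d dvd m}" using d t by simp
    have "S d = \<Gamma>"
      by (rule subgroup_of_cyclic_unique[OF fin Z S(1,3)[OF dm] \<Gamma>(1,3)]) (simp add: S(4)[OF dm] d)
    then show "S (card \<Gamma> div card T) = \<Gamma>" using d t by simp
  qed (use S t in auto)
qed

text \<open>One of two orthogonality relations, here with the lower end of the index fixed. With
  \<open>Z\<close> a point stabilizer, it singles out the points whose stabilizer is exactly
  \<open>T\<close>.\<close>

lemma sum_moebius_above:
  assumes fin: "finite (carrier G)" and Z: "cyclic_subgroup Z G" and T: "subgroup T G" "T \<subseteq> Z"
  shows "(\<Sum>\<Gamma> | \<Gamma> \<in> cyclic_over G T \<and> \<Gamma> \<subseteq> Z. moebius (subgroup_index G \<Gamma> T)) = (if T = Z then 1 else 0)"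
proof -
  have Zs: "subgroup Z G" using Z by (rule cyclic_subgroup_imp_subgroup)
  have eq: "{\<Gamma> \<in> cyclic_over G T. \<Gamma> \<subseteq> Z} = {\<Gamma>. subgroup \<Gamma> G \<and> T \<subseteq> \<Gamma> \<and> \<Gamma> \<subseteq> Z}"
    using subgroup_of_cyclic[OF fin Z] by (auto simp: cyclic_over_def cyclic_subgroup_def)
  have t: "card T > 0" "finite T" using finite_subgroupD[OF fin T(1)] by auto
  have dvd: "card T dvd card Z" using subgroup_card_dvd[OF T(1) Zs T(2)] .
  have "card Z div card T > 0"
    using dvd finite_subgroupD(3)[OF fin Zs] by (auto elim!: dvdE)
  moreover have "card Z div card T = 1 \<longleftrightarrow> T = Z"
    using dvd t T(2) finite_subgroupD(1)[OF fin Zs] card_subset_eq[of Z T]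
    by (cases "T = Z") (simp add: card_gt_0_iff, auto elim!: dvdE)
  moreover have "(\<Sum>\<Gamma> | \<Gamma> \<in> cyclic_over G T \<and> \<Gamma> \<subseteq> Z. moebius (subgroup_index G \<Gamma> T)) =
      (\<Sum>\<Gamma> | subgroup \<Gamma> G \<and> T \<subseteq> \<Gamma> \<and> \<Gamma> \<subseteq> Z. moebius (card \<Gamma> div card T))"
    unfolding eq by (rule sum.cong) (use subgroup_index_eq[OF T(1)] t in auto)
  ultimately show ?thesis
    using sum_cyclic_interval[OF assms, of moebius] sum_moebius_divisors by simp
qed

text \<open>The dual relation, with the upper end of the index fixed; it recovers a function from
  its Moebius sums. The involution sending a divisor to its complementary divisor reduces it to the
  same divisor sum.\<close>

lemma sum_moebius_below:
  assumes fin: "finite (carrier G)" and Z: "cyclic_subgroup Z G" and T: "subgroup T G" "T \<subseteq> Z"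
  shows "(\<Sum>\<Gamma> | subgroup \<Gamma> G \<and> T \<subseteq> \<Gamma> \<and> \<Gamma> \<subseteq> Z. moebius (subgroup_index G Z \<Gamma>)) = (if T = Z then 1 else 0)"
proof -
  have Zs: "subgroup Z G" using Z by (rule cyclic_subgroup_imp_subgroup)
  have t: "card T > 0" "finite T" using finite_subgroupD[OF fin T(1)] by auto
  have dvd: "card T dvd card Z" using subgroup_card_dvd[OF T(1) Zs T(2)] .
  define m where "m = card Z div card T"
  have m0: "m > 0"
    using dvd finite_subgroupD(3)[OF fin Zs] t by (auto elim!: dvdE simp: m_def)
  have m1: "m = 1 \<longleftrightarrow> T = Z"
    using dvd t T(2) finite_subgroupD(1)[OF fin Zs] card_subset_eq[of Z T]
    by (cases "T = Z") (simp add: card_gt_0_iff, auto elim!: dvdE simp: m_def)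
  have "(\<Sum>\<Gamma> | subgroup \<Gamma> G \<and> T \<subseteq> \<Gamma> \<and> \<Gamma> \<subseteq> Z. moebius (subgroup_index G Z \<Gamma>)) =
      (\<Sum>\<Gamma> | subgroup \<Gamma> G \<and> T \<subseteq> \<Gamma> \<and> \<Gamma> \<subseteq> Z. moebius (m div (card \<Gamma> div card T)))"
  proof (rule sum.cong)
    fix \<Gamma> assume "\<Gamma> \<in> {\<Gamma>. subgroup \<Gamma> G \<and> T \<subseteq> \<Gamma> \<and> \<Gamma> \<subseteq> Z}"
    then have \<Gamma>: "subgroup \<Gamma> G" "T \<subseteq> \<Gamma>" "\<Gamma> \<subseteq> Z" by auto
    have "subgroup_index G Z \<Gamma> = card Z div card \<Gamma>"
      using subgroup_index_eq[OF \<Gamma>(1) Zs \<Gamma>(3)] finite_subgroupD(1)[OF fin \<Gamma>(1)] by simp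
    also have "\<dots> = m div (card \<Gamma> div card T)"
    proof -
      obtain a where a: "card \<Gamma> = card T * a" using subgroup_card_dvd[OF T(1) \<Gamma>(1,2)] by auto
      obtain b where b: "card Z = card \<Gamma> * b" using subgroup_card_dvd[OF \<Gamma>(1) Zs \<Gamma>(3)] by auto
      have "card \<Gamma> > 0" using finite_subgroupD(3)[OF fin \<Gamma>(1)] .
      then show ?thesis using a b t by (auto simp: m_def mult.assoc card_gt_0_iff)
    qed
    finally show "moebius (subgroup_index G Z \<Gamma>) = moebius (m div (card \<Gamma> div card T))" by simp
  qed simp
  also have "\<dots> = (\<Sum>d | d dvd m. moebius (m div d))"
    using sum_cyclic_interval[OF assms, of "\<lambda>d. moebius (m div d)"] by (simp add: m_def)
  also have "\<dots> = (\<Sum>d | d dvd m. moebius d)"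
  proof -
    have "m div d dvd m \<and> m div (m div d) = d" if "d dvd m" for d
      using that m0 by (auto elim!: dvdE)
    then show ?thesis
      by (intro sum.reindex_bij_witness[where i = "\<lambda>d. m div d" and j = "\<lambda>d. m div d"]) simp_all
  qed
  finally show ?thesis using sum_moebius_divisors[OF m0] m1 by simp
qed

end

subsection \<open>Conjugation\<close>

text \<open>As the image under an inner automorphism it is open to the facts on homomorphisms;
  \<open>coset_conj_eq\<close> identifies it with the product of cosets that occurs in
  \<open>conjugate_subgroups\<close> and in the normalizer.\<close>

definition conj_set :: "('g, 'b) monoid_scheme \<Rightarrow> 'g \<Rightarrow> 'g set \<Rightarrow> 'g set" where
  "conj_set G g T = (\<lambda>t. g \<otimes>\<^bsub>G\<^esub> t \<otimes>\<^bsub>G\<^esub> inv\<^bsub>G\<^esub> g) ` T"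

lemma coset_conj_eq: "g <#\<^bsub>G\<^esub> T #>\<^bsub>G\<^esub> inv\<^bsub>G\<^esub> g = conj_set G g T"
  by (auto simp: conj_set_def l_coset_def r_coset_def)

context group
begin

lemma inv_mult_cancel:
  assumes "g \<in> carrier G" "x \<in> carrier G"
  shows "inv g \<otimes> (g \<otimes> x) = x" "g \<otimes> (inv g \<otimes> x) = x"
  using assms by (simp_all flip: m_assoc)

lemma conj_hom: "g \<in> carrier G \<Longrightarrow> group_hom G G (\<lambda>t. g \<otimes> t \<otimes> inv g)"
  by unfold_locales (auto simp: hom_def m_assoc inv_solve_left)

lemma conj_set_one: "T \<subseteq> carrier G \<Longrightarrow> conj_set G \<one> T = T"
  by (force simp: conj_set_def)

lemma conj_set_mult:
  assumes "g \<in> carrier G" "h \<in> carrier G" "T \<subseteq> carrier G"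
  shows "conj_set G (g \<otimes> h) T = conj_set G g (conj_set G h T)"
  unfolding conj_set_def image_image
  by (rule image_cong) (use assms in \<open>auto simp: m_assoc inv_mult_group subset_iff\<close>)

lemma conj_set_inv:
  assumes "g \<in> carrier G" "T \<subseteq> carrier G"
  shows "conj_set G (inv g) (conj_set G g T) = T" "conj_set G g (conj_set G (inv g) T) = T"
  using conj_set_mult[of "inv g" g T] conj_set_mult[of g "inv g" T] assms conj_set_one by simp_all

lemma conj_set_subset_carrier: "g \<in> carrier G \<Longrightarrow> T \<subseteq> carrier G \<Longrightarrow> conj_set G g T \<subseteq> carrier G"
  by (auto simp: conj_set_def)

lemma mem_conj_set_iff:
  assumes "g \<in> carrier G" "x \<in> carrier G" "T \<subseteq> carrier G"
  shows "x \<in> conj_set G g T \<longleftrightarrow> inv g \<otimes> x \<otimes> g \<in> T"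
proof
  assume "x \<in> conj_set G g T"
  then show "inv g \<otimes> x \<otimes> g \<in> T"
    using assms by (auto simp: conj_set_def m_assoc subset_iff inv_mult_cancel)
next
  assume "inv g \<otimes> x \<otimes> g \<in> T"
  moreover have "x = g \<otimes> (inv g \<otimes> x \<otimes> g) \<otimes> inv g"
    using assms by (simp add: m_assoc inv_mult_cancel)
  ultimately show "x \<in> conj_set G g T" unfolding conj_set_def by (rule rev_image_eqI)
qed

lemma conj_set_inj: "g \<in> carrier G \<Longrightarrow> T \<subseteq> carrier G \<Longrightarrow> inj_on (\<lambda>t. g \<otimes> t \<otimes> inv g) T"
  by (auto simp: inj_on_def subset_iff)

lemma card_conj_set: "g \<in> carrier G \<Longrightarrow> T \<subseteq> carrier G \<Longrightarrow> card (conj_set G g T) = card T"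
  unfolding conj_set_def by (simp add: card_image conj_set_inj)

lemma subgroup_conj_set: "g \<in> carrier G \<Longrightarrow> subgroup T G \<Longrightarrow> subgroup (conj_set G g T) G"
  unfolding conj_set_def by (rule group_hom.subgroup_img_is_subgroup[OF conj_hom])

lemma conj_set_generate:
  assumes "g \<in> carrier G" "x \<in> carrier G"
  shows "conj_set G g (generate G {x}) = generate G {g \<otimes> x \<otimes> inv g}"
  using group_hom.generate_img[OF conj_hom[OF assms(1)], of "{x}"] assms by (simp add: conj_set_def)

lemma cyclic_conj_set: "g \<in> carrier G \<Longrightarrow> cyclic_subgroup T G \<Longrightarrow> cyclic_subgroup (conj_set G g T) G"
  unfolding cyclic_subgroup_iff using conj_set_generate by fastforce

lemma conj_set_mono: "S \<subseteq> T \<Longrightarrow> conj_set G g S \<subseteq> conj_set G g T"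
  by (auto simp: conj_set_def)

lemma normalizer_eq:
  assumes "T \<subseteq> carrier G"
  shows "normalizer G T = {g \<in> carrier G. conj_set G g T = T}"
  using assms by (auto simp: normalizer_def stabilizer_def coset_conj_eq)

lemma normalizer_in_eq:
  assumes "T \<subseteq> carrier G" "K \<subseteq> carrier G"
  shows "normalizer_in G K T = {g \<in> K. conj_set G g T = T}"
  using assms by (auto simp: normalizer_in_def normalizer_eq)

lemma conj_set_self: "subgroup T G \<Longrightarrow> g \<in> T \<Longrightarrow> conj_set G g T = T"
proof -
  assume T: "subgroup T G" "g \<in> T"
  have sub: "T \<subseteq> carrier G" by (rule subgroup.subset) fact
  have "conj_set G h T \<subseteq> T" if "h \<in> T" for h
    using that T by (auto simp: conj_set_def subgroup.m_closed subgroup.m_inv_closed)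
  from this[OF T(2)] this[of "inv g"] show ?thesis
    using conj_set_mono[of "conj_set G (inv g) T" T g] conj_set_inv(2)[of g T] T sub
    by (auto simp: subgroup.m_inv_closed)
qed

lemma subgroup_normalizer_in:
  assumes "T \<subseteq> carrier G" "subgroup K G"
  shows "subgroup (normalizer_in G K T) G"
  unfolding normalizer_in_def using assms normalizer_imp_subgroup subgroups_Inter_pair by blast

lemma subgroup_index_conj_set:
  assumes "finite (carrier G)" "g \<in> carrier G" "subgroup S G" "subgroup T G" "S \<subseteq> T"
  shows "subgroup_index G (conj_set G g T) (conj_set G g S) = subgroup_index G T S"
proof -
  note f = finite_subgroupD[OF assms(1)]
  have fin: "finite (conj_set G g S)" using f(1)[OF assms(3)] by (simp add: conj_set_def)
  show ?thesis
    using subgroup_index_eq[OF assms(3,4,5) f(1)[OF assms(3)]]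
      subgroup_index_eq[OF subgroup_conj_set[OF assms(2,3)] subgroup_conj_set[OF assms(2,4)] conj_set_mono[OF assms(5)] fin]
      card_conj_set[OF assms(2) f(2)[OF assms(3)]] card_conj_set[OF assms(2) f(2)[OF assms(4)]] by simp
qed

lemma bij_betw_cyclic_over_conj_set:
  assumes "g \<in> carrier G" "T \<subseteq> carrier G"
  shows "bij_betw (conj_set G g) (cyclic_over G T) (cyclic_over G (conj_set G g T))"
proof (rule bij_betw_byWitness[where f' = "conj_set G (inv g)"])
  have car: "\<Gamma> \<subseteq> carrier G" if "cyclic_subgroup \<Gamma> G" for \<Gamma>
    using that cyclic_subgroup_imp_subgroup subgroup.subset by blast
  show "\<forall>\<Gamma>\<in>cyclic_over G T. conj_set G (inv g) (conj_set G g \<Gamma>) = \<Gamma>"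
    using conj_set_inv(1)[OF assms(1)] car by (auto simp: cyclic_over_def)
  show "\<forall>\<Gamma>\<in>cyclic_over G (conj_set G g T). conj_set G g (conj_set G (inv g) \<Gamma>) = \<Gamma>"
    using conj_set_inv(2)[OF assms(1)] car by (auto simp: cyclic_over_def)
  show "conj_set G g ` cyclic_over G T \<subseteq> cyclic_over G (conj_set G g T)"
    using assms(1) by (auto simp: cyclic_over_def cyclic_conj_set dest: conj_set_mono)
  show "conj_set G (inv g) ` cyclic_over G (conj_set G g T) \<subseteq> cyclic_over G T"
  proof
    fix \<Delta> assume "\<Delta> \<in> conj_set G (inv g) ` cyclic_over G (conj_set G g T)"
    then obtain \<Gamma> where \<Gamma>: "\<Delta> = conj_set G (inv g) \<Gamma>" "cyclic_subgroup \<Gamma> G" "conj_set G g T \<subseteq> \<Gamma>"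
      by (auto simp: cyclic_over_def)
    have "T \<subseteq> \<Delta>" using conj_set_mono[OF \<Gamma>(3), of "inv g"] conj_set_inv(1)[OF assms] by (simp add: \<Gamma>(1))
    then show "\<Delta> \<in> cyclic_over G T" using \<Gamma> assms(1) by (simp add: cyclic_over_def cyclic_conj_set)
  qed
qed

lemma finite_cyclic_subgroups: "finite (carrier G) \<Longrightarrow> finite {\<Gamma>. cyclic_subgroup \<Gamma> G}"
  by (rule finite_subset[of _ "Pow (carrier G)"]) (auto simp: cyclic_subgroup_def dest: subgroup.subset)

lemma finite_cyclic_over: "finite (carrier G) \<Longrightarrow> finite (cyclic_over G T)"
  by (rule finite_subset[OF _ finite_cyclic_subgroups]) (auto simp: cyclic_over_def)

end

text \<open>The integer \<open>B(T)\<close> of the overview, for an arbitrary function on subgroups: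
  besides the depth, it is applied to a modification of the depth at the trivial subgroup when the
  coefficients of the Artin character are computed.\<close>

definition moebius_sum :: "('g, 'b) monoid_scheme \<Rightarrow> ('g set \<Rightarrow> int) \<Rightarrow> 'g set \<Rightarrow> int" where
  "moebius_sum J F T = (\<Sum>\<Gamma>\<in>cyclic_over J T. moebius (subgroup_index J \<Gamma> T) * F \<Gamma>)"

context group
begin

lemma moebius_sum_conj_set:
  assumes fin: "finite (carrier G)" and g: "g \<in> carrier G" and T: "subgroup T G"
    and F: "\<And>\<Gamma>. cyclic_subgroup \<Gamma> G \<Longrightarrow> T \<subseteq> \<Gamma> \<Longrightarrow> F (conj_set G g \<Gamma>) = F \<Gamma>"
  shows "moebius_sum G F (conj_set G g T) = moebius_sum G F T"
proof -
  have "moebius_sum G F (conj_set G g T) =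
      (\<Sum>\<Gamma>\<in>cyclic_over G T. moebius (subgroup_index G (conj_set G g \<Gamma>) (conj_set G g T)) * F (conj_set G g \<Gamma>))"
    unfolding moebius_sum_def
    by (rule sum.reindex_bij_betw[OF bij_betw_cyclic_over_conj_set[OF g subgroup.subset[OF T]], symmetric])
  also have "\<dots> = moebius_sum G F T"
    unfolding moebius_sum_def
    by (rule sum.cong) (auto simp: cyclic_over_def F subgroup_index_conj_set[OF fin g T] cyclic_subgroup_imp_subgroup)
  finally show ?thesis .
qed

text \<open>Moebius inversion. After the two sums are exchanged, the inner one runs over the
  subgroups between the group generated by \<sigma> and \<Gamma>, and by
  \<open>sum_moebius_below\<close> it vanishes unless these two coincide.\<close>

lemma sum_moebius_sum:
  assumes fin: "finite (carrier G)" and \<sigma>: "\<sigma> \<in> carrier G"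
  shows "(\<Sum>U | cyclic_subgroup U G \<and> \<sigma> \<in> U. moebius_sum G F U) = F (generate G {\<sigma>})"
proof -
  let ?S = "generate G {\<sigma>}" and ?C = "{\<Gamma>. cyclic_subgroup \<Gamma> G}"
  have S: "subgroup ?S G" using \<sigma> by (simp add: generate_is_subgroup)
  have S_sub: "?S \<subseteq> \<Gamma> \<longleftrightarrow> \<sigma> \<in> \<Gamma>" if "cyclic_subgroup \<Gamma> G" for \<Gamma>
    using generate_subset_iff[OF \<sigma>] that cyclic_subgroup_imp_subgroup by blast
  have finC: "finite ?C" using fin by (rule finite_cyclic_subgroups)
  have "(\<Sum>U | cyclic_subgroup U G \<and> \<sigma> \<in> U. moebius_sum G F U) =
      (\<Sum>U | U \<in> ?C \<and> \<sigma> \<in> U. \<Sum>\<Gamma> | \<Gamma> \<in> {\<Gamma>. \<Gamma> \<in> ?C \<and> \<sigma> \<in> \<Gamma>} \<and> U \<subseteq> \<Gamma>. moebius (subgroup_index G \<Gamma> U) * F \<Gamma>)"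
    unfolding moebius_sum_def cyclic_over_def
    by (intro sum.cong) auto
  also have "\<dots> = (\<Sum>\<Gamma> | \<Gamma> \<in> ?C \<and> \<sigma> \<in> \<Gamma>. \<Sum>U | U \<in> {U. U \<in> ?C \<and> \<sigma> \<in> U} \<and> U \<subseteq> \<Gamma>. moebius (subgroup_index G \<Gamma> U) * F \<Gamma>)"
    by (rule sum.swap_restrict) (use finC in auto)
  also have "\<dots> = (\<Sum>\<Gamma> | \<Gamma> \<in> ?C \<and> \<sigma> \<in> \<Gamma>. \<Sum>U | cyclic_subgroup U G \<and> \<sigma> \<in> U \<and> U \<subseteq> \<Gamma>. moebius (subgroup_index G \<Gamma> U) * F \<Gamma>)"
    by simp
  also have "\<dots> = (\<Sum>\<Gamma> | \<Gamma> \<in> ?C \<and> \<sigma> \<in> \<Gamma>. if \<Gamma> = ?S then F \<Gamma> else 0)"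
  proof (rule sum.cong)
    fix \<Gamma> assume "\<Gamma> \<in> {\<Gamma>. \<Gamma> \<in> ?C \<and> \<sigma> \<in> \<Gamma>}"
    then have \<Gamma>: "cyclic_subgroup \<Gamma> G" "\<sigma> \<in> \<Gamma>" by auto
    have "{U. cyclic_subgroup U G \<and> \<sigma> \<in> U \<and> U \<subseteq> \<Gamma>} = {U. subgroup U G \<and> ?S \<subseteq> U \<and> U \<subseteq> \<Gamma>}"
      using subgroup_of_cyclic[OF fin \<Gamma>(1)] S_sub cyclic_subgroup_imp_subgroup generate_subset_iff[OF \<sigma>] by blast
    then have "(\<Sum>U | cyclic_subgroup U G \<and> \<sigma> \<in> U \<and> U \<subseteq> \<Gamma>. moebius (subgroup_index G \<Gamma> U) * F \<Gamma>)
        = (\<Sum>U | subgroup U G \<and> ?S \<subseteq> U \<and> U \<subseteq> \<Gamma>. moebius (subgroup_index G \<Gamma> U)) * F \<Gamma>"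
      by (simp add: sum_distrib_right)
    also have "\<dots> = (if ?S = \<Gamma> then 1 else 0) * F \<Gamma>"
      using sum_moebius_below[OF fin \<Gamma>(1) S] S_sub[OF \<Gamma>(1)] \<Gamma>(2) by simp
    finally show "(\<Sum>U | cyclic_subgroup U G \<and> \<sigma> \<in> U \<and> U \<subseteq> \<Gamma>. moebius (subgroup_index G \<Gamma> U) * F \<Gamma>)
        = (if \<Gamma> = ?S then F \<Gamma> else 0)" by auto
  qed simp
  also have "\<dots> = F ?S"
    using finC S_sub[OF cyclic_subgroup_generate[OF \<sigma>]] cyclic_subgroup_generate[OF \<sigma>] by (subst sum.delta) auto
  finally show ?thesis .
qed

text \<open>Sending \<open>g\<close> to the conjugate of \<open>T\<close> by \<open>g\<close> maps
  the counted elements onto the conjugates of \<open>T\<close> that contain \<sigma>, and each fibre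
  is a left coset of the normalizer.\<close>

lemma card_conjugators:
  assumes fin: "finite (carrier G)" and T: "subgroup T G" and \<sigma>: "\<sigma> \<in> carrier G"
  shows "card {g \<in> carrier G. inv g \<otimes> \<sigma> \<otimes> g \<in> T} =
    card (normalizer G T) * card {U. conjugate_subgroups G T U \<and> \<sigma> \<in> U}"
proof -
  have Tc: "T \<subseteq> carrier G" using T by (rule subgroup.subset)
  let ?A = "{g \<in> carrier G. inv g \<otimes> \<sigma> \<otimes> g \<in> T}"
  have A: "?A = {g \<in> carrier G. \<sigma> \<in> conj_set G g T}"
    using mem_conj_set_iff[OF _ \<sigma> Tc] by auto
  have img: "(\<lambda>g. conj_set G g T) ` ?A = {U. conjugate_subgroups G T U \<and> \<sigma> \<in> U}"
    unfolding A conjugate_subgroups_def coset_conj_eq by auto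
  have "card {h \<in> ?A. conj_set G h T = conj_set G g T} = card (normalizer G T)" if g: "g \<in> ?A" for g
  proof -
    have gc: "g \<in> carrier G" using g by simp
    have "{h \<in> ?A. conj_set G h T = conj_set G g T} = (\<lambda>n. g \<otimes> n) ` normalizer G T"
    proof (intro equalityI subsetI)
      fix h assume "h \<in> {h \<in> ?A. conj_set G h T = conj_set G g T}"
      then have h: "h \<in> carrier G" "conj_set G h T = conj_set G g T" by auto
      have "inv g \<otimes> h \<in> normalizer G T"
        using h gc Tc by (simp add: normalizer_eq conj_set_mult conj_set_inv)
      moreover have "h = g \<otimes> (inv g \<otimes> h)" using h gc by (simp flip: m_assoc)
      ultimately show "h \<in> (\<lambda>n. g \<otimes> n) ` normalizer G T" by (rule rev_image_eqI)
    next
      fix h assume "h \<in> (\<lambda>n. g \<otimes> n) ` normalizer G T"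
      then show "h \<in> {h \<in> ?A. conj_set G h T = conj_set G g T}"
        using g gc Tc unfolding A by (auto simp: normalizer_eq conj_set_mult)
    qed
    moreover have "inj_on (\<lambda>n. g \<otimes> n) (normalizer G T)"
      using gc Tc by (auto simp: inj_on_def normalizer_eq)
    ultimately show ?thesis by (simp add: card_image)
  qed
  then have "(\<Sum>U\<in>(\<lambda>g. conj_set G g T) ` ?A. card {h \<in> ?A. conj_set G h T = U}) =
      (\<Sum>U\<in>(\<lambda>g. conj_set G g T) ` ?A. card (normalizer G T))"
    by (intro sum.cong) auto
  moreover have "card ?A = (\<Sum>U\<in>(\<lambda>g. conj_set G g T) ` ?A. card {h \<in> ?A. conj_set G h T = U})"
    using sum.image_gen[of ?A "\<lambda>_. 1::nat" "\<lambda>g. conj_set G g T"] fin by simp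
  ultimately show ?thesis unfolding img by simp
qed

lemma conjugate_subgroups_refl: "T \<subseteq> carrier G \<Longrightarrow> conjugate_subgroups G T T"
  unfolding conjugate_subgroups_def coset_conj_eq using conj_set_one by (metis one_closed)

lemma conjugate_subgroups_sym: "T \<subseteq> carrier G \<Longrightarrow> conjugate_subgroups G T U \<Longrightarrow> conjugate_subgroups G U T"
  unfolding conjugate_subgroups_def coset_conj_eq using conj_set_inv(1) by (metis inv_closed)

lemma conjugate_subgroups_trans:
  "T \<subseteq> carrier G \<Longrightarrow> conjugate_subgroups G T U \<Longrightarrow> conjugate_subgroups G U V \<Longrightarrow> conjugate_subgroups G T V"
  unfolding conjugate_subgroups_def coset_conj_eq using conj_set_mult by (metis m_closed)

text \<open>A cyclic subgroup containing \<sigma> is conjugate to exactly one representative, and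
  \<open>B\<close> is constant on classes. This passes from sums over representatives, as in the
  definition of the coefficients, to sums over all cyclic subgroups, which Moebius inversion can
  evaluate.\<close>

lemma sum_class_representatives:
  fixes B :: "'a set \<Rightarrow> int"
  assumes fin: "finite (carrier G)" and R: "cyclic_class_representatives G R" and \<sigma>: "\<sigma> \<in> carrier G"
    and B: "\<And>T U. cyclic_subgroup T G \<Longrightarrow> conjugate_subgroups G T U \<Longrightarrow> B U = B T"
  shows "(\<Sum>T\<in>R. B T * int (card {U. conjugate_subgroups G T U \<and> \<sigma> \<in> U})) =
    (\<Sum>U | cyclic_subgroup U G \<and> \<sigma> \<in> U. B U)"
proof -
  have Rc: "cyclic_subgroup T G" if "T \<in> R" for T using R that by (simp add: cyclic_class_representatives_def)
  have car: "T \<subseteq> carrier G" if "cyclic_subgroup T G" for T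
    using that cyclic_subgroup_imp_subgroup subgroup.subset by blast
  have finR: "finite R" using Rc by (intro finite_subset[OF _ finite_cyclic_subgroups[OF fin]]) auto
  let ?X = "{U. cyclic_subgroup U G \<and> \<sigma> \<in> U}"
  have finX: "finite ?X" using finite_cyclic_subgroups[OF fin] by simp
  define rep where "rep U = (THE T. T \<in> R \<and> conjugate_subgroups G U T)" for U
  have rep: "rep U \<in> R" "conjugate_subgroups G U (rep U)" if "cyclic_subgroup U G" for U
    using theI'[of "\<lambda>T. T \<in> R \<and> conjugate_subgroups G U T"] R that
    unfolding rep_def cyclic_class_representatives_def by blast+
  have rep_iff: "rep U = T \<longleftrightarrow> conjugate_subgroups G T U" if "cyclic_subgroup U G" "T \<in> R" for U T
    using rep[OF that(1)] R that car[OF that(1)] car[OF Rc[OF that(2)]] conjugate_subgroups_sym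
    unfolding cyclic_class_representatives_def by metis
  have conj_cyc: "cyclic_subgroup U G" if "T \<in> R" "conjugate_subgroups G T U" for T U
    using cyclic_conj_set Rc[OF that(1)] that(2) unfolding conjugate_subgroups_def coset_conj_eq by blast
  have "(\<Sum>U\<in>?X. B U) = (\<Sum>T\<in>R. \<Sum>U | U \<in> ?X \<and> rep U = T. B U)"
    by (rule sum.group[symmetric]) (use finX finR rep in auto)
  also have "\<dots> = (\<Sum>T\<in>R. \<Sum>U | conjugate_subgroups G T U \<and> \<sigma> \<in> U. B T)"
  proof (rule sum.cong)
    fix T assume T: "T \<in> R"
    show "(\<Sum>U | U \<in> ?X \<and> rep U = T. B U) = (\<Sum>U | conjugate_subgroups G T U \<and> \<sigma> \<in> U. B T)"
    proof (rule sum.cong)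
      show "{U. U \<in> ?X \<and> rep U = T} = {U. conjugate_subgroups G T U \<and> \<sigma> \<in> U}"
        using rep_iff[OF _ T] conj_cyc[OF T] by auto
    qed (use B[OF Rc[OF T]] in auto)
  qed simp
  also have "\<dots> = (\<Sum>T\<in>R. B T * int (card {U. conjugate_subgroups G T U \<and> \<sigma> \<in> U}))"
    by (simp add: mult.commute)
  finally show ?thesis by simp
qed

lemma class_representatives_exist: "\<exists>R. cyclic_class_representatives G R"
proof -
  \<comment> \<open>Conjugate subgroups give the choice operator the same predicate, hence the same
    value; so \<open>r\<close> is constant on classes.\<close>
  define r where "r T = (SOME U. conjugate_subgroups G T U)" for T
  have car: "T \<subseteq> carrier G" if "cyclic_subgroup T G" for T
    using that cyclic_subgroup_imp_subgroup subgroup.subset by blast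
  have conj_cyc: "cyclic_subgroup U G" if "cyclic_subgroup T G" "conjugate_subgroups G T U" for T U
    using cyclic_conj_set that unfolding conjugate_subgroups_def coset_conj_eq by blast
  have r: "conjugate_subgroups G T (r T)" if "cyclic_subgroup T G" for T
    unfolding r_def using conjugate_subgroups_refl[OF car[OF that]] by (rule someI)
  have r_eq: "r T = r U" if "cyclic_subgroup T G" "conjugate_subgroups G T U" for T U
  proof -
    have "conjugate_subgroups G T V \<longleftrightarrow> conjugate_subgroups G U V" for V
      using conjugate_subgroups_trans conjugate_subgroups_sym car that conj_cyc by metis
    then show ?thesis by (simp add: r_def)
  qed
  have "cyclic_class_representatives G (r ` {T. cyclic_subgroup T G})"
    unfolding cyclic_class_representatives_def
  proof (intro conjI ballI allI impI)
    fix T assume T: "cyclic_subgroup T G"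
    show "\<exists>!U. U \<in> r ` {T. cyclic_subgroup T G} \<and> conjugate_subgroups G T U"
    proof (rule ex1I[of _ "r T"])
      fix U assume "U \<in> r ` {T. cyclic_subgroup T G} \<and> conjugate_subgroups G T U"
      then obtain V where V: "cyclic_subgroup V G" "U = r V" "conjugate_subgroups G T U" by auto
      have "r V = r (r V)" using r_eq[OF V(1) r[OF V(1)]] .
      with r_eq[OF T V(3)] V(2) show "U = r T" by simp
    qed (use T r in auto)
  qed (use r conj_cyc in blast)
  then show ?thesis ..
qed

end

subsection \<open>Group actions with cyclic stabilizers\<close>

text \<open>\<open>BijGroup\<close> consists of extensional bijections, so an action given by total
  functions has to be restricted to its set. Bijectivity comes from the inverse group
  element.\<close>

lemma (in group) group_action_restrict:
  assumes closed: "\<And>g x. g \<in> carrier G \<Longrightarrow> x \<in> E \<Longrightarrow> a g x \<in> E"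
    and one: "\<And>x. x \<in> E \<Longrightarrow> a \<one> x = x"
    and mult: "\<And>g h x. g \<in> carrier G \<Longrightarrow> h \<in> carrier G \<Longrightarrow> x \<in> E \<Longrightarrow> a (g \<otimes> h) x = a g (a h x)"
  shows "group_action G E (\<lambda>g. restrict (a g) E)"
proof -
  have Bij: "restrict (a g) E \<in> Bij E" if g: "g \<in> carrier G" for g
  proof -
    have "bij_betw (a g) E E"
      using closed one mult[of "inv g" g, symmetric] mult[of g "inv g", symmetric] g
      by (intro bij_betw_byWitness[where f' = "a (inv g)"]) auto
    then show ?thesis by (simp add: Bij_def)
  qed
  have "(\<lambda>g. restrict (a g) E) \<in> hom G (BijGroup E)"
  proof (rule homI)
    fix g h assume gh: "g \<in> carrier G" "h \<in> carrier G"
    then show "restrict (a (g \<otimes> h)) E = restrict (a g) E \<otimes>\<^bsub>BijGroup E\<^esub> restrict (a h) E"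
      using Bij closed mult by (auto simp: BijGroup_def compose_def restrict_def fun_eq_iff)
  qed (use Bij in \<open>simp add: BijGroup_def\<close>)
  then show ?thesis
    by (simp add: group_action_def group_hom_def group_hom_axioms_def group_BijGroup is_group)
qed

context group_action
begin

text \<open>On an orbit an invariant function sums to its value times the length of the orbit. The
  later divisibility arguments by orbit counting are instances, often with the constant function
  1.\<close>

lemma dvd_sum_if_dvd_orbit_sums:
  fixes f :: "'c \<Rightarrow> int"
  assumes fin: "finite E" and inv: "\<And>g x. g \<in> carrier G \<Longrightarrow> x \<in> E \<Longrightarrow> f (\<phi> g x) = f x"
    and dvd: "\<And>x. x \<in> E \<Longrightarrow> k dvd int (card (orbit G \<phi> x)) * f x"
  shows "k dvd sum f E"
proof -
  have "k dvd sum f O'" if O: "O' \<in> orbits G E \<phi>" for O'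
  proof -
    obtain x where x: "x \<in> E" "O' = orbit G \<phi> x" using O by (auto simp: orbits_def)
    have "sum f O' = (\<Sum>y\<in>O'. f x)"
      by (rule sum.cong) (use inv x in \<open>auto simp: orbit_def\<close>)
    then show ?thesis using dvd[OF x(1)] x(2) by simp
  qed
  then have "k dvd (\<Sum>O'\<in>orbits G E \<phi>. sum f O')" by (rule dvd_sum)
  then show ?thesis using disjoint_sum[OF fin, of f] by simp
qed

lemma stabilizer_translate:
  assumes g: "g \<in> carrier G" and x: "x \<in> E"
  shows "stabilizer G \<phi> (\<phi> g x) = conj_set G g (stabilizer G \<phi> x)"
proof -
  interpret group G using group_hom group_hom.axioms(1) by auto
  have gx: "\<phi> g x \<in> E" using element_image[OF g x] by simp
  have "h \<in> stabilizer G \<phi> (\<phi> g x) \<longleftrightarrow> inv g \<otimes> h \<otimes> g \<in> stabilizer G \<phi> x" if h: "h \<in> carrier G" for h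
  proof -
    have "\<phi> (inv g \<otimes> (h \<otimes> g)) x = \<phi> (inv g) (\<phi> (h \<otimes> g) x)"
      by (rule composition_rule) (use g h x in auto)
    also have "\<phi> (h \<otimes> g) x = \<phi> h (\<phi> g x)"
      by (rule composition_rule) (use g h x in auto)
    finally have "\<phi> (inv g \<otimes> h \<otimes> g) x = \<phi> (inv g) (\<phi> h (\<phi> g x))"
      using g h by (simp add: m_assoc)
    moreover have "\<phi> (inv g) y = x \<longleftrightarrow> y = \<phi> g x" if "y \<in> E" for y
      using orbit_sym_aux[OF g x] orbit_sym_aux[of "inv g" y] that g by auto
    ultimately show ?thesis
      using g h element_image[OF h gx] by (simp add: stabilizer_def)
  qed
  moreover have "h \<in> conj_set G g (stabilizer G \<phi> x) \<longleftrightarrow> inv g \<otimes> h \<otimes> g \<in> stabilizer G \<phi> x"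
    if "h \<in> carrier G" for h
    by (rule mem_conj_set_iff[OF g that stabilizer_subset])
  ultimately show ?thesis
    using stabilizer_subset conj_set_subset_carrier[OF g stabilizer_subset] by blast
qed

text \<open>Exchanging the sums leaves, for each point \<open>x\<close>, the Moebius sum over the
  cyclic groups between \<open>T\<close> and the stabilizer of \<open>x\<close>. Since this
  stabilizer is cyclic, \<open>sum_moebius_above\<close> evaluates it to 1 if the stabilizer is
  \<open>T\<close> and to 0 otherwise.\<close>

lemma moebius_sum_fixed_points:
  assumes fin: "finite (carrier G)" "finite E"
    and cyc: "\<And>x. x \<in> E \<Longrightarrow> cyclic_subgroup (stabilizer G \<phi> x) G"
    and T: "cyclic_subgroup T G"
    and F: "\<And>\<Gamma>. \<Gamma> \<in> cyclic_over G T \<Longrightarrow> F \<Gamma> = int (card {x \<in> E. \<Gamma> \<subseteq> stabilizer G \<phi> x})"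
  shows "moebius_sum G F T = int (card {x \<in> E. stabilizer G \<phi> x = T})"
proof -
  interpret group G using group_hom group_hom.axioms(1) by auto
  let ?st = "stabilizer G \<phi>" and ?\<mu> = "\<lambda>\<Gamma>. moebius (subgroup_index G \<Gamma> T)"
  have finC: "finite (cyclic_over G T)" using fin(1) by (rule finite_cyclic_over)
  have "moebius_sum G F T = (\<Sum>\<Gamma>\<in>cyclic_over G T. \<Sum>x | x \<in> E \<and> \<Gamma> \<subseteq> ?st x. ?\<mu> \<Gamma>)"
    unfolding moebius_sum_def by (rule sum.cong) (auto simp: F mult.commute)
  also have "\<dots> = (\<Sum>x\<in>E. \<Sum>\<Gamma> | \<Gamma> \<in> cyclic_over G T \<and> \<Gamma> \<subseteq> ?st x. ?\<mu> \<Gamma>)"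
    by (rule sum.swap_restrict[OF finC fin(2)])
  also have "\<dots> = (\<Sum>x\<in>E. if ?st x = T then 1 else 0)"
  proof (rule sum.cong)
    fix x assume x: "x \<in> E"
    show "(\<Sum>\<Gamma> | \<Gamma> \<in> cyclic_over G T \<and> \<Gamma> \<subseteq> ?st x. ?\<mu> \<Gamma>) = (if ?st x = T then 1 else 0)"
    proof (cases "T \<subseteq> ?st x")
      case True
      then show ?thesis
        using sum_moebius_above[OF fin(1) cyc[OF x] cyclic_subgroup_imp_subgroup[OF T]] by auto
    next
      case False
      then have "{\<Gamma>. \<Gamma> \<in> cyclic_over G T \<and> \<Gamma> \<subseteq> ?st x} = {}" by (auto simp: cyclic_over_def)
      with False show ?thesis by (auto simp del: Collect_empty_eq)
    qed
  qed simp
  also have "\<dots> = int (card {x \<in> E. ?st x = T})"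
    using fin(2) by (simp add: sum.If_cases Int_def)
  finally show ?thesis .
qed

text \<open>The normalizer of \<open>T\<close> permutes the points with stabilizer exactly
  \<open>T\<close>, and modulo \<open>T\<close> it acts freely on them, so all its orbits there have
  length \<open>[N(T) : T]\<close>.\<close>

lemma index_dvd_card_stabilizer_eq:
  assumes fin: "finite (carrier G)" "finite E" and T: "subgroup T G"
  shows "subgroup_index G (normalizer G T) T dvd card {x \<in> E. stabilizer G \<phi> x = T}"
proof -
  interpret group G using group_hom group_hom.axioms(1) by auto
  have Tc: "T \<subseteq> carrier G" using T by (rule subgroup.subset)
  let ?N = "normalizer G T" and ?E = "{x \<in> E. stabilizer G \<phi> x = T}"
  let ?K = "G\<lparr>carrier := ?N\<rparr>" and ?\<phi> = "\<lambda>g. restrict (\<phi> g) ?E"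
  have N: "subgroup ?N G" using Tc by (rule normalizer_imp_subgroup)
  have Nc: "g \<in> carrier G" if "g \<in> ?N" for g using N that by (rule subgroup.mem_carrier)
  interpret K: group ?K using N by (rule subgroup_imp_group)
  have TN: "T \<subseteq> ?N" using conj_set_self[OF T] Tc by (auto simp: normalizer_eq)
  interpret K: group_action ?K ?E ?\<phi>
  proof (rule K.group_action_restrict)
    fix g x assume "g \<in> carrier ?K" "x \<in> ?E"
    then show "\<phi> g x \<in> ?E"
      using stabilizer_translate[of g x] element_image[of g x] Tc by (auto simp: normalizer_eq)
  next
    fix x assume "x \<in> ?E" then show "\<phi> \<one>\<^bsub>?K\<^esub> x = x" by (simp flip: id_eq_one)
  next
    fix g h x assume "g \<in> carrier ?K" "h \<in> carrier ?K" "x \<in> ?E"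
    then show "\<phi> (g \<otimes>\<^bsub>?K\<^esub> h) x = \<phi> g (\<phi> h x)" using Nc composition_rule by simp
  qed
  have "subgroup_index G ?N T = card (orbit ?K ?\<phi> x)" if x: "x \<in> ?E" for x
  proof -
    have "stabilizer ?K ?\<phi> x = T"
      using x TN Nc by (auto simp: stabilizer_def)
    then have "card (orbit ?K ?\<phi> x) * card T = card ?N"
      using K.orbit_stabilizer_theorem[OF x] by (simp add: Coset.order_def)
    then have "card ?N div card T = card (orbit ?K ?\<phi> x)"
      using finite_subgroupD(3)[OF fin(1) T] by (auto simp flip: \<open>_ = card ?N\<close>)
    then show ?thesis
      using subgroup_index_eq[OF T N TN finite_subgroupD(1)[OF fin(1) T]] by simp
  qed
  then have "int (subgroup_index G ?N T) dvd (\<Sum>x\<in>?E. 1)"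
    using fin(2) by (intro K.dvd_sum_if_dvd_orbit_sums) simp_all
  then show ?thesis by simp
qed

text \<open>All orbit lengths are powers of \<open>q\<close>; if none of them were 1, then
  \<open>q\<close> would divide \<open>card E\<close>.\<close>

lemma p_group_fixed_point:
  assumes fin: "finite (carrier G)" "finite E" and q: "Factorial_Ring.prime q" "Coset.order G = q ^ n"
    and nd: "\<not> q dvd card E"
  shows "\<exists>x\<in>E. stabilizer G \<phi> x = carrier G"
proof (rule ccontr)
  assume neg: "\<not> ?thesis"
  have "int q dvd int (card (orbit G \<phi> x)) * 1" if x: "x \<in> E" for x
  proof -
    have os: "card (orbit G \<phi> x) * card (stabilizer G \<phi> x) = q ^ n"
      using orbit_stabilizer_theorem[OF x] q(2) by simp
    then obtain i where i: "card (orbit G \<phi> x) = q ^ i"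
      using divides_primepow_nat[OF q(1)] by (metis dvd_triv_left)
    have "i \<noteq> 0"
    proof
      assume "i = 0"
      then have "card (stabilizer G \<phi> x) = card (carrier G)"
        using os i q(2) by (simp add: Coset.order_def)
      then show False using neg x card_subset_eq[OF fin(1) stabilizer_subset] by blast
    qed
    then show ?thesis by (simp add: i)
  qed
  then have "int q dvd (\<Sum>x\<in>E. 1)"
    using fin(2) by (intro dvd_sum_if_dvd_orbit_sums) simp_all
  then show False using nd by simp
qed

end

subsection \<open>The Bertin obstruction and the coefficients of the Artin character\<close>

context group
begin

lemma l_coset_eq_iff:
  assumes "subgroup T G" "x \<in> carrier G" "y \<in> carrier G"
  shows "x <# T = y <# T \<longleftrightarrow> inv y \<otimes> x \<in> T"
proof
  have Tc: "T \<subseteq> carrier G" using assms(1) by (rule subgroup.subset)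
  { assume "x <# T = y <# T"
    then have "x \<in> y <# T" using subgroup.one_closed[OF assms(1)] assms(2) by (force simp: l_coset_def)
    then show "inv y \<otimes> x \<in> T" using assms Tc by (auto simp: l_coset_def inv_mult_cancel) }
  assume *: "inv y \<otimes> x \<in> T"
  have "x <# T = y <# ((inv y \<otimes> x) <# T)"
    using assms Tc by (simp add: lcos_m_assoc inv_mult_cancel)
  also have "(inv y \<otimes> x) <# T = T" using * assms by (simp add: coset_join3)
  finally show "x <# T = y <# T" .
qed

text \<open>The coset of \<open>g\<close> is fixed by \<sigma> exactly when the conjugate of
  \<sigma> by the inverse of \<open>g\<close> lies in \<open>T\<close>; each fixed coset is counted
  once for each of its elements. Combined with \<open>card_conjugators\<close>, this is the
  permutation character of G/T.\<close>

lemma card_fixed_l_cosets: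
  assumes fin: "finite (carrier G)" and T: "subgroup T G" and \<sigma>: "\<sigma> \<in> carrier G"
  shows "card {A \<in> (\<lambda>g. g <# T) ` carrier G. \<sigma> <# A = A} * card T = card {g \<in> carrier G. inv g \<otimes> \<sigma> \<otimes> g \<in> T}"
proof -
  have Tc: "T \<subseteq> carrier G" using T by (rule subgroup.subset)
  let ?A = "{g \<in> carrier G. inv g \<otimes> \<sigma> \<otimes> g \<in> T}"
  have fixed: "\<sigma> <# (g <# T) = g <# T \<longleftrightarrow> g \<in> ?A" if "g \<in> carrier G" for g
    using that \<sigma> Tc l_coset_eq_iff[OF T, of "\<sigma> \<otimes> g" g] by (simp add: lcos_m_assoc m_assoc)
  then have img: "(\<lambda>g. g <# T) ` ?A = {A \<in> (\<lambda>g. g <# T) ` carrier G. \<sigma> <# A = A}" by auto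
  have "card {h \<in> ?A. h <# T = g <# T} = card T" if g: "g \<in> ?A" for g
  proof -
    have gc: "g \<in> carrier G" using g by simp
    have "h \<in> ?A" if "h \<in> carrier G" "h <# T = g <# T" for h
      using fixed[OF gc] fixed[OF that(1)] that(2) g by simp
    then have "{h \<in> ?A. h <# T = g <# T} = {h \<in> carrier G. h <# T = g <# T}" by auto
    also have "\<dots> = (\<lambda>t. g \<otimes> t) ` T"
    proof (intro equalityI subsetI)
      fix h assume "h \<in> {h \<in> carrier G. h <# T = g <# T}"
      then have h: "h \<in> carrier G" "inv g \<otimes> h \<in> T" using l_coset_eq_iff[OF T _ gc] by auto
      then show "h \<in> (\<lambda>t. g \<otimes> t) ` T" using gc by (intro rev_image_eqI[OF h(2)]) (simp add: inv_mult_cancel)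
    next
      fix h assume "h \<in> (\<lambda>t. g \<otimes> t) ` T"
      then obtain t where t: "t \<in> T" "h = g \<otimes> t" by auto
      then have "h \<in> carrier G" "inv g \<otimes> h \<in> T" using gc Tc by (auto simp: inv_mult_cancel)
      then show "h \<in> {h \<in> carrier G. h <# T = g <# T}"
        using l_coset_eq_iff[OF T _ gc] by simp
    qed
    finally show ?thesis using gc Tc by (simp add: card_image inj_on_def subset_iff)
  qed
  then have "(\<Sum>B\<in>(\<lambda>g. g <# T) ` ?A. card {h \<in> ?A. h <# T = B}) = (\<Sum>B\<in>(\<lambda>g. g <# T) ` ?A. card T)"
    by (intro sum.cong) auto
  moreover have "card ?A = (\<Sum>B\<in>(\<lambda>g. g <# T) ` ?A. card {h \<in> ?A. h <# T = B})"
    using sum.image_gen[of ?A "\<lambda>_. 1::nat" "\<lambda>g. g <# T"] fin by simp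
  ultimately show ?thesis unfolding img by simp
qed

lemma subset_normalizer: "subgroup T G \<Longrightarrow> T \<subseteq> normalizer G T"
  using conj_set_self subgroup.subset by (fastforce simp: normalizer_eq)

lemma normalizer_index_card:
  assumes "finite (carrier G)" "subgroup T G"
  shows "subgroup_index G (normalizer G T) T * card T = card (normalizer G T)"
    and "subgroup_index G (normalizer G T) T > 0"
proof -
  have N: "subgroup (normalizer G T) G" by (rule normalizer_imp_subgroup[OF subgroup.subset[OF assms(2)]])
  note d = subgroup_card_dvd[OF assms(2) N subset_normalizer[OF assms(2)]]
  note f = finite_subgroupD[OF assms]
  show "subgroup_index G (normalizer G T) T * card T = card (normalizer G T)"
    using subgroup_index_eq[OF assms(2) N subset_normalizer[OF assms(2)] f(1)] d by simp
  then show "subgroup_index G (normalizer G T) T > 0"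
    using finite_subgroupD(3)[OF assms(1) N] by (metis gr0I mult_0 less_irrefl)
qed

text \<open>In this form the factor \<open>[N(T) : T]\<close> is visible: it is the denominator of
  the coefficients in \<open>artin_coeff_eq\<close>.\<close>

lemma induced_class_fun_one:
  assumes fin: "finite (carrier G)" and T: "subgroup T G" and \<sigma>: "\<sigma> \<in> carrier G"
  shows "induced_class_fun G T (\<lambda>_. 1) \<sigma> =
    of_nat (subgroup_index G (normalizer G T) T) * of_nat (card {U. conjugate_subgroups G T U \<and> \<sigma> \<in> U})"
proof -
  have "card {g \<in> carrier G. inv g \<otimes> \<sigma> \<otimes> g \<in> T} =
      subgroup_index G (normalizer G T) T * card {U. conjugate_subgroups G T U \<and> \<sigma> \<in> U} * card T"
    unfolding card_conjugators[OF fin T \<sigma>] normalizer_index_card(1)[OF fin T, symmetric] by simp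
  moreover have "card T > 0" using finite_subgroupD(3)[OF fin T] .
  ultimately show ?thesis by (simp add: induced_class_fun_def)
qed

text \<open>The required set is a disjoint union of coset spaces, in which G/T occurs
  \<open>B(T) / [N(T) : T]\<close> times. An element \<sigma> then has as many fixed points as the
  sum of \<open>B(U)\<close> over the cyclic \<open>U\<close> containing \<sigma>, and Moebius
  inversion turns this into the depth.\<close>

lemma bertin_obstruction_vanishesI:
  fixes \<psi> :: "'a \<Rightarrow> 'k::field fps \<Rightarrow> 'k fps"
  assumes fin: "finite (carrier G)"
    and F: "\<And>\<sigma>. \<sigma> \<in> carrier G \<Longrightarrow> \<sigma> \<noteq> \<one> \<Longrightarrow> int (subdegree (\<psi> \<sigma> fps_X - fps_X)) = F (generate G {\<sigma>})"
    and F_conj: "\<And>g \<Gamma>. g \<in> carrier G \<Longrightarrow> cyclic_subgroup \<Gamma> G \<Longrightarrow> F (conj_set G g \<Gamma>) = F \<Gamma>"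
    and pos: "\<And>T. cyclic_subgroup T G \<Longrightarrow> T \<noteq> {\<one>} \<Longrightarrow> 0 \<le> moebius_sum G F T"
    and dvd: "\<And>T. cyclic_subgroup T G \<Longrightarrow> T \<noteq> {\<one>} \<Longrightarrow>
      int (subgroup_index G (normalizer G T) T) dvd moebius_sum G F T"
  shows "bertin_obstruction_vanishes G \<psi>"
proof -
  obtain R where R: "cyclic_class_representatives G R" using class_representatives_exist by blast
  have Rc: "cyclic_subgroup T G" if "T \<in> R" for T using R that by (simp add: cyclic_class_representatives_def)
  have Rs: "subgroup T G" if "T \<in> R" for T using Rc[OF that] by (rule cyclic_subgroup_imp_subgroup)
  have Rcar: "T \<subseteq> carrier G" if "T \<in> R" for T using Rs[OF that] by (rule subgroup.subset)
  have finR: "finite R" using Rc by (intro finite_subset[OF _ finite_cyclic_subgroups[OF fin]]) auto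
  let ?R = "R - {{\<one>}}" and ?B = "moebius_sum G F" and ?L = "\<lambda>T. (\<lambda>g. g <# T) ` carrier G"
  define idx where "idx T = subgroup_index G (normalizer G T) T" for T
  define n where "n T = nat (?B T div int (idx T))" for T
  have n: "int (n T) * int (idx T) = ?B T" if "T \<in> ?R" for T
    using pos[of T] dvd[of T] Rc that normalizer_index_card(2)[OF fin Rs, of T]
    by (auto simp: n_def idx_def pos_imp_zdiv_nonneg_iff)
  \<comment> \<open>The label \<open>i\<close> keeps the \<open>n T\<close> copies of G/T apart. The
    trivial subgroup is left out because free orbits would have trivial stabilizers.\<close>
  define E where "E = Sigma ?R (\<lambda>T. {..<n T} \<times> ?L T)"
  define a where "a h = (\<lambda>(T::'a set, i::nat, A). (T, i, l_coset G h A))" for h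
  have finE: "finite E" unfolding E_def using finR fin by auto
  have a_closed: "a h e \<in> E" if "h \<in> carrier G" "e \<in> E" for h e
    using that Rcar by (auto simp: E_def a_def lcos_m_assoc)
  have a_mult: "a (g \<otimes> h) e = a g (a h e)" if "g \<in> carrier G" "h \<in> carrier G" "e \<in> E" for g h e
    using that Rcar by (auto simp: E_def a_def lcos_m_assoc m_assoc)
  have a_one: "a \<one> e = e" if "e \<in> E" for e
    using that Rcar by (auto simp: E_def a_def lcos_m_assoc)
  have a_stab: "cyclic_subgroup {h \<in> carrier G. a h e = e} G \<and> {h \<in> carrier G. a h e = e} \<noteq> {\<one>}" if "e \<in> E" for e
  proof -
    obtain T i g where e: "e = (T, i, g <# T)" "T \<in> ?R" "g \<in> carrier G" using \<open>e \<in> E\<close> by (auto simp: E_def)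
    have T: "T \<in> R" using e by simp
    have "a h e = e \<longleftrightarrow> h \<in> conj_set G g T" if "h \<in> carrier G" for h
      using that e(3) Rcar[OF T] l_coset_eq_iff[OF Rs[OF T], of "h \<otimes> g" g] mem_conj_set_iff[OF e(3) that Rcar[OF T]]
      by (simp add: e(1) a_def lcos_m_assoc m_assoc)
    then have st: "{h \<in> carrier G. a h e = e} = conj_set G g T"
      using conj_set_subset_carrier[OF e(3) Rcar[OF T]] by auto
    moreover have "conj_set G g T \<noteq> {\<one>}"
    proof
      assume "conj_set G g T = {\<one>}"
      then have "T = conj_set G (inv g) {\<one>}" using conj_set_inv(1)[OF e(3) Rcar[OF T]] by simp
      also have "\<dots> = {\<one>}" using e(3) by (simp add: conj_set_def)
      finally show False using e(2) by simp
    qed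
    ultimately show ?thesis using cyclic_conj_set[OF e(3) Rc[OF T]] by simp
  qed
  have fixed: "int (card {e \<in> E. a \<sigma> e = e}) = F (generate G {\<sigma>})" if \<sigma>: "\<sigma> \<in> carrier G" "\<sigma> \<noteq> \<one>" for \<sigma>
  proof -
    let ?U = "\<lambda>T. {U. conjugate_subgroups G T U \<and> \<sigma> \<in> U}"
    have "{e \<in> E. a \<sigma> e = e} = Sigma ?R (\<lambda>T. {..<n T} \<times> {A \<in> ?L T. \<sigma> <# A = A})"
      by (auto simp: E_def a_def)
    then have "card {e \<in> E. a \<sigma> e = e} = (\<Sum>T\<in>?R. n T * card {A \<in> ?L T. \<sigma> <# A = A})"
      using finR fin by (simp add: card_cartesian_product)
    then have "int (card {e \<in> E. a \<sigma> e = e}) = (\<Sum>T\<in>?R. int (n T) * int (card {A \<in> ?L T. \<sigma> <# A = A}))"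
      by simp
    also have "\<dots> = (\<Sum>T\<in>?R. ?B T * int (card (?U T)))"
    proof (rule sum.cong)
      fix T assume T: "T \<in> ?R"
      then have Ts: "subgroup T G" using Rs by simp
      have "card {A \<in> ?L T. \<sigma> <# A = A} * card T = idx T * card (?U T) * card T"
        unfolding card_fixed_l_cosets[OF fin Ts \<sigma>(1)] card_conjugators[OF fin Ts \<sigma>(1)]
          normalizer_index_card(1)[OF fin Ts, symmetric] idx_def by simp
      then have "card {A \<in> ?L T. \<sigma> <# A = A} = idx T * card (?U T)"
        using finite_subgroupD(3)[OF fin Ts] mult_right_cancel[of "card T"] by blast
      then show "int (n T) * int (card {A \<in> ?L T. \<sigma> <# A = A}) = ?B T * int (card (?U T))"
        using n[OF T] by (simp add: mult.assoc)
    qed simp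
    also have "\<dots> = (\<Sum>T\<in>R. ?B T * int (card (?U T)))"
    proof (rule sum.mono_neutral_left)
      have "?U {\<one>} = {}"
        using \<sigma>(2) unfolding conjugate_subgroups_def coset_conj_eq by (auto simp: conj_set_def)
      then have "card (?U {\<one>}) = 0" by (simp only: card.empty)
      moreover have "R - ?R \<subseteq> {{\<one>}}" by blast
      ultimately show "\<forall>T\<in>R - ?R. ?B T * int (card (?U T)) = 0" by fastforce
    qed (use finR in auto)
    also have "\<dots> = (\<Sum>U | cyclic_subgroup U G \<and> \<sigma> \<in> U. ?B U)"
    proof (rule sum_class_representatives[OF fin R \<sigma>(1)])
      fix T U assume T: "cyclic_subgroup T G" "conjugate_subgroups G T U"
      then obtain g where g: "g \<in> carrier G" "U = conj_set G g T"
        unfolding conjugate_subgroups_def coset_conj_eq by auto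
      show "?B U = ?B T" unfolding g(2)
        by (rule moebius_sum_conj_set[OF fin g(1) cyclic_subgroup_imp_subgroup[OF T(1)]]) (rule F_conj[OF g(1)])
    qed
    also have "\<dots> = F (generate G {\<sigma>})" by (rule sum_moebius_sum[OF fin \<sigma>(1)])
    finally show ?thesis .
  qed
  \<comment> \<open>The definition asks for a set of natural numbers, so the action is transported
    along a bijection with an initial segment.\<close>
  obtain h where h: "bij_betw h E {0..<card E}" using ex_bij_betw_finite_nat[OF finE] by blast
  let ?S = "{0..<card E}"
  define h' where "h' = inv_into E h"
  have h': "h' s \<in> E" "h (h' s) = s" if "s \<in> ?S" for s
    using that h unfolding h'_def by (auto simp: bij_betw_def f_inv_into_f inv_into_into)
  have hS: "h e \<in> ?S" "h' (h e) = e" if "e \<in> E" for e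
    using that h unfolding h'_def by (auto simp: bij_betw_def)
  define b where "b g s = h (a g (h' s))" for g s
  define act where "act = (\<lambda>g. restrict (b g) ?S)"
  interpret A: group_action G ?S act
    unfolding act_def
  proof (rule group_action_restrict)
    fix g k s assume "g \<in> carrier G" "k \<in> carrier G" "s \<in> ?S"
    then show "b (g \<otimes> k) s = b g (b k s)" using h' hS a_mult a_closed by (simp add: b_def)
  next
    fix g s assume "g \<in> carrier G" "s \<in> ?S"
    then show "b g s \<in> ?S" using h' hS(1) a_closed by (auto simp: b_def)
  next
    fix s assume "s \<in> ?S"
    then show "b \<one> s = s" using h' a_one by (simp add: b_def)
  qed
  have act_eq: "act g s = s \<longleftrightarrow> a g (h' s) = h' s" if "g \<in> carrier G" "s \<in> ?S" for g s
    using that h'[OF that(2)] hS(2)[OF a_closed[OF that(1) h'(1)[OF that(2)]]]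
    by (simp add: act_def b_def) metis
  have stab: "stabilizer G act s \<noteq> {\<one>} \<and> cyclic_subgroup (stabilizer G act s) G" if s: "s \<in> ?S" for s
  proof -
    have "stabilizer G act s = {g \<in> carrier G. a g (h' s) = h' s}"
      using act_eq[OF _ s] by (auto simp: stabilizer_def)
    then show ?thesis using a_stab[OF h'(1)[OF s]] by simp
  qed
  have inv: "int (card (invariants ?S act \<sigma>)) = - artin_character G \<psi> \<sigma>" if \<sigma>: "\<sigma> \<in> carrier G" "\<sigma> \<noteq> \<one>" for \<sigma>
  proof -
    have "invariants ?S act \<sigma> = h ` {e \<in> E. a \<sigma> e = e}"
    proof (intro equalityI subsetI)
      fix s assume "s \<in> invariants ?S act \<sigma>"
      then have s: "s \<in> ?S" "act \<sigma> s = s" by (auto simp: invariants_def)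
      then have "h' s \<in> {e \<in> E. a \<sigma> e = e}" using act_eq[OF \<sigma>(1) s(1)] h'(1)[OF s(1)] by simp
      then show "s \<in> h ` {e \<in> E. a \<sigma> e = e}" using h'(2)[OF s(1)] by (intro image_eqI[where x = "h' s"]) auto
    next
      fix s assume "s \<in> h ` {e \<in> E. a \<sigma> e = e}"
      then obtain e where e: "s = h e" "e \<in> E" "a \<sigma> e = e" by auto
      then show "s \<in> invariants ?S act \<sigma>"
        using act_eq[OF \<sigma>(1) hS(1)[OF e(2)]] hS[OF e(2)] by (simp add: invariants_def)
    qed
    moreover have "inj_on h {e \<in> E. a \<sigma> e = e}" using h by (auto simp: bij_betw_def inj_on_def)
    ultimately show ?thesis
      using fixed[OF \<sigma>] F[OF \<sigma>] \<sigma>(2) by (simp add: card_image artin_character_def)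
  qed
  \<comment> \<open>The multiplicity is read off from Burnside's formula. The fixed points of all
    elements add up to \<open>m\<close> times the order of the group, and those of the non-trivial
    elements add up to the Artin character at the identity; the difference is the number of fixed
    points of the identity.\<close>
  define m where "m = int (card (orbits G ?S act))"
  have main: "int (card (invariants ?S act \<sigma>)) = m * regular_character G \<sigma> - artin_character G \<psi> \<sigma>"
    if \<sigma>: "\<sigma> \<in> carrier G" for \<sigma>
  proof (cases "\<sigma> = \<one>")
    case True
    have "m * int (Coset.order G) = (\<Sum>g\<in>carrier G. int (card (invariants ?S act g)))"
      using A.burnside[OF fin] by (simp add: m_def flip: of_nat_mult of_nat_sum)
    also have "\<dots> = int (card (invariants ?S act \<one>)) + (\<Sum>g\<in>carrier G - {\<one>}. int (card (invariants ?S act g)))"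
      by (rule sum.remove) (use fin in simp_all)
    also have "(\<Sum>g\<in>carrier G - {\<one>}. int (card (invariants ?S act g))) = artin_character G \<psi> \<one>"
      unfolding artin_character_def using inv by (auto intro!: sum.cong simp: artin_character_def)
    finally show ?thesis by (simp add: True regular_character_def)
  next
    case False
    then show ?thesis using inv[OF \<sigma>] by (simp add: regular_character_def)
  qed
  show ?thesis
    unfolding bertin_obstruction_vanishes_def
    by (rule exI[of _ ?S], rule exI[of _ act], intro conjI ballI exI[of _ m])
      (simp_all only: finite_atLeastLessThan A.group_action_axioms main stab not_False_eq_True)
qed

text \<open>Away from the identity the regular character vanishes, so fixed points count the depth.
  They are described by containment in the stabilizer, which is the form that
  \<open>moebius_sum_fixed_points\<close> expects.\<close>

lemma bertin_obstruction_vanishesE: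
  fixes \<psi> :: "'a \<Rightarrow> 'k::field fps \<Rightarrow> 'k fps"
  assumes "bertin_obstruction_vanishes G \<psi>"
  obtains S :: "nat set" and act where "finite S" "group_action G S act"
    "\<And>s. s \<in> S \<Longrightarrow> cyclic_subgroup (stabilizer G act s) G"
    "\<And>\<sigma>. \<sigma> \<in> carrier G \<Longrightarrow> \<sigma> \<noteq> \<one> \<Longrightarrow>
      card {s \<in> S. generate G {\<sigma>} \<subseteq> stabilizer G act s} = subdegree (\<psi> \<sigma> fps_X - fps_X)"
proof -
  obtain S :: "nat set" and act m where S: "finite S" "group_action G S act"
    "\<And>s. s \<in> S \<Longrightarrow> cyclic_subgroup (stabilizer G act s) G"
    "\<And>\<sigma>. \<sigma> \<in> carrier G \<Longrightarrow> int (card (invariants S act \<sigma>)) = m * regular_character G \<sigma> - artin_character G \<psi> \<sigma>"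
    using assms unfolding bertin_obstruction_vanishes_def by blast
  interpret A: group_action G S act by fact
  have "card {s \<in> S. generate G {\<sigma>} \<subseteq> stabilizer G act s} = subdegree (\<psi> \<sigma> fps_X - fps_X)"
    if \<sigma>: "\<sigma> \<in> carrier G" "\<sigma> \<noteq> \<one>" for \<sigma>
  proof -
    have "{s \<in> S. generate G {\<sigma>} \<subseteq> stabilizer G act s} = invariants S act \<sigma>"
      using generate_subset_iff[OF \<sigma>(1) A.stabilizer_subgroup] \<sigma>(1) by (auto simp: invariants_def stabilizer_def)
    then show ?thesis using S(4)[OF \<sigma>(1)] \<sigma>(2) by (simp add: artin_character_def regular_character_def)
  qed
  with S(1-3) show ?thesis by (rule that)
qed

lemma bertin_obstruction_vanishesD:
  fixes \<psi> :: "'a \<Rightarrow> 'k::field fps \<Rightarrow> 'k fps"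
  assumes fin: "finite (carrier G)" and bertin: "bertin_obstruction_vanishes G \<psi>"
    and F: "\<And>\<sigma>. \<sigma> \<in> carrier G \<Longrightarrow> \<sigma> \<noteq> \<one> \<Longrightarrow> int (subdegree (\<psi> \<sigma> fps_X - fps_X)) = F (generate G {\<sigma>})"
    and T: "cyclic_subgroup T G" "T \<noteq> {\<one>}"
  shows "0 \<le> moebius_sum G F T" and "int (subgroup_index G (normalizer G T) T) dvd moebius_sum G F T"
proof -
  obtain S :: "nat set" and act where S: "finite S" "group_action G S act"
    "\<And>s. s \<in> S \<Longrightarrow> cyclic_subgroup (stabilizer G act s) G"
    "\<And>\<sigma>. \<sigma> \<in> carrier G \<Longrightarrow> \<sigma> \<noteq> \<one> \<Longrightarrow>
      card {s \<in> S. generate G {\<sigma>} \<subseteq> stabilizer G act s} = subdegree (\<psi> \<sigma> fps_X - fps_X)"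
    using bertin by (rule bertin_obstruction_vanishesE) blast
  interpret A: group_action G S act by fact
  have "moebius_sum G F T = int (card {s \<in> S. stabilizer G act s = T})"
  proof (rule A.moebius_sum_fixed_points[OF fin S(1,3) T(1)])
    fix \<Gamma> assume \<Gamma>: "\<Gamma> \<in> cyclic_over G T"
    then obtain \<sigma> where \<sigma>: "\<sigma> \<in> carrier G" "\<Gamma> = generate G {\<sigma>}"
      by (auto simp: cyclic_over_def cyclic_subgroup_iff)
    have "\<Gamma> \<noteq> {\<one>}"
      using \<Gamma> T subgroup.one_closed[OF cyclic_subgroup_imp_subgroup[OF T(1)]] by (auto simp: cyclic_over_def)
    then show "F \<Gamma> = int (card {s \<in> S. \<Gamma> \<subseteq> stabilizer G act s})"
      using F[OF \<sigma>(1)] S(4)[OF \<sigma>(1)] generate_eq_one_iff[OF \<sigma>(1)] \<sigma>(2) by simp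
  qed
  then show "0 \<le> moebius_sum G F T" "int (subgroup_index G (normalizer G T) T) dvd moebius_sum G F T"
    using A.index_dvd_card_stabilizer_eq[OF fin S(1) cyclic_subgroup_imp_subgroup[OF T(1)]] by simp_all
qed

lemma normalizer_index_conj_set:
  assumes fin: "finite (carrier G)" and g: "g \<in> carrier G" and Ts: "subgroup T G"
  shows "subgroup_index G (normalizer G (conj_set G g T)) (conj_set G g T) = subgroup_index G (normalizer G T) T"
proof -
  have Tc: "T \<subseteq> carrier G" using Ts by (rule subgroup.subset)
  have Nc: "normalizer G T \<subseteq> carrier G" using Tc by (auto simp: normalizer_eq)
  have "normalizer G (conj_set G g T) = conj_set G g (normalizer G T)"
  proof (rule Set.set_eqI)
    fix x
    show "x \<in> normalizer G (conj_set G g T) \<longleftrightarrow> x \<in> conj_set G g (normalizer G T)"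
    proof (cases "x \<in> carrier G")
      case True
      have "conj_set G x (conj_set G g T) = conj_set G g T \<longleftrightarrow> conj_set G (inv g) (conj_set G x (conj_set G g T)) = T"
        using conj_set_inv[OF g] Tc True g by (metis conj_set_subset_carrier)
      then show ?thesis
        using True g Tc mem_conj_set_iff[OF g True Nc] conj_set_subset_carrier
        by (simp add: normalizer_eq conj_set_mult)
    next
      case False
      then show ?thesis
        using conj_set_subset_carrier[OF g Nc] conj_set_subset_carrier[OF g Tc]
        by (auto simp: normalizer_eq)
    qed
  qed
  then show ?thesis
    using subgroup_index_conj_set[OF fin g Ts normalizer_imp_subgroup[OF Tc] subset_normalizer[OF Ts]] by simp
qed

text \<open>Moebius inversion shows that the stated values, completed at the trivial subgroup, solve
  the equations defining the coefficients; independence of the induced characters shows that they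
  are the only solution.\<close>

lemma artin_coeff_eq:
  fixes \<psi> :: "'a \<Rightarrow> 'k::field fps \<Rightarrow> 'k fps"
  assumes fin: "finite (carrier G)"
    and F: "\<And>\<sigma>. \<sigma> \<in> carrier G \<Longrightarrow> \<sigma> \<noteq> \<one> \<Longrightarrow> int (subdegree (\<psi> \<sigma> fps_X - fps_X)) = F (generate G {\<sigma>})"
    and F_conj: "\<And>g \<Gamma>. g \<in> carrier G \<Longrightarrow> cyclic_subgroup \<Gamma> G \<Longrightarrow> F (conj_set G g \<Gamma>) = F \<Gamma>"
    and T: "cyclic_subgroup T G" "T \<noteq> {\<one>}"
  shows "artin_coeff G \<psi> T = of_int (moebius_sum G F T) / of_nat (subgroup_index G (normalizer G T) T)"
proof -
  \<comment> \<open>The new value at the trivial subgroup makes the expansion hold at the identity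
    too. The Moebius sum at a non-trivial \<open>T\<close> is unaffected, since it involves only
    groups containing \<open>T\<close>.\<close>
  define F' where "F' \<Gamma> = (if \<Gamma> = {\<one>} then - artin_character G \<psi> \<one> else F \<Gamma>)" for \<Gamma>
  define idx where "idx T = subgroup_index G (normalizer G T) T" for T
  define b :: "'a set \<Rightarrow> rat"
    where "b T = (if cyclic_subgroup T G then of_int (moebius_sum G F' T) / of_nat (idx T) else 0)" for T
  let ?U = "\<lambda>T \<sigma>. {U. conjugate_subgroups G T U \<and> \<sigma> \<in> U}"
  have car: "T \<subseteq> carrier G" if "cyclic_subgroup T G" for T
    using that cyclic_subgroup_imp_subgroup subgroup.subset by blast
  have F': "- artin_character G \<psi> \<sigma> = F' (generate G {\<sigma>})" if "\<sigma> \<in> carrier G" for \<sigma>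
    using F[OF that] generate_eq_one_iff[OF that] by (simp add: F'_def artin_character_def)
  have conj_one: "conj_set G g \<Gamma> = {\<one>} \<longleftrightarrow> \<Gamma> = {\<one>}" if "g \<in> carrier G" "cyclic_subgroup \<Gamma> G" for g \<Gamma>
    using conj_set_inv(1)[OF that(1) car[OF that(2)]] that(1) by (auto simp: conj_set_def)
  have F'_conj: "F' (conj_set G g \<Gamma>) = F' \<Gamma>" if "g \<in> carrier G" "cyclic_subgroup \<Gamma> G" for g \<Gamma>
    using F_conj[OF that] conj_one[OF that] by (simp add: F'_def)
  have B_conj: "moebius_sum G F' U = moebius_sum G F' T"
    if T: "cyclic_subgroup T G" "conjugate_subgroups G T U" for T U
  proof -
    obtain g where g: "g \<in> carrier G" "U = conj_set G g T"
      using T(2) unfolding conjugate_subgroups_def coset_conj_eq by auto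
    show ?thesis unfolding g(2)
      by (rule moebius_sum_conj_set[OF fin g(1) cyclic_subgroup_imp_subgroup[OF T(1)]]) (rule F'_conj[OF g(1)])
  qed
  have idx_conj: "idx U = idx T" if T: "cyclic_subgroup T G" "conjugate_subgroups G T U" for T U
    using T normalizer_index_conj_set[OF fin _ cyclic_subgroup_imp_subgroup[OF T(1)]]
    unfolding conjugate_subgroups_def coset_conj_eq idx_def by auto
  have b_sum: "- of_int (artin_character G \<psi> \<sigma>) = (\<Sum>T\<in>R. b T * induced_class_fun G T (\<lambda>_. 1) \<sigma>)"
    if R: "cyclic_class_representatives G R" and \<sigma>: "\<sigma> \<in> carrier G" for R \<sigma>
  proof -
    have "b T * induced_class_fun G T (\<lambda>_. 1) \<sigma> = of_int (moebius_sum G F' T * int (card (?U T \<sigma>)))" if "T \<in> R" for T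
    proof -
      have T: "cyclic_subgroup T G" using R that by (simp add: cyclic_class_representatives_def)
      show ?thesis
        using normalizer_index_card(2)[OF fin cyclic_subgroup_imp_subgroup[OF T]]
        by (simp add: b_def T induced_class_fun_one[OF fin cyclic_subgroup_imp_subgroup[OF T] \<sigma>] idx_def)
    qed
    then have "(\<Sum>T\<in>R. b T * induced_class_fun G T (\<lambda>_. 1) \<sigma>) = of_int (\<Sum>T\<in>R. moebius_sum G F' T * int (card (?U T \<sigma>)))"
      unfolding of_int_sum by (rule sum.cong[OF refl])
    also have "\<dots> = of_int (F' (generate G {\<sigma>}))"
      using sum_class_representatives[OF fin R \<sigma> B_conj] sum_moebius_sum[OF fin \<sigma>] by simp
    finally show ?thesis using F'[OF \<sigma>] by (metis of_int_minus)
  qed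
  have "artin_coeff G \<psi> = b"
    unfolding artin_coeff_def
  proof (rule the_equality)
    have "b T = b U" if "cyclic_subgroup T G \<and> conjugate_subgroups G T U" for T U
    proof -
      have "cyclic_subgroup U G"
        using cyclic_conj_set that unfolding conjugate_subgroups_def coset_conj_eq by blast
      then show ?thesis using B_conj[of T U] idx_conj[of T U] that by (simp add: b_def)
    qed
    then show "(\<forall>T. \<not> cyclic_subgroup T G \<longrightarrow> b T = 0) \<and>
      (\<forall>T U. cyclic_subgroup T G \<and> conjugate_subgroups G T U \<longrightarrow> b T = b U) \<and>
      (\<forall>R. cyclic_class_representatives G R \<longrightarrow>
        (\<forall>\<sigma>\<in>carrier G. - of_int (artin_character G \<psi> \<sigma>) = (\<Sum>T\<in>R. b T * induced_class_fun G T (\<lambda>_. 1) \<sigma>)))"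
      using b_sum by (simp add: b_def)
    fix c assume "(\<forall>T. \<not> cyclic_subgroup T G \<longrightarrow> c T = 0) \<and>
      (\<forall>T U. cyclic_subgroup T G \<and> conjugate_subgroups G T U \<longrightarrow> c T = c U) \<and>
      (\<forall>R. cyclic_class_representatives G R \<longrightarrow>
        (\<forall>\<sigma>\<in>carrier G. - of_int (artin_character G \<psi> \<sigma>) = (\<Sum>T\<in>R. c T * induced_class_fun G T (\<lambda>_. 1) \<sigma>)))"
    then have c0: "\<And>T. \<not> cyclic_subgroup T G \<Longrightarrow> c T = 0"
      and c_conj: "\<And>T U. cyclic_subgroup T G \<Longrightarrow> conjugate_subgroups G T U \<Longrightarrow> c T = c U"
      and c_sum: "\<And>R \<sigma>. cyclic_class_representatives G R \<Longrightarrow> \<sigma> \<in> carrier G \<Longrightarrow>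
        - of_int (artin_character G \<psi> \<sigma>) = (\<Sum>T\<in>R. c T * induced_class_fun G T (\<lambda>_. 1) \<sigma>)"
      by blast+
    obtain R where R: "cyclic_class_representatives G R" using class_representatives_exist by blast
    have Rc: "cyclic_subgroup T G" if "T \<in> R" for T using R that by (simp add: cyclic_class_representatives_def)
    have finR: "finite R" using Rc by (intro finite_subset[OF _ finite_cyclic_subgroups[OF fin]]) auto
    have card_le: "card T \<le> card (carrier G)" if "cyclic_subgroup T G" for T
      using car[OF that] fin by (rule card_mono[rotated])
    text \<open>The characters induced from representatives are triangular with respect to the order
      of the subgroups, hence linearly independent.\<close>
    have eq_R: "c T = b T" if "T \<in> R" for T
      using that
    proof (induction "card (carrier G) - card T" arbitrary: T rule: less_induct)
      case less
      obtain \<sigma> where \<sigma>: "\<sigma> \<in> carrier G" "T = generate G {\<sigma>}"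
        using Rc[OF less.prems] cyclic_subgroup_iff by blast
      have Ts: "subgroup T G" using Rc[OF less.prems] by (rule cyclic_subgroup_imp_subgroup)
      have \<sigma>T: "\<sigma> \<in> T" using \<sigma> by (simp add: generate.incl)
      have "(\<Sum>U\<in>R. (c U - b U) * induced_class_fun G U (\<lambda>_. 1) \<sigma>) = 0"
        using c_sum[OF R \<sigma>(1)] b_sum[OF R \<sigma>(1)] by (simp add: left_diff_distrib sum_subtractf)
      \<comment> \<open>At a generator \<sigma> of \<open>T\<close>, the character induced from
        \<open>U\<close> is non-zero only if a conjugate of \<open>U\<close> contains
        \<open>T\<close>. For another representative the containment is strict, so \<open>U\<close>
        is larger than \<open>T\<close> and is covered by the induction.\<close>
      moreover have "(c U - b U) * induced_class_fun G U (\<lambda>_. 1) \<sigma> = 0" if U: "U \<in> R - {T}" for U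
      proof (cases "?U U \<sigma> = {}")
        case True
        then have "card (?U U \<sigma>) = 0" by (simp only: card.empty)
        then have "induced_class_fun G U (\<lambda>_. 1) \<sigma> = 0"
          using induced_class_fun_one[OF fin cyclic_subgroup_imp_subgroup[OF Rc, of U] \<sigma>(1)] U by simp
        then show ?thesis by simp
      next
        case False
        then obtain V where V: "conjugate_subgroups G U V" "\<sigma> \<in> V" by auto
        then obtain g where g: "g \<in> carrier G" "V = conj_set G g U"
          unfolding conjugate_subgroups_def coset_conj_eq by auto
        have Uc: "U \<subseteq> carrier G" using car[OF Rc, of U] U by simp
        have Vs: "subgroup V G" unfolding g(2)
          using subgroup_conj_set[OF g(1)] cyclic_subgroup_imp_subgroup[OF Rc, of U] U by simp
        have TV: "T \<subseteq> V" using generate_subset_iff[OF \<sigma>(1) Vs] V(2) \<sigma>(2) by simp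
        have cardV: "card V = card U" unfolding g(2) using card_conj_set[OF g(1) Uc] .
        have "T \<noteq> V"
        proof
          assume "T = V"
          then have "conjugate_subgroups G U T" using V(1) by simp
          then have "conjugate_subgroups G U U \<and> conjugate_subgroups G U T"
            using conjugate_subgroups_refl[OF Uc] by simp
          then show False using R Rc[of U] U less.prems unfolding cyclic_class_representatives_def by blast
        qed
        then have "card T < card U"
          using psubset_card_mono[of V T] TV finite_subgroupD(1)[OF fin Vs] cardV by auto
        moreover have "card U \<le> card (carrier G)" using card_le[OF Rc, of U] U by simp
        ultimately have "c U = b U" using U by (intro less.hyps) auto
        then show ?thesis by simp
      qed
      ultimately have "(c T - b T) * induced_class_fun G T (\<lambda>_. 1) \<sigma> = 0"
        using finR less.prems by (simp add: sum.remove)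
      moreover have "?U T \<sigma> \<noteq> {}" "finite (?U T \<sigma>)"
      proof -
        show "?U T \<sigma> \<noteq> {}"
          using conjugate_subgroups_refl[OF subgroup.subset[OF Ts]] \<sigma>T by blast
        have "?U T \<sigma> \<subseteq> Pow (carrier G)"
          using conj_set_subset_carrier[OF _ subgroup.subset[OF Ts]]
          unfolding conjugate_subgroups_def coset_conj_eq by blast
        then show "finite (?U T \<sigma>)" using fin by (metis finite_Pow_iff finite_subset)
      qed
      ultimately show "c T = b T"
        using induced_class_fun_one[OF fin Ts \<sigma>(1)] normalizer_index_card(2)[OF fin Ts] by (auto simp: card_eq_0_iff)
    qed
    show "c = b"
    proof
      fix T show "c T = b T"
      proof (cases "cyclic_subgroup T G")
        case True
        then obtain U where U: "U \<in> R" "conjugate_subgroups G T U"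
          using R unfolding cyclic_class_representatives_def by blast
        have "b T = b U"
          using B_conj[OF True U(2)] idx_conj[OF True U(2)] True Rc[OF U(1)] by (simp add: b_def)
        then show ?thesis using c_conj[OF True U(2)] eq_R[OF U(1)] by simp
      qed (simp add: c0 b_def)
    qed
  qed
  moreover have "moebius_sum G F' T = moebius_sum G F T"
  proof -
    have "\<Gamma> \<noteq> {\<one>}" if "\<Gamma> \<in> cyclic_over G T" for \<Gamma>
      using that T subgroup.one_closed[OF cyclic_subgroup_imp_subgroup[OF T(1)]] by (auto simp: cyclic_over_def)
    then show ?thesis unfolding moebius_sum_def by (intro sum.cong) (auto simp: F'_def)
  qed
  ultimately show ?thesis using T by (simp add: b_def idx_def)
qed

end

subsection \<open>Automorphisms of the power series ring\<close>

lemma fps_X_power_dvd_iff: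
  "fps_X ^ n dvd (f::'k::field fps) \<longleftrightarrow> (\<forall>i<n. fps_nth f i = 0)"
proof (cases "f = 0")
  case False
  have "fps_X ^ n dvd f \<longleftrightarrow> n \<le> subdegree f"
    using fps_dvd_iff[of "fps_X ^ n" f] False by simp
  also have "\<dots> \<longleftrightarrow> (\<forall>i<n. fps_nth f i = 0)"
    using False subdegree_geI[of f n] nth_less_subdegree_zero[of _ f] by (meson less_le_trans)
  finally show ?thesis .
qed simp

lemma fps_X_dvd_iff: "fps_X dvd (f::'k::field fps) \<longleftrightarrow> fps_nth f 0 = 0"
  using fps_X_power_dvd_iff[of 1 f] by simp

lemma fps_X_power_subdegree_dvd: "fps_X ^ subdegree f dvd (f::'k::field fps)"
  unfolding fps_X_power_dvd_iff by (intro allI impI nth_less_subdegree_zero)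

text \<open>Krull's intersection theorem for the power series ring. Identities between series are
  derived from it by checking them modulo all powers of \<open>w\<close>.\<close>

lemma fps_eq_0_if_power_dvd:
  fixes w z :: "'k::field fps"
  assumes "fps_nth w 0 = 0" "\<And>n. w ^ n dvd z"
  shows "z = 0"
proof (rule fps_ext)
  fix n
  have "fps_X ^ Suc n dvd w ^ Suc n" using assms(1) by (intro dvd_power_same) (simp add: fps_X_dvd_iff)
  then have "fps_X ^ Suc n dvd z" using assms(2) dvd_trans by blast
  then show "fps_nth z n = fps_nth 0 n" unfolding fps_X_power_dvd_iff by simp
qed

lemma fps_eq_const_plus_X_mult: "(f::'k::field fps) = fps_const (fps_nth f 0) + fps_X * fps_shift 1 f"
  by (rule fps_ext) (simp add: fps_nth_Abs_fps)

section \<open>Single automorphisms: effect on orders and on leading coefficients\<close>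

locale fps_algebra_aut =
  fixes f :: "'k::field fps \<Rightarrow> 'k fps"
  assumes bij: "bij f" and add: "f (x + y) = f x + f y" and mult: "f (x * y) = f x * f y"
    and const: "f (fps_const c) = fps_const c"
begin

lemma zero [simp]: "f 0 = 0" and one [simp]: "f 1 = 1"
  using const[of 0] const[of 1] by simp_all

lemma diff: "f (x - y) = f x - f y"
  using add[of "x - y" y] by (simp add: eq_diff_eq)

lemma power: "f (x ^ n) = f x ^ n"
  by (induction n) (simp_all add: mult)

lemma eq_0_iff [simp]: "f x = 0 \<longleftrightarrow> x = 0"
  using bij zero by (metis bij_def inj_eq)

lemma dvd: "x dvd y \<Longrightarrow> f x dvd f y"
  by (auto simp: dvd_def mult)

text \<open>A series with non-zero constant term is a unit, and an automorphism cannot turn a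
  non-unit into a unit. So the maximal ideal is preserved, and constants are fixed.\<close>

lemma nth_0 [simp]: "fps_nth (f x) 0 = fps_nth x 0"
proof -
  let ?x = "x - fps_const (fps_nth x 0)"
  have "fps_nth (f ?x) 0 = 0"
  proof (rule ccontr)
    assume "fps_nth (f ?x) 0 \<noteq> 0"
    then have "f ?x * inverse (f ?x) = 1" by (rule inverse_mult_eq_1')
    moreover obtain y where "f y = inverse (f ?x)" using bij by (metis bij_pointE)
    ultimately have "f (?x * y) = f 1" by (simp add: mult)
    then have "?x * y = 1" using bij by (metis bij_def inj_eq)
    then have "fps_nth (?x * y) 0 = 1" by simp
    then show False by simp
  qed
  then show ?thesis by (simp add: diff const)
qed

lemma X_dvd: "fps_X dvd f fps_X"
  by (simp add: fps_X_dvd_iff)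

lemma X_power_dvd:
  assumes "fps_X ^ n dvd x"
  shows "fps_X ^ n dvd f x"
  using dvd[OF assms] dvd_power_same[OF X_dvd, of n] by (metis dvd_trans power)

text \<open>Writing \<open>x\<close> as a constant plus \<open>fps_X * y\<close>, the difference
  \<open>f x - x\<close> is \<open>(f fps_X - fps_X) * f y + fps_X * (f y - y)\<close>, which lifts
  the divisibility for \<open>y\<close> by one power of \<open>fps_X\<close>.\<close>

lemma X_power_dvd_diff:
  assumes "fps_X ^ n dvd f fps_X - fps_X"
  shows "fps_X ^ n dvd f x - x"
proof -
  have "m \<le> n \<Longrightarrow> fps_X ^ m dvd f x - x" for m
  proof (induction m arbitrary: x)
    case (Suc m)
    define y where "y = fps_shift 1 x"
    have x: "x = fps_const (fps_nth x 0) + fps_X * y"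
      unfolding y_def by (rule fps_eq_const_plus_X_mult)
    have "f x = fps_const (fps_nth x 0) + f fps_X * f y" by (subst x) (simp add: add mult const)
    then have "f x - x = (f fps_X - fps_X) * f y + fps_X * (f y - y)"
      by (subst (2) x) (simp add: algebra_simps)
    moreover have "fps_X ^ Suc m dvd f fps_X - fps_X"
      using assms Suc.prems by (meson dvd_trans le_imp_power_dvd)
    moreover have "fps_X * fps_X ^ m dvd fps_X * (f y - y)"
      using Suc by (intro mult_dvd_mono) auto
    ultimately show ?case by simp
  qed simp
  then show ?thesis by simp
qed

lemma eq_id_if_fixes_X:
  assumes "f fps_X = fps_X"
  shows "f x = x"
proof -
  have "f x - x = 0"
    by (rule fps_eq_0_if_power_dvd[of fps_X]) (use assms in \<open>simp_all add: X_power_dvd_diff\<close>)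
  then show ?thesis by simp
qed

text \<open>A first-order Taylor expansion: the constant term of \<open>x\<close> is fixed, and
  \<open>f\<close> changes the part divisible by \<open>fps_X ^ 2\<close> only by a multiple of
  \<open>fps_X ^ Suc i\<close>, so just the linear coefficient of \<open>x\<close> matters in degree
  \<open>i\<close>.\<close>

lemma nth_diff:
  assumes "i \<ge> 2" "fps_X ^ i dvd f fps_X - fps_X"
  shows "fps_nth (f x - x) i = fps_nth (f fps_X - fps_X) i * fps_nth x 1"
proof -
  define z y where "z = fps_shift 1 x" and "y = fps_shift 1 z"
  have "x = fps_const (fps_nth x 0) + fps_X * z" "z = fps_const (fps_nth x 1) + fps_X * y"
    using fps_eq_const_plus_X_mult[of x] fps_eq_const_plus_X_mult[of z] by (simp_all add: z_def y_def)
  then have x: "x = fps_const (fps_nth x 0) + fps_const (fps_nth x 1) * fps_X + fps_X ^ 2 * y"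
    by (metis (no_types, lifting) add.assoc distrib_left mult.assoc mult.commute power2_eq_square)
  have "f x = fps_const (fps_nth x 0) + fps_const (fps_nth x 1) * f fps_X + f fps_X ^ 2 * f y"
    by (subst x) (simp add: add mult const power)
  then have "f x - x = fps_const (fps_nth x 1) * (f fps_X - fps_X)
      + ((f fps_X - fps_X) * (f fps_X + fps_X) * f y + fps_X ^ 2 * (f y - y))"
    by (subst (2) x) (simp add: algebra_simps power2_eq_square)
  moreover have "fps_X ^ Suc i dvd (f fps_X - fps_X) * (f fps_X + fps_X) * f y + fps_X ^ 2 * (f y - y)"
  proof (rule dvd_add)
    have "fps_X ^ i * fps_X dvd (f fps_X - fps_X) * (f fps_X + fps_X)"
      using assms(2) X_dvd by (intro mult_dvd_mono) auto
    then show "fps_X ^ Suc i dvd (f fps_X - fps_X) * (f fps_X + fps_X) * f y"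
      by (simp add: mult.commute)
    have "fps_X ^ 2 * fps_X ^ i dvd fps_X ^ 2 * (f y - y)"
      using X_power_dvd_diff[OF assms(2)] by (intro mult_dvd_mono) auto
    then show "fps_X ^ Suc i dvd fps_X ^ 2 * (f y - y)"
      by (rule dvd_trans[rotated]) (simp add: le_imp_power_dvd flip: power_add)
  qed
  ultimately show ?thesis
    unfolding fps_X_power_dvd_iff by (simp add: mult.commute)
qed

lemma leading_coefficient:
  assumes "fps_X ^ n dvd x"
  shows "fps_nth (f x) n = fps_nth x n * fps_nth (f fps_X) 1 ^ n"
proof -
  obtain y where y: "x = fps_X ^ n * y" using assms by (auto simp: dvd_def)
  obtain q where q: "f fps_X = fps_X * q" using X_dvd by (auto simp: dvd_def)
  have "f x = fps_X ^ n * (q ^ n * f y)" by (simp add: y mult power q power_mult_distrib)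
  then have "fps_nth (f x) n = fps_nth q 0 ^ n * fps_nth y 0"
    by (simp add: fps_X_power_mult_nth fps_nth_power_0)
  moreover have "fps_nth (f fps_X) 1 = fps_nth q 0" by (simp add: q)
  ultimately show ?thesis by (simp add: y fps_X_power_mult_nth)
qed

lemma nth_X_1_nonzero: "fps_nth (f fps_X) 1 \<noteq> 0"
proof
  assume 0: "fps_nth (f fps_X) 1 = 0"
  obtain y where y: "f y = fps_X" using bij by (metis bij_pointE)
  have "fps_nth y 0 = 0" using nth_0[of y] by (simp add: y)
  then have "fps_nth (f y) 1 = fps_nth y 1 * fps_nth (f fps_X) 1 ^ 1"
    by (intro leading_coefficient) (simp add: fps_X_dvd_iff)
  then show False using 0 y by simp
qed

end

section \<open>Finite groups of automorphisms: ramification groups and depth\<close>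

locale fps_aut_group = group G for G :: "('g, 'b) monoid_scheme" (structure) +
  fixes \<phi> :: "'g \<Rightarrow> 'k::field fps \<Rightarrow> 'k fps"
  assumes fin: "finite (carrier G)" and hom: "\<phi> \<in> hom G fps_aut" and inj: "inj_on \<phi> (carrier G)"
begin

lemma aut: "g \<in> carrier G \<Longrightarrow> fps_algebra_aut (\<phi> g)"
  using hom_in_carrier[OF hom] by unfold_locales (auto simp: fps_aut_def)

lemma comp: "g \<in> carrier G \<Longrightarrow> h \<in> carrier G \<Longrightarrow> \<phi> (g \<otimes> h) x = \<phi> g (\<phi> h x)"
  using hom_mult[OF hom] by (simp add: fps_aut_def)

lemma id_one: "\<phi> \<one> x = x"
proof -
  have "\<phi> \<one> (\<phi> \<one> x) = \<phi> \<one> x" using comp[of \<one> \<one> x] by simp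
  then show ?thesis using fps_algebra_aut.bij[OF aut[OF one_closed]] by (metis bij_def inj_eq)
qed

lemma inv_cancel: "g \<in> carrier G \<Longrightarrow> \<phi> g (\<phi> (inv g) x) = x" "g \<in> carrier G \<Longrightarrow> \<phi> (inv g) (\<phi> g x) = x"
  using comp[of g "inv g" x] comp[of "inv g" g x] by (simp_all add: id_one)

abbreviation depth :: "'g \<Rightarrow> nat" where "depth g \<equiv> subdegree (\<phi> g fps_X - fps_X)"

text \<open>The ramification groups in lower numbering, with the index shifted by one: index 2 gives
  the wild inertia group. A condition on \<open>fps_X\<close> is enough because of
  \<open>X_power_dvd_diff\<close>.\<close>

definition ramification_group :: "nat \<Rightarrow> 'g set" where
  "ramification_group n = {g \<in> carrier G. fps_X ^ n dvd \<phi> g fps_X - fps_X}"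

lemma diff_nonzero: "g \<in> carrier G \<Longrightarrow> g \<noteq> \<one> \<Longrightarrow> \<phi> g fps_X - fps_X \<noteq> 0"
proof
  assume g: "g \<in> carrier G" "g \<noteq> \<one>" "\<phi> g fps_X - fps_X = 0"
  then have "\<phi> g = \<phi> \<one>"
    using fps_algebra_aut.eq_id_if_fixes_X[OF aut[OF g(1)]] id_one by (intro ext) auto
  then show False using inj g by (auto dest: inj_onD)
qed

lemma mem_ramification_group_iff:
  assumes "g \<in> carrier G" "g \<noteq> \<one>"
  shows "g \<in> ramification_group n \<longleftrightarrow> n \<le> depth g"
  using assms fps_dvd_iff[of "fps_X ^ n" "\<phi> g fps_X - fps_X"] diff_nonzero[OF assms]
  by (simp add: ramification_group_def)

lemma ramification_group_dvd:
  "g \<in> ramification_group n \<Longrightarrow> fps_X ^ n dvd \<phi> g x - x"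
  using fps_algebra_aut.X_power_dvd_diff[OF aut] by (simp add: ramification_group_def)

lemma subgroup_ramification_group: "subgroup (ramification_group n) G"
proof (rule subgroupI)
  show "ramification_group n \<subseteq> carrier G" by (auto simp: ramification_group_def)
  have "\<one> \<in> ramification_group n" by (simp add: ramification_group_def id_one)
  then show "ramification_group n \<noteq> {}" by blast
next
  fix g assume g: "g \<in> ramification_group n"
  then have gc: "g \<in> carrier G" by (simp add: ramification_group_def)
  have "fps_X ^ n dvd \<phi> g (\<phi> (inv g) fps_X) - \<phi> (inv g) fps_X"
    using g by (rule ramification_group_dvd)
  then show "inv g \<in> ramification_group n"
    using gc by (simp add: ramification_group_def inv_cancel) (metis dvd_minus_iff minus_diff_eq)
next
  fix g h assume gh: "g \<in> ramification_group n" "h \<in> ramification_group n"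
  then have c: "g \<in> carrier G" "h \<in> carrier G" by (auto simp: ramification_group_def)
  have "\<phi> (g \<otimes> h) fps_X - fps_X = (\<phi> g (\<phi> h fps_X) - \<phi> h fps_X) + (\<phi> h fps_X - fps_X)"
    using c by (simp add: comp)
  also have "fps_X ^ n dvd \<dots>" using gh by (intro dvd_add ramification_group_dvd)
  finally show "g \<otimes> h \<in> ramification_group n" using c by (simp add: ramification_group_def)
qed

lemma conj_mem_ramification_group:
  assumes g: "g \<in> carrier G" and h: "h \<in> ramification_group n"
  shows "g \<otimes> h \<otimes> inv g \<in> ramification_group n"
proof -
  have hc: "h \<in> carrier G" using h by (simp add: ramification_group_def)
  interpret g: fps_algebra_aut "\<phi> g" using g by (rule aut)
  have "\<phi> (g \<otimes> h \<otimes> inv g) fps_X - fps_X = \<phi> g (\<phi> h (\<phi> (inv g) fps_X) - \<phi> (inv g) fps_X)"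
    using g hc by (simp add: comp g.diff inv_cancel)
  also have "fps_X ^ n dvd \<dots>"
    using h by (intro g.X_power_dvd ramification_group_dvd)
  finally show ?thesis using g hc by (simp add: ramification_group_def)
qed

lemma conj_eq_one_iff:
  assumes "g \<in> carrier G" "h \<in> carrier G"
  shows "g \<otimes> h \<otimes> inv g = \<one> \<longleftrightarrow> h = \<one>"
proof
  assume "g \<otimes> h \<otimes> inv g = \<one>"
  moreover have "h = inv g \<otimes> (g \<otimes> h \<otimes> inv g) \<otimes> g" using assms by (simp add: m_assoc flip: m_assoc[of "inv g" g])
  ultimately show "h = \<one>" using assms by simp
qed (use assms in simp)

lemma depth_conj:
  assumes g: "g \<in> carrier G" and h: "h \<in> carrier G" "h \<noteq> \<one>"
  shows "depth (g \<otimes> h \<otimes> inv g) = depth h"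
proof -
  have le: "depth h \<le> depth (g \<otimes> h \<otimes> inv g)" if "g \<in> carrier G" "h \<in> carrier G" "h \<noteq> \<one>" for g h
  proof -
    have "g \<otimes> h \<otimes> inv g \<noteq> \<one>" using that by (simp add: conj_eq_one_iff)
    moreover have "h \<in> ramification_group (depth h)" using that by (simp add: mem_ramification_group_iff)
    ultimately show ?thesis
      using conj_mem_ramification_group[OF that(1)] that
        mem_ramification_group_iff[of "g \<otimes> h \<otimes> inv g" "depth h"] by blast
  qed
  have "inv g \<otimes> (g \<otimes> h \<otimes> inv g) \<otimes> inv (inv g) = h"
    using g h(1) by (simp add: m_assoc flip: m_assoc[of "inv g" g])
  moreover have "g \<otimes> h \<otimes> inv g \<noteq> \<one>" using g h by (simp add: conj_eq_one_iff)
  ultimately have "depth (g \<otimes> h \<otimes> inv g) \<le> depth h"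
    using le[of "inv g" "g \<otimes> h \<otimes> inv g"] g h(1) by simp
  with le[OF g h] show ?thesis by simp
qed

text \<open>The minimum over all non-trivial elements makes it evident that only the subgroup
  matters. On a cyclic group it is attained at every generator, because ramification groups are
  subgroups.\<close>

definition lower_depth :: "'g set \<Rightarrow> nat" where
  "lower_depth \<Gamma> = Min (depth ` (\<Gamma> - {\<one>}))"

lemma lower_depth_generate:
  assumes \<sigma>: "\<sigma> \<in> carrier G" "\<sigma> \<noteq> \<one>"
  shows "lower_depth (generate G {\<sigma>}) = depth \<sigma>"
  unfolding lower_depth_def
proof (rule Min_eqI)
  have sub: "generate G {\<sigma>} \<subseteq> ramification_group (depth \<sigma>)"
    using \<sigma> by (intro generate_subgroup_incl subgroup_ramification_group) (simp add: mem_ramification_group_iff)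
  show "finite (depth ` (generate G {\<sigma>} - {\<one>}))"
    using finite_subset[OF generate_incl fin] \<sigma> by simp
  show "depth \<sigma> \<in> depth ` (generate G {\<sigma>} - {\<one>})" using \<sigma> by (auto intro: generate.incl)
  fix n assume "n \<in> depth ` (generate G {\<sigma>} - {\<one>})"
  then obtain \<tau> where \<tau>: "\<tau> \<in> generate G {\<sigma>}" "\<tau> \<noteq> \<one>" "n = depth \<tau>" by auto
  then have "\<tau> \<in> carrier G" "\<tau> \<in> ramification_group (depth \<sigma>)"
    using sub by (auto simp: ramification_group_def)
  then show "depth \<sigma> \<le> n" using \<tau> by (simp add: mem_ramification_group_iff)
qed

lemma lower_depth_conj:
  assumes "g \<in> carrier G" "\<Gamma> \<subseteq> carrier G"
  shows "lower_depth ((\<lambda>t. g \<otimes> t \<otimes> inv g) ` \<Gamma>) = lower_depth \<Gamma>"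
proof -
  have "g \<otimes> t \<otimes> inv g = \<one> \<longleftrightarrow> t = \<one>" if "t \<in> \<Gamma>" for t
    using that assms by (intro conj_eq_one_iff) auto
  then have "(\<lambda>t. g \<otimes> t \<otimes> inv g) ` \<Gamma> - {\<one>} = (\<lambda>t. g \<otimes> t \<otimes> inv g) ` (\<Gamma> - {\<one>})" by auto
  moreover have "depth ` (\<lambda>t. g \<otimes> t \<otimes> inv g) ` (\<Gamma> - {\<one>}) = depth ` (\<Gamma> - {\<one>})"
    unfolding image_image using assms depth_conj by (intro image_cong) auto
  ultimately show ?thesis by (simp add: lower_depth_def)
qed

definition theta_0 :: "'g \<Rightarrow> 'k" where "theta_0 g = fps_nth (\<phi> g fps_X) 1"

lemma theta_0_nonzero: "g \<in> carrier G \<Longrightarrow> theta_0 g \<noteq> 0"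
  unfolding theta_0_def by (rule fps_algebra_aut.nth_X_1_nonzero[OF aut])

lemma theta_0_mult:
  assumes "g \<in> carrier G" "h \<in> carrier G"
  shows "theta_0 (g \<otimes> h) = theta_0 g * theta_0 h"
proof -
  have "fps_nth (\<phi> g (\<phi> h fps_X)) 1 = fps_nth (\<phi> h fps_X) 1 * fps_nth (\<phi> g fps_X) 1 ^ 1"
    by (rule fps_algebra_aut.leading_coefficient[OF aut[OF assms(1)]])
      (use fps_algebra_aut.X_dvd[OF aut[OF assms(2)]] in simp)
  then show ?thesis using assms by (simp add: theta_0_def comp)
qed

lemma theta_0_one [simp]: "theta_0 \<one> = 1"
  by (simp add: theta_0_def id_one)

lemma theta_0_pow: "g \<in> carrier G \<Longrightarrow> theta_0 (g [^] (n::nat)) = theta_0 g ^ n"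
  by (induction n) (simp_all add: theta_0_mult)

lemma theta_0_eq_1_iff:
  assumes "g \<in> carrier G"
  shows "theta_0 g = 1 \<longleftrightarrow> g \<in> ramification_group 2"
proof -
  interpret g: fps_algebra_aut "\<phi> g" using assms by (rule aut)
  have "fps_X ^ 2 dvd \<phi> g fps_X - fps_X \<longleftrightarrow> theta_0 g = 1"
    unfolding fps_X_power_dvd_iff theta_0_def by (auto simp: less_2_cases_iff)
  then show ?thesis using assms by (simp add: ramification_group_def)
qed

lemma depth_ge_1:
  assumes "g \<in> carrier G" "g \<noteq> \<one>"
  shows "depth g \<ge> 1"
proof -
  interpret g: fps_algebra_aut "\<phi> g" using assms(1) by (rule aut)
  have "fps_nth (\<phi> g fps_X - fps_X) 0 = 0" by simp
  then have "g \<in> ramification_group 1"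
    using assms(1) by (simp add: ramification_group_def fps_X_dvd_iff)
  then show ?thesis using assms by (simp add: mem_ramification_group_iff)
qed

text \<open>The classical homomorphism from a higher ramification group to the additive group of
  \<open>k\<close>: since \<open>h\<close> has linear coefficient 1, applying \<open>g\<close> after
  \<open>h\<close> adds the coefficients in degree \<open>i\<close>.\<close>

lemma nth_additive:
  assumes i: "i \<ge> 2" and g: "g \<in> ramification_group i" and h: "h \<in> ramification_group i"
  shows "fps_nth (\<phi> (g \<otimes> h) fps_X - fps_X) i =
    fps_nth (\<phi> g fps_X - fps_X) i + fps_nth (\<phi> h fps_X - fps_X) i"
proof -
  have c: "g \<in> carrier G" "h \<in> carrier G" using g h by (auto simp: ramification_group_def)
  have "fps_nth (\<phi> h fps_X - fps_X) 1 = 0"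
    using h i by (auto simp: ramification_group_def fps_X_power_dvd_iff)
  then have "fps_nth (\<phi> h fps_X) 1 = 1" by simp
  moreover have "fps_nth (\<phi> g (\<phi> h fps_X) - \<phi> h fps_X) i =
      fps_nth (\<phi> g fps_X - fps_X) i * fps_nth (\<phi> h fps_X) 1"
    by (rule fps_algebra_aut.nth_diff[OF aut[OF c(1)] i]) (use g in \<open>simp add: ramification_group_def\<close>)
  moreover have "\<phi> (g \<otimes> h) fps_X - fps_X = (\<phi> g (\<phi> h fps_X) - \<phi> h fps_X) + (\<phi> h fps_X - fps_X)"
    using c by (simp add: comp)
  ultimately show ?thesis by (simp only: fps_add_nth mult_1_right)
qed

lemma nth_int_pow:
  assumes i: "i \<ge> 2" and g: "g \<in> ramification_group i"
  shows "fps_nth (\<phi> (g [^] (r::int)) fps_X - fps_X) i = of_int r * fps_nth (\<phi> g fps_X - fps_X) i"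
proof -
  define A where "A g = fps_nth (\<phi> g fps_X - fps_X) i" for g
  note sub = subgroup_ramification_group[of i]
  have gc: "g \<in> carrier G" using g by (simp add: ramification_group_def)
  have mem: "g [^] n \<in> ramification_group i" for n :: int
    using subgroup_int_pow_closed[OF sub g] .
  have A_add: "A (x \<otimes> y) = A x + A y" if "x \<in> ramification_group i" "y \<in> ramification_group i" for x y
    unfolding A_def by (rule nth_additive[OF i that])
  have A_one: "A \<one> = 0" by (simp add: A_def id_one)
  have nat: "A (g [^] n) = of_nat n * A g" for n :: nat
  proof (induction n)
    case (Suc n)
    have "A (g [^] n \<otimes> g) = A (g [^] n) + A g"
      using A_add[OF mem[of "int n"] g] by (simp add: int_pow_int)
    then show ?case using Suc by (simp add: algebra_simps)
  qed (simp add: A_one)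
  have "A (g [^] r) = of_int r * A g"
  proof (cases "r \<ge> 0")
    case True
    then obtain n where "r = int n" using nonneg_int_cases by blast
    then show ?thesis using nat[of n] by (simp add: int_pow_int)
  next
    case False
    then obtain n where n: "r = - int n" by (metis int_cases2 of_nat_0_le_iff)
    have "A (g [^] (- int n) \<otimes> g [^] int n) = A (g [^] (- int n)) + A (g [^] int n)"
      by (rule A_add[OF mem mem])
    moreover have "g [^] (- int n) \<otimes> g [^] int n = \<one>" using gc by (simp flip: int_pow_mult)
    ultimately have "A (g [^] (- int n)) = - A (g [^] n)"
      by (simp add: A_one int_pow_int eq_neg_iff_add_eq_0)
    then show ?thesis using nat[of n] n by simp
  qed
  then show ?thesis by (simp only: A_def)
qed

lemma nth_depth_nonzero:
  assumes "g \<in> carrier G" "g \<noteq> \<one>"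
  shows "fps_nth (\<phi> g fps_X - fps_X) (depth g) \<noteq> 0"
  by (rule nth_subdegree_nonzero[OF diff_nonzero[OF assms]])

text \<open>By additivity the leading coefficient of \<open>g\<close> times \<open>ord g\<close> is
  the corresponding coefficient of the identity, hence 0, while the leading coefficient itself is
  not 0.\<close>

lemma CHAR_dvd_ord:
  assumes g: "g \<in> ramification_group 2" "g \<noteq> \<one>"
  shows "CHAR('k) dvd ord g"
proof -
  have gc: "g \<in> carrier G" using g by (simp add: ramification_group_def)
  have i: "depth g \<ge> 2" using g gc by (simp add: mem_ramification_group_iff)
  have "g \<in> ramification_group (depth g)" using g gc by (simp add: mem_ramification_group_iff)
  from nth_int_pow[OF i this, of "int (ord g)"]
  have "of_nat (ord g) * fps_nth (\<phi> g fps_X - fps_X) (depth g) = 0"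
    using gc by (simp add: int_pow_int id_one)
  then have "(of_nat (ord g) :: 'k) = 0" using nth_depth_nonzero[OF gc g(2)] by simp
  then show ?thesis by (simp add: of_nat_eq_0_iff_char_dvd)
qed

text \<open>Since \<open>x\<close> after \<sigma> equals the \<open>r\<close>-th power of \<sigma>
  after \<open>x\<close>, one and the same series arises by applying \<open>x\<close> to \<sigma>(t)
  - t and by subtracting x(t) from its image under that power. With \<open>a\<close> the leading
  coefficient of \<sigma>(t) - t and \<open>i\<close> its degree, the coefficient in degree
  \<open>i\<close> is \<open>a * theta_0 x ^ i\<close> in the first form and
  \<open>r * a * theta_0 x\<close> in the second. Cancelling \<open>a * theta_0 x\<close> leaves the
  exponent \<open>i - 1\<close>.\<close>

lemma theta_0_power_depth:
  assumes \<sigma>: "\<sigma> \<in> ramification_group 2" "\<sigma> \<noteq> \<one>" and x: "x \<in> carrier G"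
    and conj: "x \<otimes> \<sigma> \<otimes> inv x = \<sigma> [^] (r::int)"
  shows "theta_0 x ^ (depth \<sigma> - 1) = of_int r"
proof -
  have \<sigma>c: "\<sigma> \<in> carrier G" using \<sigma> by (simp add: ramification_group_def)
  let ?i = "depth \<sigma>" and ?y = "\<phi> \<sigma> fps_X - fps_X"
  have i: "?i \<ge> 2" using \<sigma> \<sigma>c by (simp add: mem_ramification_group_iff)
  have ram: "\<sigma> \<in> ramification_group ?i" using \<sigma> \<sigma>c by (simp add: mem_ramification_group_iff)
  have ram_r: "\<sigma> [^] r \<in> ramification_group ?i"
    using subgroup_int_pow_closed[OF subgroup_ramification_group ram] .
  have rc: "\<sigma> [^] r \<in> carrier G" using \<sigma>c by simp
  interpret x: fps_algebra_aut "\<phi> x" using x by (rule aut)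
  have "x \<otimes> \<sigma> = \<sigma> [^] r \<otimes> x" using conj x \<sigma>c by (simp add: inv_solve_right')
  then have "\<phi> x (\<phi> \<sigma> fps_X) = \<phi> (\<sigma> [^] r) (\<phi> x fps_X)"
    using x \<sigma>c rc by (metis comp)
  then have "\<phi> x ?y = \<phi> (\<sigma> [^] r) (\<phi> x fps_X) - \<phi> x fps_X" by (simp add: x.diff)
  then have "fps_nth (\<phi> x ?y) ?i = fps_nth (\<phi> (\<sigma> [^] r) (\<phi> x fps_X) - \<phi> x fps_X) ?i" by simp
  also have "\<dots> = fps_nth (\<phi> (\<sigma> [^] r) fps_X - fps_X) ?i * fps_nth (\<phi> x fps_X) 1"
    by (rule fps_algebra_aut.nth_diff[OF aut[OF rc] i]) (use ram_r in \<open>simp add: ramification_group_def\<close>)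
  also have "\<dots> = of_int r * fps_nth ?y ?i * theta_0 x"
    using nth_int_pow[OF i ram, of r] by (simp add: theta_0_def)
  finally have "fps_nth (\<phi> x ?y) ?i = of_int r * fps_nth ?y ?i * theta_0 x" .
  moreover have "fps_nth (\<phi> x ?y) ?i = fps_nth ?y ?i * theta_0 x ^ ?i"
    unfolding theta_0_def by (rule x.leading_coefficient) (use ram in \<open>simp add: ramification_group_def\<close>)
  moreover have "theta_0 x ^ ?i = theta_0 x ^ (?i - 1) * theta_0 x"
    using i by (metis Suc_diff_1 less_le_trans pos2 power_Suc2)
  ultimately show ?thesis using nth_depth_nonzero[OF \<sigma>c \<sigma>(2)] theta_0_nonzero[OF x] by simp
qed

end

section \<open>The wild inertia group P and its complement C\<close>

lemma power_CHAR_power_eq_1: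
  fixes x :: "'k::field"
  assumes "Factorial_Ring.prime CHAR('k)" "x ^ CHAR('k) ^ n = 1"
  shows "x = 1"
proof -
  have "(1 + (x - 1)) ^ CHAR('k) ^ n = 1 ^ CHAR('k) ^ n + (x - 1) ^ CHAR('k) ^ n"
    using freshmans_dream'[OF assms(1) refl, of 1 "x - 1" n] by simp
  with assms(2) have "(x - 1) ^ CHAR('k) ^ n = 0" by simp
  then show ?thesis by simp
qed

locale tame_extension = fps_aut_group G \<phi> for G :: "('g, 'b) monoid_scheme" (structure)
    and \<phi> :: "'g \<Rightarrow> 'k::field fps \<Rightarrow> 'k fps" +
  fixes P C :: "'g set" and p s :: nat
  assumes prime_p: "Factorial_Ring.prime p" and char_p: "CHAR('k) = p"
    and P_normal: "P \<lhd> G" and card_P: "card P = p ^ s"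
    and C_cyclic: "cyclic_subgroup C G" and card_C: "coprime (card C) p"
    and PC: "P <#> C = carrier G" and P_Int_C: "P \<inter> C = {\<one>}"
begin

lemma P_subgroup: "subgroup P G"
  using P_normal by (rule normal_imp_subgroup)

lemma C_subgroup: "subgroup C G"
  using C_cyclic by (simp add: cyclic_subgroup_def)

lemma P_carrier: "P \<subseteq> carrier G" and C_carrier: "C \<subseteq> carrier G"
  using P_subgroup C_subgroup by (simp_all add: subgroup.subset)

lemma pow_card_subgroup:
  assumes "subgroup H G" "x \<in> H"
  shows "x [^] card H = \<one>"
proof -
  interpret H: group "G\<lparr>carrier := H\<rparr>" using assms(1) by (rule subgroup_imp_group)
  show ?thesis using H.pow_order_eq_1[of x] assms(2) by (simp add: Coset.order_def flip: nat_pow_consistent)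
qed

text \<open>On \<open>P\<close> the values of \<open>theta_0\<close> are \<open>p\<close>-power
  roots of unity, hence 1. Conversely, if \<open>theta_0\<close> is 1 at a product of elements of
  \<open>P\<close> and of \<open>C\<close>, it is 1 at the factor from \<open>C\<close>; were this
  factor non-trivial, its order would be divisible by \<open>p\<close>, against the coprimality of
  \<open>card C\<close> and \<open>p\<close>.\<close>

lemma P_eq: "P = ramification_group 2"
proof (intro equalityI subsetI)
  fix x assume x: "x \<in> P"
  then have xc: "x \<in> carrier G" using P_carrier by auto
  have "theta_0 x ^ p ^ s = 1" using theta_0_pow[OF xc, of "p ^ s"] pow_card_subgroup[OF P_subgroup x] by (simp add: card_P)
  then have "theta_0 x = 1" using power_CHAR_power_eq_1[of "theta_0 x" s] prime_p by (simp add: char_p)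
  then show "x \<in> ramification_group 2" using theta_0_eq_1_iff[OF xc] by simp
next
  fix g assume g: "g \<in> ramification_group 2"
  then have "g \<in> P <#> C" using PC by (simp add: ramification_group_def)
  then obtain x c where xc: "x \<in> P" "c \<in> C" "g = x \<otimes> c" by (auto simp: set_mult_def)
  have car: "x \<in> carrier G" "c \<in> carrier G" using xc P_carrier C_carrier by auto
  have "theta_0 x ^ p ^ s = 1" using theta_0_pow[OF car(1), of "p ^ s"] pow_card_subgroup[OF P_subgroup xc(1)] by (simp add: card_P)
  then have "theta_0 x = 1" using power_CHAR_power_eq_1[of "theta_0 x" s] prime_p by (simp add: char_p)
  moreover have "theta_0 g = 1" using g theta_0_eq_1_iff by (simp add: ramification_group_def)
  ultimately have "theta_0 c = 1" using theta_0_mult[OF car] xc(3) by simp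
  then have c2: "c \<in> ramification_group 2" using theta_0_eq_1_iff[OF car(2)] by simp
  have "c = \<one>"
  proof (rule ccontr)
    assume "c \<noteq> \<one>"
    then have "p dvd ord c" using CHAR_dvd_ord[OF c2] char_p by simp
    moreover have "ord c dvd card C" using pow_card_subgroup[OF C_subgroup xc(2)] pow_eq_id[OF car(2)] by simp
    ultimately have "p dvd card C" by (rule dvd_trans)
    then show False using card_C prime_p by (metis coprime_absorb_right coprime_commute not_prime_unit)
  qed
  then show "g \<in> P" using xc car by simp
qed

lemma depth_outside_P:
  assumes "g \<in> carrier G" "g \<notin> P"
  shows "depth g = 1"
proof -
  have "g \<noteq> \<one>" using assms(2) subgroup.one_closed[OF P_subgroup] by auto
  then show ?thesis
    using assms depth_ge_1[of g] mem_ramification_group_iff[of g 2] by (simp add: P_eq)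
qed

lemma theta_0_inj_on_C: "inj_on theta_0 C"
proof (rule inj_onI)
  fix x y assume xy: "x \<in> C" "y \<in> C" "theta_0 x = theta_0 y"
  have c: "x \<in> carrier G" "y \<in> carrier G" using xy C_carrier by auto
  have "theta_0 (x \<otimes> inv y) * theta_0 y = theta_0 x"
    using c by (simp add: m_assoc flip: theta_0_mult)
  then have "theta_0 (x \<otimes> inv y) = 1" using xy(3) theta_0_nonzero[OF c(2)] by simp
  then have "x \<otimes> inv y \<in> P" using c theta_0_eq_1_iff by (simp add: P_eq)
  moreover have "x \<otimes> inv y \<in> C" using xy C_subgroup by (simp add: subgroup.m_closed subgroup.m_inv_closed)
  ultimately have "x \<otimes> inv y = \<one>" using P_Int_C by auto
  then show "x = y" using c by (metis inv_equality inv_inv inv_closed)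
qed

subsection \<open>The invariant ring\<close>

abbreviation inv_ring :: "'k fps set" where "inv_ring \<equiv> fixed_fps \<phi> P"

lemma fixed_const: "fps_const c \<in> inv_ring"
  using fps_algebra_aut.const[OF aut] P_carrier by (auto simp: fixed_fps_def)

lemma fixed_diff: "x \<in> inv_ring \<Longrightarrow> y \<in> inv_ring \<Longrightarrow> x - y \<in> inv_ring"
  using fps_algebra_aut.diff[OF aut] P_carrier by (auto simp: fixed_fps_def)

lemma fixed_cancel:
  assumes "w \<in> inv_ring" "w \<noteq> 0" "w * q \<in> inv_ring"
  shows "q \<in> inv_ring"
  unfolding fixed_fps_def
proof (intro CollectI ballI)
  fix \<sigma> assume \<sigma>: "\<sigma> \<in> P"
  then interpret \<sigma>: fps_algebra_aut "\<phi> \<sigma>" using P_carrier by (intro aut) auto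
  have "w * \<phi> \<sigma> q = w * q" using \<sigma>.mult[of w q] assms \<sigma> by (simp add: fixed_fps_def)
  then show "\<phi> \<sigma> q = q" using assms(2) by simp
qed

lemma fixed_translate:
  assumes g: "g \<in> carrier G" and x: "x \<in> inv_ring"
  shows "\<phi> g x \<in> inv_ring"
  unfolding fixed_fps_def
proof (intro CollectI ballI)
  fix \<sigma> assume \<sigma>: "\<sigma> \<in> P"
  then have c: "\<sigma> \<in> carrier G" using P_carrier by auto
  have "inv g \<otimes> \<sigma> \<otimes> g \<in> P" using normal.inv_op_closed1[OF P_normal g \<sigma>] .
  then have "\<phi> (inv g \<otimes> \<sigma> \<otimes> g) x = x" using x by (simp add: fixed_fps_def)
  then have "\<phi> g (\<phi> (inv g \<otimes> \<sigma> \<otimes> g) x) = \<phi> g x" by simp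
  then show "\<phi> \<sigma> (\<phi> g x) = \<phi> g x" using g c by (simp add: comp inv_cancel)
qed

text \<open>The norm of \<open>t\<close>, an invariant of order \<open>card P\<close>. It shows that
  invariants of positive order exist and, through \<open>ramification_index_dvd_subdegree\<close>,
  that the ramification index is a power of \<open>p\<close>.\<close>

definition norm_X :: "'k fps" where "norm_X = (\<Prod>\<sigma>\<in>P. \<phi> \<sigma> fps_X)"

lemma norm_X_fixed: "norm_X \<in> inv_ring"
  unfolding fixed_fps_def
proof (intro CollectI ballI)
  fix \<tau> assume \<tau>: "\<tau> \<in> P"
  then have \<tau>c: "\<tau> \<in> carrier G" using P_carrier by auto
  interpret \<tau>: fps_algebra_aut "\<phi> \<tau>" using \<tau>c by (rule aut)
  have "\<phi> \<tau> (\<Prod>\<sigma>\<in>A. \<phi> \<sigma> fps_X) = (\<Prod>\<sigma>\<in>A. \<phi> \<tau> (\<phi> \<sigma> fps_X))" if "finite A" for A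
    using that by induction (simp_all add: \<tau>.mult)
  then have "\<phi> \<tau> norm_X = (\<Prod>\<sigma>\<in>P. \<phi> \<tau> (\<phi> \<sigma> fps_X))"
    using finite_subset[OF P_carrier fin] by (simp add: norm_X_def)
  also have "\<dots> = (\<Prod>\<sigma>\<in>P. \<phi> (\<tau> \<otimes> \<sigma>) fps_X)"
    by (rule prod.cong) (use \<tau>c P_carrier in \<open>auto simp: comp\<close>)
  also have "\<dots> = norm_X"
    unfolding norm_X_def
    by (rule prod.reindex_bij_witness[where i = "\<lambda>\<sigma>. inv \<tau> \<otimes> \<sigma>" and j = "\<lambda>\<sigma>. \<tau> \<otimes> \<sigma>"])
      (use \<tau> \<tau>c P_carrier P_subgroup in \<open>auto simp: subgroup.m_closed subgroup.m_inv_closed subset_iff simp flip: m_assoc\<close>)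
  finally show "\<phi> \<tau> norm_X = norm_X" .
qed

lemma subdegree_norm_X: "norm_X \<noteq> 0" "subdegree norm_X = card P"
proof -
  have ne: "\<phi> \<sigma> fps_X \<noteq> 0" if "\<sigma> \<in> P" for \<sigma>
    using fps_algebra_aut.eq_0_iff[OF aut] that P_carrier by auto
  have "subdegree (\<phi> \<sigma> fps_X) = 1" if "\<sigma> \<in> P" for \<sigma>
  proof -
    interpret fps_algebra_aut "\<phi> \<sigma>" using that P_carrier by (intro aut) auto
    show ?thesis using nth_X_1_nonzero nth_0[of fps_X] by (intro subdegreeI) auto
  qed
  moreover show "norm_X \<noteq> 0" using ne finite_subset[OF P_carrier fin] by (auto simp: norm_X_def)
  ultimately show "subdegree norm_X = card P"
    unfolding norm_X_def by (subst subdegree_prod) (use ne in auto)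
qed

text \<open>Defined through minimality so that an invariant attaining it divides every invariant
  without constant term. This division is what makes such an invariant a uniformizer.\<close>

definition ramification_index :: nat where
  "ramification_index = (LEAST n. n > 0 \<and> (\<exists>w\<in>inv_ring. w \<noteq> 0 \<and> subdegree w = n))"

lemma ramification_index_attained:
  "ramification_index > 0 \<and> (\<exists>w\<in>inv_ring. w \<noteq> 0 \<and> subdegree w = ramification_index)"
  unfolding ramification_index_def
proof (rule LeastI)
  have "card P > 0" using card_P prime_p by (simp add: prime_gt_0_nat)
  then show "card P > 0 \<and> (\<exists>w\<in>inv_ring. w \<noteq> 0 \<and> subdegree w = card P)"
    using norm_X_fixed subdegree_norm_X by blast
qed

lemma ramification_index_le:
  assumes "w \<in> inv_ring" "w \<noteq> 0" "fps_nth w 0 = 0"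
  shows "ramification_index \<le> subdegree w"
  unfolding ramification_index_def
proof (rule Least_le)
  have "subdegree w \<noteq> 0" using assms(2,3) by (simp add: subdegree_eq_0_iff)
  then show "subdegree w > 0 \<and> (\<exists>v\<in>inv_ring. v \<noteq> 0 \<and> subdegree v = subdegree w)" using assms by blast
qed

context
  fixes w :: "'k fps"
  assumes w: "w \<in> inv_ring" "w \<noteq> 0" "subdegree w = ramification_index"
begin

lemma w_0: "fps_nth w 0 = 0"
  using w ramification_index_attained by (metis nth_less_subdegree_zero)

text \<open>By minimality of the order of \<open>w\<close>, the quotient exists as a power series;
  being a quotient of invariants, it is invariant.\<close>

lemma fixed_divisible:
  assumes "x \<in> inv_ring" "fps_nth x 0 = 0"
  shows "\<exists>y\<in>inv_ring. x = w * y"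
proof (cases "x = 0")
  case True
  then show ?thesis using fixed_const[of 0] by auto
next
  case False
  then have "w dvd x" using fps_dvd_iff[of w x] w ramification_index_le[OF assms(1) _ assms(2)] by simp
  then obtain y where y: "x = w * y" by (auto simp: dvd_def)
  with fixed_cancel[OF w(1,2)] assms(1) show ?thesis by auto
qed

lemma ramification_index_dvd_subdegree: "x \<in> inv_ring \<Longrightarrow> x \<noteq> 0 \<Longrightarrow> ramification_index dvd subdegree x"
proof (induction "subdegree x" arbitrary: x rule: less_induct)
  case less
  show ?case
  proof (cases "fps_nth x 0 = 0")
    case True
    then obtain y where y: "y \<in> inv_ring" "x = w * y" using fixed_divisible[OF less.prems(1)] by blast
    then have "y \<noteq> 0" "subdegree x = ramification_index + subdegree y" using less.prems(2) w by auto
    with less.hyps[OF _ y(1)] ramification_index_attained show ?thesis by simp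
  next
    case False
    then have "subdegree x = 0" by (simp add: subdegree_eq_0_iff)
    then show ?thesis by simp
  qed
qed

text \<open>With g(w) equal to a constant plus \<open>w * h\<close>, the defect of invariance of
  g(w) is \<open>w\<close> times that of \<open>h\<close>, and \<open>h\<close> is again a series in
  \<open>w\<close>. So the defect is divisible by all powers of \<open>w\<close> and
  vanishes.\<close>

lemma compose_fixed: "fps_compose g w \<in> inv_ring"
  unfolding fixed_fps_def
proof (intro CollectI ballI)
  fix \<sigma> assume \<sigma>: "\<sigma> \<in> P"
  then interpret \<sigma>: fps_algebra_aut "\<phi> \<sigma>" using P_carrier by (intro aut) auto
  have "w ^ n dvd \<phi> \<sigma> (fps_compose g w) - fps_compose g w" for n
  proof (induction n arbitrary: g)
    case (Suc n)
    define h where "h = fps_compose (fps_shift 1 g) w"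
    have g: "fps_compose g w = fps_const (fps_nth g 0) + w * h"
      unfolding h_def by (subst fps_eq_const_plus_X_mult[of g])
        (simp only: fps_compose_add_distrib fps_compose_mult_distrib[OF w_0] fps_const_compose fps_X_fps_compose_startby0[OF w_0])
    have "\<phi> \<sigma> w = w" using w(1) \<sigma> by (simp add: fixed_fps_def)
    then have "\<phi> \<sigma> (fps_compose g w) - fps_compose g w = w * (\<phi> \<sigma> h - h)"
      by (simp add: g \<sigma>.add \<sigma>.mult \<sigma>.const algebra_simps)
    moreover have "w * w ^ n dvd w * (\<phi> \<sigma> h - h)"
      unfolding h_def by (intro mult_dvd_mono Suc) simp
    ultimately show ?case by simp
  qed simp
  then show "\<phi> \<sigma> (fps_compose g w) = fps_compose g w"
    using fps_eq_0_if_power_dvd[OF w_0] by (metis right_minus_eq)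
qed

lemma fixed_imp_compose:
  assumes "x \<in> inv_ring"
  shows "\<exists>g. x = fps_compose g w"
proof -
  \<comment> \<open>Removing the constant term and dividing by \<open>w\<close>, which stays within
    the invariants.\<close>
  define step where "step x = (SOME y. y \<in> inv_ring \<and> x - fps_const (fps_nth x 0) = w * y)" for x
  have step: "step x \<in> inv_ring \<and> x - fps_const (fps_nth x 0) = w * step x" if "x \<in> inv_ring" for x
  proof -
    have "\<exists>y. y \<in> inv_ring \<and> x - fps_const (fps_nth x 0) = w * y"
      using fixed_divisible[OF fixed_diff[OF that fixed_const[of "fps_nth x 0"]]] by auto
    then show ?thesis unfolding step_def by (rule someI_ex)
  qed
  \<comment> \<open>The digits of \<open>x\<close> in base \<open>w\<close>: the constant terms of
    the successive remainders.\<close>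
  define g where "g x = Abs_fps (\<lambda>n. fps_nth ((step ^^ n) x) 0)" for x
  have g: "g x = fps_const (fps_nth x 0) + fps_X * g (step x)" for x
    by (rule fps_ext) (auto simp: g_def funpow_swap1 gr0_conv_Suc split: nat.splits)
  have gw: "fps_compose (g x) w = fps_const (fps_nth x 0) + w * fps_compose (g (step x)) w" for x
    by (subst g) (simp only: fps_compose_add_distrib fps_compose_mult_distrib[OF w_0] fps_const_compose fps_X_fps_compose_startby0[OF w_0])
  have "w ^ n dvd x - fps_compose (g x) w" if "x \<in> inv_ring" for n x
    using that
  proof (induction n arbitrary: x)
    case (Suc n)
    have "x = fps_const (fps_nth x 0) + w * step x" using step[OF Suc.prems] by (simp add: diff_eq_eq add.commute)
    with gw[of x] have "x - fps_compose (g x) w = w * (step x - fps_compose (g (step x)) w)"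
      unfolding right_diff_distrib by (metis add_diff_cancel_left)
    moreover have "w * w ^ n dvd w * (step x - fps_compose (g (step x)) w)"
      using step[OF Suc.prems] by (intro mult_dvd_mono Suc.IH) auto
    ultimately show ?case by simp
  qed simp
  then have "x - fps_compose (g x) w = 0" using assms fps_eq_0_if_power_dvd[OF w_0] by blast
  then show ?thesis by auto
qed

lemma uniformizer: "is_uniformizer \<phi> P w"
  unfolding is_uniformizer_def using w(2) w_0 compose_fixed fixed_imp_compose by blast

end

text \<open>An invariant \<open>w\<close> of least positive order is a series in \<open>u\<close>
  without constant term, hence a multiple of \<open>u\<close>; so the order of \<open>u\<close> is
  minimal as well.\<close>

lemma uniformizerD:
  assumes "is_uniformizer \<phi> P u"
  shows "u \<in> inv_ring" "u \<noteq> 0" "subdegree u = ramification_index"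
proof -
  have u: "u \<noteq> 0" "fps_nth u 0 = 0" "inv_ring = range (\<lambda>g. fps_compose g u)"
    using assms by (auto simp: is_uniformizer_def)
  have "fps_compose fps_X u = u" using u(2) by simp
  then show fixed: "u \<in> inv_ring" unfolding u(3) by (metis rangeI)
  show "u \<noteq> 0" by fact
  obtain w where w: "w \<in> inv_ring" "w \<noteq> 0" "subdegree w = ramification_index"
    using ramification_index_attained by blast
  obtain g where g: "w = fps_compose g u" using w(1) unfolding u(3) by auto
  have "fps_nth g 0 = 0" using w_0[OF w] g by simp
  then have "w = fps_compose (fps_X * fps_shift 1 g) u"
    using fps_eq_const_plus_X_mult[of g] g by simp
  then have "w = u * fps_compose (fps_shift 1 g) u"
    by (simp only: fps_compose_mult_distrib[OF u(2)] fps_X_fps_compose_startby0[OF u(2)])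
  then have "subdegree u \<le> subdegree w" using w(2) by (metis subdegree_mult le_add1 mult_zero_left mult_zero_right)
  then show "subdegree u = ramification_index"
    using ramification_index_le[OF fixed u(1,2)] w(3) by simp
qed

text \<open>Every uniformizer has order \<open>ramification_index\<close>, so comparing leading
  coefficients gives the quotient in the definition the same constant term, whichever uniformizer is
  taken. This constant term is the value singled out by the description operator.\<close>

lemma theta_char_eq:
  assumes \<sigma>: "\<sigma> \<in> carrier G"
  shows "theta_char \<phi> P \<sigma> = theta_0 \<sigma> ^ ramification_index"
proof -
  interpret \<sigma>: fps_algebra_aut "\<phi> \<sigma>" using \<sigma> by (rule aut)
  have quot: "\<phi> \<sigma> u / u \<in> inv_ring \<and> fps_nth (\<phi> \<sigma> u / u) 0 = theta_0 \<sigma> ^ ramification_index"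
    if u: "u \<in> inv_ring" "u \<noteq> 0" "subdegree u = ramification_index" for u
  proof -
    have fixed: "\<phi> \<sigma> u \<in> inv_ring" using \<sigma> u(1) by (rule fixed_translate)
    obtain q where q: "q \<in> inv_ring" "\<phi> \<sigma> u = u * q"
      using fixed_divisible[OF u fixed] w_0[OF u] by auto
    have "fps_nth (\<phi> \<sigma> u) (subdegree u) = fps_nth u (subdegree u) * theta_0 \<sigma> ^ subdegree u"
      unfolding theta_0_def by (rule \<sigma>.leading_coefficient[OF fps_X_power_subdegree_dvd])
    moreover have "fps_nth (u * q) (subdegree u) = fps_nth u (subdegree u) * fps_nth q 0"
    proof -
      have "fps_X ^ subdegree u dvd u" by (rule fps_X_power_subdegree_dvd)
      then obtain v where v: "u = fps_X ^ subdegree u * v" unfolding dvd_def by blast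
      have "fps_nth (fps_X ^ n * v) n = fps_nth v 0" "fps_nth (fps_X ^ n * v * q) n = fps_nth v 0 * fps_nth q 0" for n
        by (simp_all add: fps_X_power_mult_nth mult.assoc)
      from this[of "subdegree u"] show ?thesis unfolding v[symmetric] by simp
    qed
    ultimately have "fps_nth q 0 = theta_0 \<sigma> ^ ramification_index"
      using u q(2) nth_subdegree_nonzero[OF u(2)] by simp
    moreover have "\<phi> \<sigma> u / u = q" using q(2) u(2) by simp
    ultimately show ?thesis using q(1) by simp
  qed
  show ?thesis
    unfolding theta_char_def
  proof (rule the_equality)
    obtain u where u: "u \<in> inv_ring" "u \<noteq> 0" "subdegree u = ramification_index"
      using ramification_index_attained by blast
    note q = quot[OF u]
    have "\<exists>h\<in>inv_ring. \<phi> \<sigma> u / u - fps_const (theta_0 \<sigma> ^ ramification_index) = u * h"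
      by (rule fixed_divisible[OF u]) (use q fixed_diff fixed_const in auto)
    then show "\<exists>u. is_uniformizer \<phi> P u \<and>
        (\<exists>h\<in>inv_ring. \<phi> \<sigma> u / u - fps_const (theta_0 \<sigma> ^ ramification_index) = u * h)"
      using uniformizer[OF u] by blast
  next
    fix c assume "\<exists>u. is_uniformizer \<phi> P u \<and> (\<exists>h\<in>inv_ring. \<phi> \<sigma> u / u - fps_const c = u * h)"
    then obtain u h where u: "is_uniformizer \<phi> P u" and h: "\<phi> \<sigma> u / u - fps_const c = u * h" by blast
    have "fps_nth (\<phi> \<sigma> u / u - fps_const c) 0 = 0"
      unfolding h using u by (simp add: is_uniformizer_def)
    then show "c = theta_0 \<sigma> ^ ramification_index" using quot[OF uniformizerD[OF u]] by simp
  qed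
qed

lemma ramification_index_eq: "\<exists>e. ramification_index = p ^ e"
proof -
  obtain w where "w \<in> inv_ring" "w \<noteq> 0" "subdegree w = ramification_index"
    using ramification_index_attained by blast
  then have "ramification_index dvd p ^ s"
    using ramification_index_dvd_subdegree[of w norm_X] norm_X_fixed subdegree_norm_X card_P by simp
  then show ?thesis using divides_primepow_nat[OF prime_p] by blast
qed

end

subsection \<open>Roots of unity in the p-adic integers\<close>

text \<open>The difference \<open>x ^ p - y ^ p\<close> is \<open>x - y\<close> times a sum of
  \<open>p\<close> terms, all congruent to \<open>y ^ (p - 1)\<close> modulo \<open>p\<close>; so
  the sum contributes one more factor \<open>p\<close>.\<close>

lemma cong_power_prime_power_lift:
  fixes x y :: int
  assumes "[x = y] (mod int p ^ Suc j)"
  shows "[x ^ p = y ^ p] (mod int p ^ Suc (Suc j))"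
proof -
  have d: "int p ^ Suc j dvd x - y"
    using assms by (simp add: cong_iff_dvd_diff)
  then have xy: "[x = y] (mod int p)"
    by (metis cong_iff_dvd_diff dvd_mult_left power_Suc)
  have "[(\<Sum>i<p. y ^ (p - Suc i) * x ^ i) = (\<Sum>i<p. y ^ (p - Suc i) * y ^ i)] (mod int p)"
    by (intro cong_sum cong_mult cong_pow xy cong_refl)
  also have "(\<Sum>i<p. y ^ (p - Suc i) * y ^ i) = (\<Sum>i<p. y ^ (p - 1))"
    by (rule sum.cong) (auto simp flip: power_add)
  also have "\<dots> = int p * y ^ (p - 1)" by simp
  finally have "int p dvd (\<Sum>i<p. y ^ (p - Suc i) * x ^ i)"
    by (metis cong_0_iff cong_dvd_iff dvd_triv_left)
  with d have "int p ^ Suc j * int p dvd x ^ p - y ^ p"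
    unfolding power_diff_sumr2 by (rule mult_dvd_mono)
  then show ?thesis by (simp add: cong_iff_dvd_diff mult.commute)
qed

lemma cong_power_of_cong_mod_prime:
  fixes a b :: int
  assumes "[a = b] (mod int p)"
  shows "[a ^ p ^ j = b ^ p ^ j] (mod int p ^ Suc j)"
proof (induction j)
  case (Suc j)
  from cong_power_prime_power_lift[OF Suc] show ?case
    by (simp add: mult.commute flip: power_mult)
qed (use assms in simp)

text \<open>Raising to the power \<open>p ^ n\<close> turns a congruence modulo \<open>p\<close>
  into one modulo \<open>p ^ n\<close>. As \<open>m\<close> is prime to \<open>p\<close>, some
  multiple of \<open>p ^ n\<close> is 1 modulo \<open>m\<close>, and raising to that multiple
  changes neither \<open>a\<close> nor \<open>b\<close> modulo \<open>p ^ n\<close>.\<close>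

lemma cong_of_finite_order:
  fixes a b :: int and p m n :: nat
  assumes ab: "[a = b] (mod int p)" and a: "[a ^ m = 1] (mod int p ^ n)" and b: "[b ^ m = 1] (mod int p ^ n)"
    and m: "coprime m p" "p > 0"
  shows "[a = b] (mod int p ^ n)"
proof -
  have "coprime (p ^ n) m" using m(1) by (simp add: coprime_commute)
  then obtain u v where "p ^ n * u = m * v + 1"
    using bezout_nat[of "p ^ n" m] m(2) by auto
  then have uv: "p ^ n * u = Suc (m * v)" by simp
  have key: "[c = c ^ (p ^ n * u)] (mod int p ^ n)" if "[c ^ m = 1] (mod int p ^ n)" for c
  proof -
    have "[c * (c ^ m) ^ v = c * 1 ^ v] (mod int p ^ n)"
      by (intro cong_mult cong_pow that cong_refl)
    then show ?thesis unfolding uv by (simp add: power_mult cong_sym)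
  qed
  have "[a ^ p ^ n = b ^ p ^ n] (mod int p ^ n)"
    by (rule cong_dvd_modulus[OF cong_power_of_cong_mod_prime[OF ab]]) simp
  then have "[a ^ (p ^ n * u) = b ^ (p ^ n * u)] (mod int p ^ n)"
    unfolding power_mult by (rule cong_pow)
  with key[OF a] key[OF b] show ?thesis
    by (meson cong_sym cong_trans)
qed

section \<open>The p-adic integers and Teichmueller representatives\<close>

lemma padic_carrier:
  "x \<in> carrier (padic_int_ring p) \<longleftrightarrow>
     (\<forall>n. 0 \<le> x n \<and> x n < int p ^ n \<and> x (Suc n) mod int p ^ n = x n)"
  by (simp add: padic_int_ring_def)

lemma padic_mult: "x \<otimes>\<^bsub>padic_int_ring p\<^esub> y = (\<lambda>n. (x n * y n) mod int p ^ n)"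
  by (simp add: padic_int_ring_def)

lemma padic_one: "\<one>\<^bsub>padic_int_ring p\<^esub> = (\<lambda>n. 1 mod int p ^ n)"
  by (simp add: padic_int_ring_def)

lemma padic_carrierI:
  assumes "p > 0" "\<And>n. [f (Suc n) = f n] (mod int p ^ n)"
  shows "(\<lambda>n. f n mod int p ^ n) \<in> carrier (padic_int_ring p)"
  unfolding padic_carrier
proof (intro allI conjI)
  fix n
  show "f (Suc n) mod int p ^ Suc n mod int p ^ n = f n mod int p ^ n"
    using assms(2)[of n] by (simp add: mod_mod_cancel cong_def)
qed (use assms(1) in auto)

lemma padic_coherent:
  assumes "x \<in> carrier (padic_int_ring p)"
  shows "[x (Suc n) = x n] (mod int p ^ n)"
  using assms unfolding padic_carrier cong_def by (metis mod_mod_trivial)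

lemma padic_residue:
  assumes "x \<in> carrier (padic_int_ring p)" "n > 0"
  shows "[x n = x 1] (mod int p)"
  using assms(2)
proof (induction n rule: nat_induct_non_zero)
  case (Suc n)
  have "[x (Suc n) = x n] (mod int p)"
    by (rule cong_dvd_modulus[OF padic_coherent[OF assms(1)]]) (use Suc in auto)
  with Suc.IH show ?case by (rule cong_trans[rotated])
qed simp

lemma padic_comm_monoid:
  assumes "p > 0"
  shows "comm_monoid (padic_int_ring p)"
proof (rule comm_monoidI)
  fix x y assume "x \<in> carrier (padic_int_ring p)" "y \<in> carrier (padic_int_ring p)"
  then show "x \<otimes>\<^bsub>padic_int_ring p\<^esub> y \<in> carrier (padic_int_ring p)"
    unfolding padic_mult by (intro padic_carrierI cong_mult padic_coherent assms)
next
  show "\<one>\<^bsub>padic_int_ring p\<^esub> \<in> carrier (padic_int_ring p)"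
    unfolding padic_one by (intro padic_carrierI cong_refl assms)
next
  fix x assume "x \<in> carrier (padic_int_ring p)"
  then show "\<one>\<^bsub>padic_int_ring p\<^esub> \<otimes>\<^bsub>padic_int_ring p\<^esub> x = x"
    by (auto simp: padic_mult padic_one padic_carrier mod_mult_left_eq)
qed (auto simp: padic_mult mod_mult_left_eq mod_mult_right_eq mult_ac)

lemma padic_pow_nth:
  assumes "p > 0" "x \<in> carrier (padic_int_ring p)"
  shows "(x [^]\<^bsub>padic_int_ring p\<^esub> (m::nat)) n = x n ^ m mod int p ^ n"
  by (induction m) (auto simp: padic_one padic_mult nat_pow_def mod_mult_left_eq mod_mult_right_eq mult_ac)

lemma padic_eqI_finite_order:
  assumes p: "p > 0" and x: "x \<in> carrier (padic_int_ring p)" and y: "y \<in> carrier (padic_int_ring p)"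
    and "x [^]\<^bsub>padic_int_ring p\<^esub> m = \<one>\<^bsub>padic_int_ring p\<^esub>" "y [^]\<^bsub>padic_int_ring p\<^esub> m = \<one>\<^bsub>padic_int_ring p\<^esub>"
    and m: "coprime m p" and res: "x 1 = y 1"
  shows "x = y"
proof
  fix n
  have pow: "[z n ^ m = 1] (mod int p ^ n)"
    if "z \<in> carrier (padic_int_ring p)" "z [^]\<^bsub>padic_int_ring p\<^esub> m = \<one>\<^bsub>padic_int_ring p\<^esub>" for z
    using padic_pow_nth[OF p that(1), of m n] that(2) by (simp add: padic_one cong_def)
  have "[x n = y n] (mod int p ^ n)"
  proof (cases "n = 0")
    case False
    then have "[x n = y n] (mod int p)"
      using padic_residue[OF x, of n] padic_residue[OF y, of n] res by (metis cong_sym cong_trans neq0_conv)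
    then show ?thesis
      by (rule cong_of_finite_order[OF _ pow pow m p]) (use assms in auto)
  qed simp
  then show "x n = y n"
    using x y by (simp add: padic_carrier cong_def)
qed

text \<open>The limit of the iterated \<open>p\<close>-th powers of \<open>a\<close>. For prime
  \<open>p\<close> these powers are constant modulo \<open>p ^ n\<close> from the exponent
  \<open>p ^ (n - 1)\<close> on, so the exponent \<open>p ^ n\<close> already gives the right
  residue at level \<open>n\<close>.\<close>

definition teichmueller_padic :: "nat \<Rightarrow> int \<Rightarrow> nat \<Rightarrow> int" where
  "teichmueller_padic p a = (\<lambda>n. a ^ p ^ n mod int p ^ n)"

lemma teichmueller_padic_cong:
  assumes "[a = b] (mod int p)"
  shows "teichmueller_padic p a = teichmueller_padic p b"
proof
  fix n
  have "[a ^ p ^ n = b ^ p ^ n] (mod int p ^ n)"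
    by (rule cong_dvd_modulus[OF cong_power_of_cong_mod_prime[OF assms]]) simp
  then show "teichmueller_padic p a n = teichmueller_padic p b n"
    by (simp add: teichmueller_padic_def cong_def)
qed

lemma teichmueller_padic_mult:
  "teichmueller_padic p (a * b) = teichmueller_padic p a \<otimes>\<^bsub>padic_int_ring p\<^esub> teichmueller_padic p b"
  by (auto simp: teichmueller_padic_def padic_mult power_mult_distrib mod_mult_eq)

lemma teichmueller_padic_one: "teichmueller_padic p 1 = \<one>\<^bsub>padic_int_ring p\<^esub>"
  by (simp add: teichmueller_padic_def padic_one)

lemma fermat_int:
  fixes a :: int
  assumes "Factorial_Ring.prime p"
  shows "[a ^ p = a] (mod int p)"
proof (cases "int p dvd a")
  case True
  then have "int p dvd a ^ p - a"
    using assms by (intro dvd_diff) (auto simp: dvd_power prime_gt_0_nat intro: dvd_trans[OF True])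
  then show ?thesis by (simp add: cong_iff_dvd_diff)
next
  case False
  define b where "b = nat (a mod int p)"
  have ab: "[a = int b] (mod int p)"
    using prime_gt_0_nat[OF assms] by (simp add: b_def cong_def)
  then have nd: "\<not> p dvd b" using False by (metis cong_dvd_iff int_dvd_int_iff)
  then have "[b ^ (p - 1) = 1] (mod p)" using fermat_theorem[OF assms] by blast
  then have "[b ^ (p - 1) * b = 1 * b] (mod p)" by (rule cong_mult) simp
  moreover have "b ^ (p - 1) * b = b ^ p"
    using prime_gt_0_nat[OF assms] by (metis Suc_diff_1 power_Suc2)
  ultimately have "[b ^ p = b] (mod p)" by simp
  then have "[int b ^ p = int b] (mod int p)" by (metis cong_int_iff of_nat_power)
  then show ?thesis using ab by (meson cong_pow cong_sym cong_trans)
qed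

lemma teichmueller_padic_closed:
  assumes "Factorial_Ring.prime p"
  shows "teichmueller_padic p a \<in> carrier (padic_int_ring p)"
  unfolding teichmueller_padic_def
proof (rule padic_carrierI)
  fix n
  have "[(a ^ p) ^ p ^ n = a ^ p ^ n] (mod int p ^ Suc n)"
    by (rule cong_power_of_cong_mod_prime[OF fermat_int[OF assms]])
  then have "[(a ^ p) ^ p ^ n = a ^ p ^ n] (mod int p ^ n)"
    by (rule cong_dvd_modulus) simp
  then show "[a ^ p ^ Suc n = a ^ p ^ n] (mod int p ^ n)"
    by (simp add: power_mult)
qed (simp add: prime_gt_0_nat assms)

lemma teichmueller_padic_residue:
  assumes "Factorial_Ring.prime p"
  shows "[teichmueller_padic p a 1 = a] (mod int p)"
  using fermat_int[OF assms, of a] by (simp add: teichmueller_padic_def cong_def)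

lemma teichmueller_padic_Units:
  assumes "Factorial_Ring.prime p" "coprime a (int p)"
  shows "teichmueller_padic p a \<in> Units (padic_int_ring p)"
proof -
  obtain b where "[a * b = 1] (mod int p)"
    using cong_solve_coprime_int[OF assms(2)] by auto
  then have "teichmueller_padic p a \<otimes>\<^bsub>padic_int_ring p\<^esub> teichmueller_padic p b = \<one>\<^bsub>padic_int_ring p\<^esub>"
    by (metis teichmueller_padic_cong teichmueller_padic_mult teichmueller_padic_one)
  moreover from this have "teichmueller_padic p b \<otimes>\<^bsub>padic_int_ring p\<^esub> teichmueller_padic p a = \<one>\<^bsub>padic_int_ring p\<^esub>"
    by (metis mult.commute teichmueller_padic_mult)
  ultimately show ?thesis
    using teichmueller_padic_closed[OF assms(1)] by (auto simp: Units_def)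
qed

lemma padic_units_comm_group:
  assumes "p > 0" shows "comm_group (padic_units p)"
  using comm_monoid.units_comm_group[OF padic_comm_monoid[OF assms]] .

lemma padic_units_simps:
  "x \<otimes>\<^bsub>padic_units p\<^esub> y = x \<otimes>\<^bsub>padic_int_ring p\<^esub> y"
  "\<one>\<^bsub>padic_units p\<^esub> = \<one>\<^bsub>padic_int_ring p\<^esub>"
  "carrier (padic_units p) = Units (padic_int_ring p)"
  "x [^]\<^bsub>padic_units p\<^esub> (m::nat) = x [^]\<^bsub>padic_int_ring p\<^esub> m"
  by (simp_all add: units_of_def nat_pow_def)

section \<open>Characters with values in the p-adic units\<close>

context
  fixes G :: "('g, 'b) monoid_scheme" and p :: nat and D :: "'g set"
  assumes G: "group G" and p: "Factorial_Ring.prime p" and D: "subgroup D G" "finite D" "coprime (card D) p"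
begin

lemma padic_character_pow_card:
  assumes "\<chi> \<in> padic_characters G p D" "x \<in> D"
  shows "\<chi> x \<in> Units (padic_int_ring p)" "\<chi> x [^]\<^bsub>padic_int_ring p\<^esub> card D = \<one>\<^bsub>padic_int_ring p\<^esub>"
proof -
  interpret GD: group "G\<lparr>carrier := D\<rparr>" using G D(1) by (simp add: group.subgroup_imp_group)
  interpret U: comm_group "padic_units p" by (rule padic_units_comm_group) (simp add: p prime_gt_0_nat)
  interpret group_hom "G\<lparr>carrier := D\<rparr>" "padic_units p" \<chi>
    using assms(1) by unfold_locales (simp add: padic_characters_def)
  show "\<chi> x \<in> Units (padic_int_ring p)"
    using hom_closed[of x] assms(2) by (simp add: padic_units_simps)
  have "x [^]\<^bsub>G\<lparr>carrier := D\<rparr>\<^esub> card D = \<one>\<^bsub>G\<lparr>carrier := D\<rparr>\<^esub>"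
    using GD.pow_order_eq_1[of x] assms(2) by (simp add: Coset.order_def)
  then have "\<chi> x [^]\<^bsub>padic_units p\<^esub> card D = \<one>\<^bsub>padic_units p\<^esub>"
    using hom_nat_pow[of x "card D"] assms(2) hom_one by simp
  then show "\<chi> x [^]\<^bsub>padic_int_ring p\<^esub> card D = \<one>\<^bsub>padic_int_ring p\<^esub>"
    by (simp add: padic_units_simps)
qed

text \<open>The values are roots of unity of order dividing \<open>card D\<close>, which is prime to
  \<open>p\<close>, and such roots are determined by their residues.\<close>

lemma padic_characters_eqI:
  assumes "\<chi> \<in> padic_characters G p D" "\<chi>' \<in> padic_characters G p D"
    and "\<And>x. x \<in> D \<Longrightarrow> [\<chi> x 1 = \<chi>' x 1] (mod int p)"
  shows "\<chi> = \<chi>'"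
proof (rule extensionalityI[of _ D])
  fix x assume x: "x \<in> D"
  have c: "\<chi> x \<in> carrier (padic_int_ring p)" "\<chi>' x \<in> carrier (padic_int_ring p)"
    using padic_character_pow_card(1)[OF assms(1) x] padic_character_pow_card(1)[OF assms(2) x]
    by (auto simp: Units_def)
  then have "0 \<le> \<chi> x 1" "\<chi> x 1 < int p ^ 1" "0 \<le> \<chi>' x 1" "\<chi>' x 1 < int p ^ 1"
    unfolding padic_carrier by blast+
  with assms(3)[OF x] have "\<chi> x 1 = \<chi>' x 1"
    by (simp add: cong_def)
  then show "\<chi> x = \<chi>' x"
    using padic_eqI_finite_order[OF _ c] padic_character_pow_card(2)[OF assms(1) x]
      padic_character_pow_card(2)[OF assms(2) x] D(3) p by (auto simp: prime_gt_0_nat)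
qed (use assms in \<open>auto simp: padic_characters_def\<close>)

lemma teichmueller_padic_character:
  assumes "\<And>x. x \<in> D \<Longrightarrow> coprime (r x) (int p)"
    and "\<And>x y. x \<in> D \<Longrightarrow> y \<in> D \<Longrightarrow> [r (x \<otimes>\<^bsub>G\<^esub> y) = r x * r y] (mod int p)"
  shows "(\<lambda>x\<in>D. teichmueller_padic p (r x)) \<in> padic_characters G p D"
  using assms D(1) unfolding padic_characters_def
  by (auto simp: hom_def padic_units_simps teichmueller_padic_Units p subgroup.m_closed
      teichmueller_padic_cong simp flip: teichmueller_padic_mult)

text \<open>The integers \<open>r x\<close> need to be multiplicative modulo \<open>p\<close> only,
  because a Teichmueller representative depends just on the residue. The clause on orders holds
  since the representative of a power of \<open>r x\<close> is 1 exactly if that power is 1 modulo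
  \<open>p\<close>.\<close>

lemma teichmueller_lift_eq:
  fixes \<eta> :: "'g \<Rightarrow> 'k::field"
  assumes k: "CHAR('k) = p"
    and cop: "\<And>x. x \<in> D \<Longrightarrow> coprime (r x) (int p)"
    and hom: "\<And>x y. x \<in> D \<Longrightarrow> y \<in> D \<Longrightarrow> [r (x \<otimes>\<^bsub>G\<^esub> y) = r x * r y] (mod int p)"
    and \<eta>: "\<And>x. x \<in> D \<Longrightarrow> \<eta> x = of_int (r x)"
  shows "teichmueller_lift G p D \<eta> = (\<lambda>x\<in>D. teichmueller_padic p (r x))" (is "_ = ?\<tau>")
  unfolding teichmueller_lift_def
proof (rule the_equality)
  interpret U: comm_group "padic_units p" by (rule padic_units_comm_group) (simp add: p prime_gt_0_nat)
  have eq_iff: "(of_int a :: 'k) = of_int b \<longleftrightarrow> [a = b] (mod int p)" for a b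
    by (simp add: of_int_eq_iff_cong_CHAR k)
  have \<tau>: "?\<tau> \<in> padic_characters G p D"
    by (rule teichmueller_padic_character[OF cop hom])
  have one: "?\<tau> x [^]\<^bsub>padic_units p\<^esub> n = \<one>\<^bsub>padic_units p\<^esub> \<longleftrightarrow> \<eta> x ^ n = 1" if x: "x \<in> D" for x and n :: nat
  proof -
    have pow: "teichmueller_padic p (r x) [^]\<^bsub>padic_units p\<^esub> n = teichmueller_padic p (r x ^ n)"
      by (induction n) (simp_all add: padic_units_simps teichmueller_padic_one mult.commute flip: teichmueller_padic_mult)
    have "teichmueller_padic p (r x ^ n) = teichmueller_padic p 1 \<longleftrightarrow> [r x ^ n = 1] (mod int p)"
      using teichmueller_padic_cong[of "r x ^ n" 1] teichmueller_padic_residue[OF p, of "r x ^ n"]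
        teichmueller_padic_residue[OF p, of 1] by (metis cong_sym cong_trans)
    also have "\<dots> \<longleftrightarrow> \<eta> x ^ n = 1"
      using eq_iff[of "r x ^ n" 1] \<eta>[OF x] by simp
    finally show ?thesis
      using x pow by (simp add: teichmueller_padic_one padic_units_simps)
  qed
  show "?\<tau> \<in> padic_characters G p D \<and> (\<forall>x\<in>D. of_int (?\<tau> x 1) = \<eta> x) \<and>
    (\<forall>n. (\<forall>x\<in>D. ?\<tau> x [^]\<^bsub>padic_units p\<^esub> n = \<one>\<^bsub>padic_units p\<^esub>) = (\<forall>x\<in>D. \<eta> x ^ n = 1))"
    using \<tau> one eq_iff teichmueller_padic_residue[OF p] \<eta> by auto
  fix \<tau> assume "\<tau> \<in> padic_characters G p D \<and> (\<forall>x\<in>D. of_int (\<tau> x 1) = \<eta> x) \<and>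
    (\<forall>n. (\<forall>x\<in>D. \<tau> x [^]\<^bsub>padic_units p\<^esub> n = \<one>\<^bsub>padic_units p\<^esub>) = (\<forall>x\<in>D. \<eta> x ^ n = 1))"
  then have \<tau>': "\<tau> \<in> padic_characters G p D" "\<And>x. x \<in> D \<Longrightarrow> of_int (\<tau> x 1) = \<eta> x" by auto
  show "\<tau> = ?\<tau>"
  proof (rule padic_characters_eqI[OF \<tau>'(1) \<tau>])
    fix x assume x: "x \<in> D"
    then have "[\<tau> x 1 = r x] (mod int p)" using \<tau>'(2)[OF x] \<eta>[OF x] eq_iff by auto
    then show "[\<tau> x 1 = ?\<tau> x 1] (mod int p)"
      using x teichmueller_padic_residue[OF p, of "r x"] by (auto intro: cong_trans cong_sym)
  qed
qed

end

text \<open>The exponent \<open>r x\<close> is determined modulo the order \<open>p ^ s\<close> of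
  \<sigma>, and there it has multiplicative order prime to \<open>p\<close>. Therefore it agrees
  modulo \<open>p ^ s\<close> with the Teichmueller representative of its residue, which can replace
  it as an exponent on \<open>T\<close>.\<close>

lemma chi_char_eq:
  fixes G :: "('g, 'b) monoid_scheme" (structure)
  defines "D C T \<equiv> normalizer_in G C T"
  assumes G: "group G" and p: "Factorial_Ring.prime p" and D: "subgroup (D C T) G" "finite (D C T)" "coprime (card (D C T)) p"
    and \<sigma>: "\<sigma> \<in> carrier G" "group.ord G \<sigma> = p ^ s" "s > 0"
    and T: "\<And>y. y \<in> T \<longleftrightarrow> (\<exists>j::int. y = \<sigma> [^]\<^bsub>G\<^esub> j)"
    and r: "\<And>x. x \<in> D C T \<Longrightarrow> x \<otimes>\<^bsub>G\<^esub> \<sigma> \<otimes>\<^bsub>G\<^esub> inv\<^bsub>G\<^esub> x = \<sigma> [^]\<^bsub>G\<^esub> (r x :: int)"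
  shows "chi_char G p C T = (\<lambda>x\<in>D C T. teichmueller_padic p (r x))"
    and "x \<in> D C T \<Longrightarrow> coprime (r x) (int p)"
proof -
  interpret group G by fact
  have Dc: "x \<in> carrier G" if "x \<in> D C T" for x using D(1) that by (rule subgroup.mem_carrier)
  have ppos: "p > 0" by (simp add: p prime_gt_0_nat)
  have pow_eq: "\<sigma> [^] a = \<sigma> [^] b \<longleftrightarrow> [a = b] (mod int p ^ s)" for a b :: int
    using int_pow_eq[OF \<sigma>(1), of a b] \<sigma>(2) by (simp add: cong_iff_dvd_diff dvd_diff_commute)
  have conj_pow: "x \<otimes> y [^] j \<otimes> inv x = (x \<otimes> y \<otimes> inv x) [^] j"
    if "x \<in> carrier G" "y \<in> carrier G" for x y and j :: int
  proof -
    interpret c: group_hom G G "\<lambda>y. x \<otimes> y \<otimes> inv x"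
      using that by unfold_locales (auto simp: hom_def m_assoc inv_solve_left)
    show ?thesis using c.hom_int_pow[OF that(2)] by simp
  qed
  have hom_s: "[r (x \<otimes> y) = r x * r y] (mod int p ^ s)" if x: "x \<in> D C T" and y: "y \<in> D C T" for x y
  proof -
    have xy: "x \<otimes> y \<in> D C T" using x y D(1) by (simp add: subgroup.m_closed)
    have "\<sigma> [^] r (x \<otimes> y) = x \<otimes> (y \<otimes> \<sigma> \<otimes> inv y) \<otimes> inv x"
      using r[OF xy] Dc[OF x] Dc[OF y] \<sigma>(1) by (simp add: m_assoc inv_mult_group)
    also have "\<dots> = (x \<otimes> \<sigma> \<otimes> inv x) [^] r y"
      using conj_pow r[OF y] Dc[OF x] \<sigma>(1) by simp
    also have "\<dots> = \<sigma> [^] (r x * r y)"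
      using r[OF x] \<sigma>(1) by (simp add: int_pow_pow)
    finally show ?thesis by (simp add: pow_eq)
  qed
  have one_s: "[r \<one> = 1] (mod int p ^ s)"
    using r[of \<one>] D(1) \<sigma>(1) pow_eq[of "r \<one>" 1] by (simp add: subgroup.one_closed int_pow_1)
  have pow_r: "[r x ^ n = r (x [^] n)] (mod int p ^ s)" if x: "x \<in> D C T" for x and n :: nat
  proof (induction n)
    case (Suc n)
    have xn: "x [^] n \<in> D C T" 
      using subgroup.subgroup_is_submonoid[OF D(1)] x by (metis D(1) int_pow_int subgroup_int_pow_closed)
    have "[r x ^ n * r x = r (x [^] n) * r x] (mod int p ^ s)"
      using Suc by (rule cong_mult) simp
    also have "[r (x [^] n) * r x = r (x [^] n \<otimes> x)] (mod int p ^ s)"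
      using hom_s[OF xn x] by (rule cong_sym)
    finally show ?case by (simp add: mult.commute)
  qed (use one_s in \<open>simp add: cong_sym\<close>)
  define m where "m = card (D C T)"
  have r_m: "[r x ^ m = 1] (mod int p ^ s)" if x: "x \<in> D C T" for x
  proof -
    interpret GD: group "G\<lparr>carrier := D C T\<rparr>" using D(1) by (rule subgroup_imp_group)
    have "x [^]\<^bsub>G\<lparr>carrier := D C T\<rparr>\<^esub> m = \<one>\<^bsub>G\<lparr>carrier := D C T\<rparr>\<^esub>"
      using GD.pow_order_eq_1[of x] x by (simp add: Coset.order_def m_def)
    then have "x [^] m = \<one>" by (simp flip: nat_pow_consistent)
    with pow_r[OF x, of m] one_s show ?thesis by (metis cong_trans)
  qed
  have p_s: "int p dvd int p ^ s" using \<sigma>(3) by simp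
  have m_pos: "m > 0" 
    using D(2) subgroup.one_closed[OF D(1)] by (auto simp: m_def card_gt_0_iff)
  show cop: "coprime (r x) (int p)" if x: "x \<in> D C T" for x
  proof -
    have "[r x ^ m = 1] (mod int p)" using r_m[OF x] p_s by (rule cong_dvd_modulus)
    then have "coprime (r x ^ m) (int p)" by (metis cong_imp_coprime cong_sym coprime_1_left)
    then show ?thesis using m_pos by simp
  qed
  have hom: "[r (x \<otimes>\<^bsub>G\<^esub> y) = r x * r y] (mod int p)" if "x \<in> D C T" "y \<in> D C T" for x y
    using hom_s[OF that] p_s by (rule cong_dvd_modulus)
  have \<tau>: "(\<lambda>x\<in>D C T. teichmueller_padic p (r x)) \<in> padic_characters G p (D C T)" (is "?\<tau> \<in> _")
    using teichmueller_padic_character[OF G p D cop hom] .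
  show "chi_char G p C T = ?\<tau>"
    unfolding chi_char_def D_def[symmetric]
  proof (rule the_equality)
    have "x \<otimes> y \<otimes> inv x = padic_pow G p y (?\<tau> x)" if x: "x \<in> D C T" and y: "y \<in> T" for x y
    proof -
      obtain j :: int where j: "y = \<sigma> [^] j" using y T by auto
      have yc: "y \<in> carrier G" using j \<sigma>(1) by simp
      have lhs: "x \<otimes> y \<otimes> inv x = y [^] r x"
        using conj_pow[OF Dc[OF x] \<sigma>(1), of j] r[OF x] \<sigma>(1)
        by (simp add: j int_pow_pow mult.commute)
      define N where "N = (LEAST n. y [^] (p ^ n) = \<one>)"
      have ys: "y [^] (p ^ s) = \<one>"
        using \<sigma>(1,2) pow_ord_eq_1[OF \<sigma>(1)] unfolding j
        by (metis int_pow_int int_pow_one int_pow_pow mult.commute)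
      have yN: "y [^] (p ^ N) = \<one>" unfolding N_def using ys by (rule LeastI)
      have Ns: "N \<le> s" unfolding N_def using ys by (rule Least_le)
      have "[r x = teichmueller_padic p (r x) N] (mod int p ^ N)"
      proof (cases "N = 0")
        case False
        \<comment> \<open>Both sides have the same residue modulo \<open>p\<close>; the exponent
          \<open>m * (p - 1)\<close> is prime to \<open>p\<close> and kills both modulo
          \<open>p ^ N\<close>.\<close>
        show ?thesis
        proof (rule cong_of_finite_order[where m = "m * (p - 1)"])
          show "[r x = teichmueller_padic p (r x) N] (mod int p)"
            using padic_residue[OF teichmueller_padic_closed[OF p], of N "r x"] False
              teichmueller_padic_residue[OF p, of "r x"] by (metis cong_sym cong_trans neq0_conv)
          have rN: "[r x ^ m = 1] (mod int p ^ N)"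
            using r_m[OF x] by (rule cong_dvd_modulus) (simp add: le_imp_power_dvd Ns)
          then show "[r x ^ (m * (p - 1)) = 1] (mod int p ^ N)"
            unfolding power_mult by (metis cong_pow power_one)
          have "[teichmueller_padic p (r x) N = r x ^ p ^ N] (mod int p ^ N)"
            by (simp add: teichmueller_padic_def cong_def)
          then have "[teichmueller_padic p (r x) N ^ (m * (p - 1)) = (r x ^ p ^ N) ^ (m * (p - 1))] (mod int p ^ N)"
            by (rule cong_pow)
          also have "(r x ^ p ^ N) ^ (m * (p - 1)) = (r x ^ m) ^ (p ^ N * (p - 1))"
            by (simp add: mult.commute mult.left_commute flip: power_mult)
          also have "[\<dots> = 1] (mod int p ^ N)" using rN by (metis cong_pow power_one)
          finally show "[teichmueller_padic p (r x) N ^ (m * (p - 1)) = 1] (mod int p ^ N)" .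
          have "coprime (p - 1) p" by (rule coprime_diff_one_left_nat[OF ppos])
          then show "coprime (m * (p - 1)) p" using D(3) by (simp add: m_def)
        qed (rule ppos)
      qed simp
      then have "int (ord y) dvd r x - teichmueller_padic p (r x) N"
        using pow_eq_id[OF yc, of "p ^ N"] yN
        by (metis cong_iff_dvd_diff dvd_trans int_dvd_int_iff of_nat_power)
      then have "y [^] r x = y [^] teichmueller_padic p (r x) N"
        using int_pow_eq[OF yc] by (simp add: dvd_diff_commute)
      then show ?thesis
        using lhs x by (simp add: padic_pow_def N_def)
    qed
    moreover have "\<exists>n::nat. n > 0 \<and> coprime n p \<and> ?\<tau> x [^]\<^bsub>padic_units p\<^esub> n = \<one>\<^bsub>padic_units p\<^esub>"
      if "x \<in> D C T" for x
      using padic_character_pow_card(2)[OF G p D \<tau> that] m_pos D(3)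
      by (intro exI[of _ m]) (simp add: m_def padic_units_simps)
    ultimately show "?\<tau> \<in> padic_characters G p (D C T) \<and>
      (\<forall>x\<in>D C T. \<exists>n>0. coprime n p \<and> ?\<tau> x [^]\<^bsub>padic_units p\<^esub> n = \<one>\<^bsub>padic_units p\<^esub>) \<and>
      (\<forall>x\<in>D C T. \<forall>y\<in>T. x \<otimes> y \<otimes> inv x = padic_pow G p y (?\<tau> x))"
      using \<tau> by blast
    fix \<chi> assume "\<chi> \<in> padic_characters G p (D C T) \<and>
      (\<forall>x\<in>D C T. \<exists>n>0. coprime n p \<and> \<chi> x [^]\<^bsub>padic_units p\<^esub> n = \<one>\<^bsub>padic_units p\<^esub>) \<and>
      (\<forall>x\<in>D C T. \<forall>y\<in>T. x \<otimes> y \<otimes> inv x = padic_pow G p y (\<chi> x))"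
    then have \<chi>: "\<chi> \<in> padic_characters G p (D C T)"
      and act: "\<And>x y. x \<in> D C T \<Longrightarrow> y \<in> T \<Longrightarrow> x \<otimes> y \<otimes> inv x = padic_pow G p y (\<chi> x)" by auto
    have \<sigma>T: "\<sigma> \<in> T" using T \<sigma>(1) by (metis int_pow_1)
    \<comment> \<open>At the generator, \<open>padic_pow\<close> reads the exponent at level
      \<open>s\<close>, so the defining relation at \<sigma> determines a candidate modulo
      \<open>p ^ s\<close>, and with it its residue.\<close>
    have least: "(LEAST n. \<sigma> [^] (p ^ n) = \<one>) = s"
    proof (rule Least_equality)
      show "\<sigma> [^] (p ^ s) = \<one>" using \<sigma>(2) pow_ord_eq_1[OF \<sigma>(1)] by simp
      fix n assume "\<sigma> [^] (p ^ n) = \<one>"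
      then have "p ^ s dvd p ^ n" using pow_eq_id[OF \<sigma>(1)] \<sigma>(2) by simp
      then show "s \<le> n" using prime_gt_1_nat[OF p] by (simp add: power_dvd_imp_le)
    qed
    show "\<chi> = ?\<tau>"
    proof (rule padic_characters_eqI[OF G p D \<chi> \<tau>])
      fix x assume x: "x \<in> D C T"
      have "\<sigma> [^] r x = \<sigma> [^] \<chi> x s"
        using act[OF x \<sigma>T] r[OF x] by (simp add: padic_pow_def least)
      then have "[r x = \<chi> x s] (mod int p)"
        unfolding pow_eq using p_s by (rule cong_dvd_modulus)
      moreover have "[\<chi> x s = \<chi> x 1] (mod int p)"
        using padic_character_pow_card(1)[OF G p D \<chi> x] \<sigma>(3) by (intro padic_residue) (auto simp: Units_def)
      moreover have "[?\<tau> x 1 = r x] (mod int p)"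
        using teichmueller_padic_residue[OF p, of "r x"] x by simp
      ultimately show "[\<chi> x 1 = ?\<tau> x 1] (mod int p)"
        by (meson cong_sym cong_trans)
    qed
  qed
qed

subsection \<open>Passing to a subgroup\<close>

context group
begin

lemma cyclic_subgroup_restrict_iff:
  assumes "subgroup H G"
  shows "cyclic_subgroup T (G\<lparr>carrier := H\<rparr>) \<longleftrightarrow> cyclic_subgroup T G \<and> T \<subseteq> H"
proof -
  have "subgroup T (G\<lparr>carrier := H\<rparr>) \<longleftrightarrow> subgroup T G \<and> T \<subseteq> H"
    using assms incl_subgroup[OF assms] subgroup_incl[OF _ assms] subgroup.subset[of T "G\<lparr>carrier := H\<rparr>"] by auto
  then show ?thesis by (auto simp: cyclic_subgroup_def)
qed

lemma cyclic_over_restrict: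
  "subgroup H G \<Longrightarrow> cyclic_over (G\<lparr>carrier := H\<rparr>) T = {\<Gamma> \<in> cyclic_over G T. \<Gamma> \<subseteq> H}"
  by (auto simp: cyclic_over_def cyclic_subgroup_restrict_iff)

lemma subgroup_index_restrict [simp]: "subgroup_index (G\<lparr>carrier := H\<rparr>) K T = subgroup_index G K T"
  by (simp add: subgroup_index_def)

lemma moebius_sum_restrict:
  "subgroup H G \<Longrightarrow> moebius_sum (G\<lparr>carrier := H\<rparr>) F T =
    (\<Sum>\<Gamma> | \<Gamma> \<in> cyclic_over G T \<and> \<Gamma> \<subseteq> H. moebius (subgroup_index G \<Gamma> T) * F \<Gamma>)"
  by (simp add: moebius_sum_def cyclic_over_restrict)

lemma conj_set_restrict:
  "subgroup H G \<Longrightarrow> g \<in> H \<Longrightarrow> conj_set (G\<lparr>carrier := H\<rparr>) g T = conj_set G g T"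
  by (simp add: conj_set_def m_inv_consistent)

lemma normalizer_restrict:
  assumes "subgroup H G" "T \<subseteq> H"
  shows "normalizer (G\<lparr>carrier := H\<rparr>) T = normalizer_in G H T"
proof -
  interpret H: group "G\<lparr>carrier := H\<rparr>" using assms(1) by (rule subgroup_imp_group)
  have "H \<subseteq> carrier G" using assms(1) by (rule subgroup.subset)
  then show ?thesis
    using assms by (auto simp: H.normalizer_eq normalizer_in_eq conj_set_restrict)
qed

lemma generate_restrict:
  assumes "subgroup H G" "x \<in> H"
  shows "generate (G\<lparr>carrier := H\<rparr>) {x} = generate G {x}"
  using generate_consistent[of "{x}" H] assms by simp

lemma subgroup_centralizer_in:
  assumes "subgroup A G" "B \<subseteq> carrier G"
  shows "subgroup (centralizer_in G A B) G"
proof (rule subgroupI)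
  have A: "A \<subseteq> carrier G" using assms(1) by (rule subgroup.subset)
  show "centralizer_in G A B \<subseteq> carrier G" using A by (auto simp: centralizer_in_def)
  have "\<one> \<in> centralizer_in G A B" using assms by (auto simp: centralizer_in_def subgroup.one_closed)
  then show "centralizer_in G A B \<noteq> {}" by blast
  fix a assume a: "a \<in> centralizer_in G A B"
  then have ac: "a \<in> carrier G" "a \<in> A" using A by (auto simp: centralizer_in_def)
  have "inv a \<otimes> y = y \<otimes> inv a" if "y \<in> B" for y
  proof -
    have yc: "y \<in> carrier G" using that assms(2) by auto
    have "a \<otimes> y = y \<otimes> a" using a that by (simp add: centralizer_in_def)
    then have "inv a \<otimes> (a \<otimes> y) \<otimes> inv a = inv a \<otimes> (y \<otimes> a) \<otimes> inv a" by simp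
    then show ?thesis using ac yc by (simp add: m_assoc inv_mult_cancel)
  qed
  then show "inv a \<in> centralizer_in G A B" using ac assms(1) by (simp add: centralizer_in_def subgroup.m_inv_closed)
  fix b assume b: "b \<in> centralizer_in G A B"
  then have bc: "b \<in> carrier G" "b \<in> A" using A by (auto simp: centralizer_in_def)
  have "a \<otimes> b \<otimes> y = y \<otimes> (a \<otimes> b)" if "y \<in> B" for y
  proof -
    have yc: "y \<in> carrier G" using that assms(2) by auto
    have "a \<otimes> b \<otimes> y = a \<otimes> (y \<otimes> b)" using b that ac bc yc by (simp add: centralizer_in_def m_assoc)
    also have "\<dots> = (y \<otimes> a) \<otimes> b" using a that ac bc yc by (simp add: centralizer_in_def flip: m_assoc)
    finally show ?thesis using ac bc yc by (simp add: m_assoc)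
  qed
  then show "a \<otimes> b \<in> centralizer_in G A B"
    using ac bc assms(1) by (simp add: centralizer_in_def subgroup.m_closed)
qed

end

lemma int_dvd_if_prime_power_dvd:
  fixes m :: nat and b :: int
  assumes "m > 0" "\<And>q k. Factorial_Ring.prime q \<Longrightarrow> q ^ k dvd m \<Longrightarrow> int q ^ k dvd b"
  shows "int m dvd b"
proof (cases "b = 0")
  case False
  have "m dvd nat \<bar>b\<bar>"
  proof (rule multiplicity_le_imp_dvd)
    fix q :: nat assume q: "Factorial_Ring.prime q"
    have "q ^ multiplicity q m dvd nat \<bar>b\<bar>"
      using assms(2)[OF q multiplicity_dvd] by (simp add: nat_abs_dvd_iff flip: of_nat_power)
    then show "multiplicity q m \<le> multiplicity q (nat \<bar>b\<bar>)"
      using False q by (intro multiplicity_geI) (auto simp: prime_gt_1_nat not_prime_unit)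
  qed (use assms(1) in simp)
  then show ?thesis by (metis int_dvd_int_iff dvd_abs_iff abs_ge_zero nat_0_le)
qed simp

section \<open>The criterion in terms of Moebius sums, for G and for P\<close>

context tame_extension
begin

abbreviation GP :: "('g, 'b) monoid_scheme" where "GP \<equiv> G\<lparr>carrier := P\<rparr>"

abbreviation F :: "'g set \<Rightarrow> int" where "F \<Gamma> \<equiv> int (lower_depth \<Gamma>)"

lemma F_generate:
  "\<sigma> \<in> carrier G \<Longrightarrow> \<sigma> \<noteq> \<one> \<Longrightarrow> int (depth \<sigma>) = F (generate G {\<sigma>})"
  by (simp add: lower_depth_generate)

lemma F_conj_set: "g \<in> carrier G \<Longrightarrow> \<Gamma> \<subseteq> carrier G \<Longrightarrow> F (conj_set G g \<Gamma>) = F \<Gamma>"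
  by (simp add: conj_set_def lower_depth_conj)

lemma cyclic_carrier: "cyclic_subgroup \<Gamma> G \<Longrightarrow> \<Gamma> \<subseteq> carrier G"
  using cyclic_subgroup_imp_subgroup subgroup.subset by blast

lemma cyclic_generator:
  assumes "cyclic_subgroup T G" "T \<noteq> {\<one>}"
  obtains \<sigma> where "\<sigma> \<in> carrier G" "\<sigma> \<noteq> \<one>" "T = generate G {\<sigma>}" "\<sigma> \<in> T"
proof -
  obtain \<sigma> where \<sigma>: "\<sigma> \<in> carrier G" "T = generate G {\<sigma>}" using assms(1) cyclic_subgroup_iff by blast
  then show thesis
    using that assms(2) generate_eq_one_iff[OF \<sigma>(1)] by (auto intro: generate.incl)
qed

lemma F_outside_P:
  assumes "cyclic_subgroup \<Gamma> G" "\<not> \<Gamma> \<subseteq> P"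
  shows "F \<Gamma> = 1"
proof -
  have "\<Gamma> \<noteq> {\<one>}" using assms(2) subgroup.one_closed[OF P_subgroup] by auto
  then obtain \<sigma> where \<sigma>: "\<sigma> \<in> carrier G" "\<sigma> \<noteq> \<one>" "\<Gamma> = generate G {\<sigma>}"
    using assms(1) cyclic_generator by metis
  then have "\<sigma> \<notin> P" using assms(2) generate_subset_iff[OF \<sigma>(1) P_subgroup] by simp
  then show ?thesis unfolding \<sigma>(3) lower_depth_generate[OF \<sigma>(1,2)] using depth_outside_P[OF \<sigma>(1)] by simp
qed

lemma F_in_P:
  assumes "cyclic_subgroup T G" "T \<subseteq> P" "T \<noteq> {\<one>}"
  shows "lower_depth T \<ge> 2"
proof -
  obtain \<sigma> where \<sigma>: "\<sigma> \<in> carrier G" "\<sigma> \<noteq> \<one>" "T = generate G {\<sigma>}" "\<sigma> \<in> T"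
    using assms(1,3) by (rule cyclic_generator)
  then have "\<sigma> \<in> ramification_group 2" using assms(2) P_eq by auto
  then show ?thesis using \<sigma> by (simp add: lower_depth_generate mem_ramification_group_iff)
qed

lemma moebius_sum_split:
  "moebius_sum G F T = moebius_sum GP F T + b_prime G P T"
proof -
  have f: "finite (cyclic_over G T)" using fin by (rule finite_cyclic_over)
  have "moebius_sum G F T = (\<Sum>\<Gamma> | \<Gamma> \<in> cyclic_over G T \<and> \<Gamma> \<subseteq> P. moebius (subgroup_index G \<Gamma> T) * F \<Gamma>)
    + (\<Sum>\<Gamma> | \<Gamma> \<in> cyclic_over G T \<and> \<not> \<Gamma> \<subseteq> P. moebius (subgroup_index G \<Gamma> T) * F \<Gamma>)"
    unfolding moebius_sum_def by (subst sum.union_disjoint[symmetric]) (use f in \<open>auto intro!: sum.cong\<close>)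
  also have "(\<Sum>\<Gamma> | \<Gamma> \<in> cyclic_over G T \<and> \<not> \<Gamma> \<subseteq> P. moebius (subgroup_index G \<Gamma> T) * F \<Gamma>) = b_prime G P T"
    unfolding b_prime_def by (rule sum.cong) (auto simp: cyclic_over_def F_outside_P)
  finally show ?thesis by (simp add: moebius_sum_restrict[OF P_subgroup])
qed

lemma b_double_prime_split:
  "b_double_prime G T = (\<Sum>\<Gamma>\<in>cyclic_over GP T. moebius (subgroup_index G \<Gamma> T)) + b_prime G P T"
proof -
  have f: "finite (cyclic_over G T)" using fin by (rule finite_cyclic_over)
  show ?thesis unfolding b_double_prime_def b_prime_def cyclic_over_restrict[OF P_subgroup]
    by (subst sum.union_disjoint[symmetric]) (use f in \<open>auto intro!: sum.cong\<close>)
qed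

lemma GP_facts:
  shows "group GP" "finite (carrier GP)"
    and "\<sigma> \<in> carrier GP \<Longrightarrow> \<sigma> \<noteq> \<one>\<^bsub>GP\<^esub> \<Longrightarrow> int (depth \<sigma>) = F (generate GP {\<sigma>})"
    and "g \<in> carrier GP \<Longrightarrow> cyclic_subgroup \<Gamma> GP \<Longrightarrow> F (conj_set GP g \<Gamma>) = F \<Gamma>"
proof -
  show "group GP" using P_subgroup by (rule subgroup_imp_group)
  show "finite (carrier GP)" using finite_subset[OF P_carrier fin] by simp
  show "\<sigma> \<in> carrier GP \<Longrightarrow> \<sigma> \<noteq> \<one>\<^bsub>GP\<^esub> \<Longrightarrow> int (depth \<sigma>) = F (generate GP {\<sigma>})"
    using P_carrier generate_restrict[OF P_subgroup] F_generate by auto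
  show "g \<in> carrier GP \<Longrightarrow> cyclic_subgroup \<Gamma> GP \<Longrightarrow> F (conj_set GP g \<Gamma>) = F \<Gamma>"
    using P_carrier conj_set_restrict[OF P_subgroup] F_conj_set cyclic_carrier
    by (auto simp: cyclic_subgroup_restrict_iff[OF P_subgroup])
qed

text \<open>Through this identity the inequality in (c) becomes the non-negativity of the Moebius
  sum for \<open>G\<close>.\<close>

lemma artin_coeff_P:
  assumes T: "cyclic_subgroup T G" "T \<subseteq> P" "T \<noteq> {\<one>}"
  shows "of_nat (subgroup_index G (normalizer_in G P T) T) * artin_coeff GP \<phi> T = of_int (moebius_sum GP F T)"
proof -
  interpret GP: group GP by (rule GP_facts)
  have cyc: "cyclic_subgroup T GP" using T by (simp add: cyclic_subgroup_restrict_iff[OF P_subgroup])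
  show ?thesis
    using GP.artin_coeff_eq[OF GP_facts(2), of \<phi> F T] GP_facts(3,4) cyc T(3)
      GP.normalizer_index_card(2)[OF GP_facts(2) GP.cyclic_subgroup_imp_subgroup[OF cyc]]
    by (simp add: normalizer_restrict[OF P_subgroup T(2)])
qed

lemma bertin_P_iff:
  "bertin_obstruction_vanishes GP \<phi> \<longleftrightarrow>
    (\<forall>T. cyclic_subgroup T G \<and> T \<subseteq> P \<and> T \<noteq> {\<one>} \<longrightarrow> 0 \<le> moebius_sum GP F T \<and>
      int (subgroup_index G (normalizer_in G P T) T) dvd moebius_sum GP F T)" (is "_ \<longleftrightarrow> ?R")
proof -
  interpret GP: group GP by (rule GP_facts)
  have norm: "normalizer GP T = normalizer_in G P T" if "T \<subseteq> P" for T
    using that by (rule normalizer_restrict[OF P_subgroup])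
  show ?thesis
  proof
    assume b: "bertin_obstruction_vanishes GP \<phi>"
    show ?R
    proof (intro allI impI)
      fix T assume T: "cyclic_subgroup T G \<and> T \<subseteq> P \<and> T \<noteq> {\<one>}"
      then have "cyclic_subgroup T GP" "T \<noteq> {\<one>\<^bsub>GP\<^esub>}" by (simp_all add: cyclic_subgroup_restrict_iff[OF P_subgroup])
      from GP.bertin_obstruction_vanishesD[OF GP_facts(2) b GP_facts(3) this]
      show "0 \<le> moebius_sum GP F T \<and> int (subgroup_index G (normalizer_in G P T) T) dvd moebius_sum GP F T"
        using T norm by simp
    qed
  next
    assume R: ?R
    show "bertin_obstruction_vanishes GP \<phi>"
    proof (rule GP.bertin_obstruction_vanishesI[OF GP_facts(2), of \<phi> F])
      fix T assume "cyclic_subgroup T GP" "T \<noteq> {\<one>\<^bsub>GP\<^esub>}"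
      then have T: "cyclic_subgroup T G \<and> T \<subseteq> P \<and> T \<noteq> {\<one>}" by (simp add: cyclic_subgroup_restrict_iff[OF P_subgroup])
      then show "0 \<le> moebius_sum GP F T" "int (subgroup_index GP (normalizer GP T) T) dvd moebius_sum GP F T"
        using R norm by simp_all
    qed (use GP_facts(3,4) in auto)
  qed
qed

lemma bertin_G_iff:
  "bertin_obstruction_vanishes G \<phi> \<longleftrightarrow>
    (\<forall>T. cyclic_subgroup T G \<and> T \<noteq> {\<one>} \<longrightarrow> 0 \<le> moebius_sum G F T \<and>
      int (subgroup_index G (normalizer G T) T) dvd moebius_sum G F T)"
proof
  assume "bertin_obstruction_vanishes G \<phi>"
  from bertin_obstruction_vanishesD[OF fin this F_generate]
  show "\<forall>T. cyclic_subgroup T G \<and> T \<noteq> {\<one>} \<longrightarrow> 0 \<le> moebius_sum G F T \<and>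
      int (subgroup_index G (normalizer G T) T) dvd moebius_sum G F T" by simp
next
  assume "\<forall>T. cyclic_subgroup T G \<and> T \<noteq> {\<one>} \<longrightarrow> 0 \<le> moebius_sum G F T \<and>
      int (subgroup_index G (normalizer G T) T) dvd moebius_sum G F T"
  then show "bertin_obstruction_vanishes G \<phi>"
    using F_generate F_conj_set[OF _ cyclic_carrier]
    by (intro bertin_obstruction_vanishesI[OF fin, of \<phi> F]) simp_all
qed

text \<open>On the set realizing the criterion for \<open>G\<close>, the stabilizers in
  \<open>P\<close> are still cyclic but may become trivial. Hence the set itself is not reused; it
  serves to count points with stabilizer \<open>T\<close> for non-trivial \<open>T\<close>, and the
  numerical criterion for \<open>P\<close> concludes.\<close>

lemma bertin_G_imp_P:
  assumes "bertin_obstruction_vanishes G \<phi>"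
  shows "bertin_obstruction_vanishes GP \<phi>"
proof -
  interpret GP: group GP by (rule GP_facts)
  obtain S :: "nat set" and act where S: "finite S" "group_action G S act"
    "\<And>s. s \<in> S \<Longrightarrow> cyclic_subgroup (stabilizer G act s) G"
    "\<And>\<sigma>. \<sigma> \<in> carrier G \<Longrightarrow> \<sigma> \<noteq> \<one> \<Longrightarrow> card {s \<in> S. generate G {\<sigma>} \<subseteq> stabilizer G act s} = depth \<sigma>"
    using assms by (rule bertin_obstruction_vanishesE) (rule that)
  interpret A: group_action G S act by fact
  let ?act = "\<lambda>g. restrict (act g) S"
  interpret B: group_action GP S ?act
  proof (rule GP.group_action_restrict)
    fix g s assume "g \<in> carrier GP" "s \<in> S"
    then show "act g s \<in> S" using A.element_image P_carrier by auto
  next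
    fix s assume "s \<in> S" then show "act \<one>\<^bsub>GP\<^esub> s = s" by (simp flip: A.id_eq_one)
  next
    fix g h s assume "g \<in> carrier GP" "h \<in> carrier GP" "s \<in> S"
    then show "act (g \<otimes>\<^bsub>GP\<^esub> h) s = act g (act h s)" using P_carrier A.composition_rule[of s g h] by auto
  qed
  have st: "stabilizer GP ?act s = stabilizer G act s \<inter> P" if "s \<in> S" for s
    using that P_carrier by (auto simp: stabilizer_def)
  have cyc: "cyclic_subgroup (stabilizer GP ?act s) GP" if s: "s \<in> S" for s
    unfolding st[OF s] cyclic_subgroup_restrict_iff[OF P_subgroup]
    using subgroup_of_cyclic[OF fin S(3)[OF s]] subgroups_Inter_pair[OF A.stabilizer_subgroup[OF s] P_subgroup] by simp
  show ?thesis
    unfolding bertin_P_iff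
  proof (intro allI impI)
    fix T assume T: "cyclic_subgroup T G \<and> T \<subseteq> P \<and> T \<noteq> {\<one>}"
    then have T': "cyclic_subgroup T GP" by (simp add: cyclic_subgroup_restrict_iff[OF P_subgroup])
    have "moebius_sum GP F T = int (card {s \<in> S. stabilizer GP ?act s = T})"
    proof (rule B.moebius_sum_fixed_points[OF GP_facts(2) S(1) cyc T'])
      fix \<Gamma> assume \<Gamma>: "\<Gamma> \<in> cyclic_over GP T"
      then have \<Gamma>': "cyclic_subgroup \<Gamma> G" "T \<subseteq> \<Gamma>" "\<Gamma> \<subseteq> P" unfolding cyclic_over_restrict[OF P_subgroup] by (auto simp: cyclic_over_def)
      then have "\<Gamma> \<noteq> {\<one>}"
        using T subgroup.one_closed[of T G] cyclic_subgroup_imp_subgroup[of T] by blast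
      then obtain \<sigma> where \<sigma>: "\<sigma> \<in> carrier G" "\<sigma> \<noteq> \<one>" "\<Gamma> = generate G {\<sigma>}"
        using \<Gamma>'(1) cyclic_generator by metis
      have "{s \<in> S. \<Gamma> \<subseteq> stabilizer GP ?act s} = {s \<in> S. \<Gamma> \<subseteq> stabilizer G act s}"
        using st \<Gamma>'(3) by auto
      then show "F \<Gamma> = int (card {s \<in> S. \<Gamma> \<subseteq> stabilizer GP ?act s})"
        using S(4)[OF \<sigma>(1,2)] \<sigma> by (simp add: lower_depth_generate)
    qed
    moreover have "subgroup_index GP (normalizer GP T) T dvd card {s \<in> S. stabilizer GP ?act s = T}"
      by (rule B.index_dvd_card_stabilizer_eq[OF GP_facts(2) S(1) GP.cyclic_subgroup_imp_subgroup[OF T']])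
    ultimately show "0 \<le> moebius_sum GP F T \<and> int (subgroup_index G (normalizer_in G P T) T) dvd moebius_sum GP F T"
      using T by (simp add: normalizer_restrict[OF P_subgroup])
  qed
qed

subsection \<open>Congruences from the action of C\<close>

lemma conj_generator:
  assumes "\<sigma> \<in> carrier G" "x \<in> carrier G" "conj_set G x (generate G {\<sigma>}) = generate G {\<sigma>}"
  obtains r :: int where "x \<otimes> \<sigma> \<otimes> inv x = \<sigma> [^] r"
proof -
  have "x \<otimes> \<sigma> \<otimes> inv x \<in> conj_set G x (generate G {\<sigma>})"
    unfolding conj_set_def by (intro imageI generate.incl) simp
  then have "x \<otimes> \<sigma> \<otimes> inv x \<in> generate G {\<sigma>}" unfolding assms(3) .
  then show thesis using that unfolding generate_pow[OF assms(1)] by blast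
qed

lemma theta_0_power_lower_depth:
  assumes \<sigma>: "\<sigma> \<in> P" "\<sigma> \<noteq> \<one>" and x: "x \<in> carrier G" "x \<otimes> \<sigma> \<otimes> inv x = \<sigma> [^] (r::int)"
  shows "theta_0 x ^ (lower_depth (generate G {\<sigma>}) - 1) = of_int r"
  using theta_0_power_depth[OF _ \<sigma>(2) x] \<sigma> P_carrier by (simp add: P_eq[symmetric] lower_depth_generate subset_iff)

lemma theta_0_power_eq_iff:
  assumes "x \<in> C"
  shows "theta_0 x ^ a = theta_0 x ^ b \<longleftrightarrow> int (ord x) dvd int a - int b"
proof -
  have xc: "x \<in> carrier G" using assms C_carrier by auto
  have "x [^] n \<in> C" for n :: nat
    using subgroup_int_pow_closed[OF C_subgroup assms, of "int n"] by (simp add: int_pow_int)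
  then have "theta_0 x ^ a = theta_0 x ^ b \<longleftrightarrow> x [^] a = x [^] b"
    using theta_0_inj_on_C by (simp add: inj_on_def flip: theta_0_pow[OF xc]) metis
  also have "\<dots> \<longleftrightarrow> int (ord x) dvd int a - int b"
    using int_pow_eq[OF xc, of "int a" "int b"] by (simp add: int_pow_int dvd_diff_commute)
  finally show ?thesis .
qed

lemma subgroup_C_generator:
  assumes "subgroup D G" "D \<subseteq> C"
  obtains x where "x \<in> D" "ord x = card D"
proof -
  have "cyclic_subgroup D G" by (rule subgroup_of_cyclic[OF fin C_cyclic assms])
  then obtain x where x: "x \<in> carrier G" "D = generate G {x}" using cyclic_subgroup_iff by blast
  then show thesis using that[of x] generate_pow_card[OF x(1)] by (simp add: generate.incl)
qed

text \<open>A generator \<open>x\<close> of \<open>D\<close> raises a generator of \<Gamma> to some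
  power \<open>r\<close>, and elements of \<open>T\<close> to the same power. So
  \<open>theta_0 x\<close> to the exponent \<open>F \<Gamma> - 1\<close> and to the exponent
  \<open>F T - 1\<close> both equal \<open>r\<close>, while \<open>theta_0 x\<close> has order
  \<open>card D\<close>.\<close>

lemma depth_cong_over:
  assumes T: "cyclic_subgroup T G" "T \<noteq> {\<one>}" and \<Gamma>: "cyclic_subgroup \<Gamma> G" "T \<subseteq> \<Gamma>" "\<Gamma> \<subseteq> P"
    and D: "subgroup D G" "D \<subseteq> C" "\<And>x. x \<in> D \<Longrightarrow> conj_set G x \<Gamma> = \<Gamma>" "\<And>x. x \<in> D \<Longrightarrow> conj_set G x T = T"
  shows "int (card D) dvd F \<Gamma> - F T"
proof -
  obtain x where x: "x \<in> D" "ord x = card D" using D(1,2) by (rule subgroup_C_generator)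
  have xc: "x \<in> carrier G" "x \<in> C" using x(1) D(2) C_carrier by auto
  obtain \<tau> where \<tau>: "\<tau> \<in> carrier G" "\<tau> \<noteq> \<one>" "T = generate G {\<tau>}" "\<tau> \<in> T" using T by (rule cyclic_generator)
  have "\<Gamma> \<noteq> {\<one>}" using \<tau> \<Gamma>(2) by auto
  with \<Gamma>(1) obtain \<gamma> where \<gamma>: "\<gamma> \<in> carrier G" "\<gamma> \<noteq> \<one>" "\<Gamma> = generate G {\<gamma>}" "\<gamma> \<in> \<Gamma>" by (rule cyclic_generator)
  obtain r :: int where r: "x \<otimes> \<gamma> \<otimes> inv x = \<gamma> [^] r"
    using D(3)[OF x(1)] \<gamma> xc by (metis conj_generator)
  obtain m :: int where m: "\<tau> = \<gamma> [^] m" using \<tau>(4) \<Gamma>(2) unfolding \<gamma>(3) generate_pow[OF \<gamma>(1)] by auto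
  have "x \<otimes> \<tau> \<otimes> inv x = (x \<otimes> \<gamma> \<otimes> inv x) [^] m"
    using group_hom.hom_int_pow[OF conj_hom[OF xc(1)] \<gamma>(1), of m] by (simp add: m)
  also have "\<dots> = \<tau> [^] r" unfolding r m using \<gamma>(1) by (simp add: int_pow_pow mult.commute)
  finally have "theta_0 x ^ (lower_depth T - 1) = of_int r"
    using theta_0_power_lower_depth[of \<tau> x r] \<tau> \<Gamma> xc by auto
  moreover have "theta_0 x ^ (lower_depth \<Gamma> - 1) = of_int r"
    using theta_0_power_lower_depth[of \<gamma> x r] \<gamma> \<Gamma> xc r by auto
  ultimately have "int (ord x) dvd int (lower_depth \<Gamma> - 1) - int (lower_depth T - 1)"
    using theta_0_power_eq_iff[OF xc(2), of "lower_depth \<Gamma> - 1" "lower_depth T - 1"] by simp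
  moreover have "lower_depth T \<ge> 2" "lower_depth \<Gamma> \<ge> 2"
    using F_in_P[OF T(1) _ T(2)] F_in_P[OF \<Gamma>(1,3) \<open>\<Gamma> \<noteq> {\<one>}\<close>] \<Gamma> by auto
  ultimately show ?thesis using x(2) by simp
qed

text \<open>Modulo \<open>#N_C(T)\<close> all depths in the sum may be replaced by that of
  \<open>T\<close>. \<open>N_C(T)\<close> permutes the groups \<Gamma>; on each orbit the stabilizer
  order divides the change of depth, and the orbit length supplies the complementary factor.\<close>

lemma moebius_sum_P_cong:
  assumes T: "cyclic_subgroup T G" "T \<subseteq> P" "T \<noteq> {\<one>}"
  shows "int (card (normalizer_in G C T)) dvd
    moebius_sum GP F T - F T * (\<Sum>\<Gamma>\<in>cyclic_over GP T. moebius (subgroup_index G \<Gamma> T))"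
proof -
  let ?D = "normalizer_in G C T" and ?E = "cyclic_over GP T"
  let ?GD = "G\<lparr>carrier := ?D\<rparr>" and ?act = "\<lambda>x. restrict (conj_set G x) (cyclic_over GP T)"
  have Tc: "T \<subseteq> carrier G" and Ts: "subgroup T G" using T cyclic_carrier cyclic_subgroup_imp_subgroup by auto
  have D: "subgroup ?D G" by (rule subgroup_normalizer_in[OF Tc C_subgroup])
  have D_mem: "x \<in> ?D \<longleftrightarrow> x \<in> C \<and> conj_set G x T = T" for x
    using normalizer_in_eq[OF Tc C_carrier] by auto
  have Dc: "x \<in> carrier G" if "x \<in> ?D" for x using that D_mem C_carrier by auto
  interpret D: group ?GD using D by (rule subgroup_imp_group)
  have E: "?E = {\<Gamma>. cyclic_subgroup \<Gamma> G \<and> T \<subseteq> \<Gamma> \<and> \<Gamma> \<subseteq> P}"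
    unfolding cyclic_over_restrict[OF P_subgroup] by (auto simp: cyclic_over_def)
  have finE: "finite ?E" using group.finite_cyclic_over[OF GP_facts(1,2)] .
  have conj_P: "conj_set G x \<Gamma> \<subseteq> P" if "x \<in> carrier G" "\<Gamma> \<subseteq> P" for x \<Gamma>
    using that normal.inv_op_closed2[OF P_normal] by (auto simp: conj_set_def)
  interpret A: group_action ?GD ?E ?act
  proof (rule D.group_action_restrict)
    fix x \<Gamma> assume "x \<in> carrier ?GD" "\<Gamma> \<in> ?E"
    then show "conj_set G x \<Gamma> \<in> ?E"
      using D_mem Dc cyclic_conj_set conj_P conj_set_mono[of T \<Gamma> x] unfolding E by auto
  next
    fix \<Gamma> assume "\<Gamma> \<in> ?E"
    then show "conj_set G \<one>\<^bsub>?GD\<^esub> \<Gamma> = \<Gamma>" using cyclic_carrier conj_set_one unfolding E by auto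
  next
    fix x y \<Gamma> assume "x \<in> carrier ?GD" "y \<in> carrier ?GD" "\<Gamma> \<in> ?E"
    then show "conj_set G (x \<otimes>\<^bsub>?GD\<^esub> y) \<Gamma> = conj_set G x (conj_set G y \<Gamma>)"
      using Dc cyclic_carrier conj_set_mult unfolding E by auto
  qed
  let ?f = "\<lambda>\<Gamma>. moebius (subgroup_index G \<Gamma> T) * (F \<Gamma> - F T)"
  have "int (card ?D) dvd sum ?f ?E"
  proof (rule A.dvd_sum_if_dvd_orbit_sums[OF finE])
    fix x \<Gamma> assume x: "x \<in> carrier ?GD" and "\<Gamma> \<in> ?E"
    then have \<Gamma>: "cyclic_subgroup \<Gamma> G" "T \<subseteq> \<Gamma>" unfolding E by auto
    have "subgroup_index G (conj_set G x \<Gamma>) (conj_set G x T) = subgroup_index G \<Gamma> T"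
      by (rule subgroup_index_conj_set[OF fin Dc Ts cyclic_subgroup_imp_subgroup[OF \<Gamma>(1)] \<Gamma>(2)]) (use x in simp)
    then show "?f (?act x \<Gamma>) = ?f \<Gamma>"
      using \<open>\<Gamma> \<in> ?E\<close> x D_mem F_conj_set[OF Dc cyclic_carrier[OF \<Gamma>(1)]] by simp
  next
    fix \<Gamma> assume \<Gamma>E: "\<Gamma> \<in> ?E"
    then have \<Gamma>: "cyclic_subgroup \<Gamma> G" "T \<subseteq> \<Gamma>" "\<Gamma> \<subseteq> P" unfolding E by auto
    let ?St = "stabilizer ?GD ?act \<Gamma>"
    have St: "?St = {x \<in> ?D. conj_set G x \<Gamma> = \<Gamma>}" using \<Gamma>E by (auto simp: stabilizer_def)
    have "subgroup ?St G" using incl_subgroup[OF D A.stabilizer_subgroup[OF \<Gamma>E]] .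
    then have "int (card ?St) dvd F \<Gamma> - F T"
      by (rule depth_cong_over[OF T(1,3) \<Gamma>]) (auto simp: St D_mem)
    then have "int (card ?St) dvd ?f \<Gamma>" by (rule dvd_mult)
    then have "int (card (orbit ?GD ?act \<Gamma>)) * int (card ?St) dvd int (card (orbit ?GD ?act \<Gamma>)) * ?f \<Gamma>"
      by (rule mult_dvd_mono[OF dvd_refl])
    moreover have "card (orbit ?GD ?act \<Gamma>) * card ?St = card ?D"
      using A.orbit_stabilizer_theorem[OF \<Gamma>E] by (simp add: Coset.order_def)
    then have "int (card (orbit ?GD ?act \<Gamma>)) * int (card ?St) = int (card ?D)"
      by (simp only: flip: of_nat_mult)
    ultimately show "int (card ?D) dvd int (card (orbit ?GD ?act \<Gamma>)) * ?f \<Gamma>" by simp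
  qed
  moreover have "sum ?f ?E = moebius_sum GP F T - F T * (\<Sum>\<Gamma>\<in>?E. moebius (subgroup_index G \<Gamma> T))"
    by (simp add: moebius_sum_def right_diff_distrib sum_subtractf sum_distrib_left mult.commute)
  ultimately show ?thesis by simp
qed

text \<open>The order of \<open>N_C(T)\<close> divides that of \<open>N_G(T)\<close> and is prime to
  the order of \<open>T\<close>, a power of \<open>p\<close>.\<close>

lemma card_normalizer_in_C_dvd_index:
  assumes T: "cyclic_subgroup T G" "T \<subseteq> P"
  shows "card (normalizer_in G C T) dvd subgroup_index G (normalizer G T) T"
proof -
  have Ts: "subgroup T G" and Tc: "T \<subseteq> carrier G" using T cyclic_subgroup_imp_subgroup cyclic_carrier by auto
  have D: "subgroup (normalizer_in G C T) G" by (rule subgroup_normalizer_in[OF Tc C_subgroup])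
  have "card (normalizer_in G C T) dvd card (normalizer G T)"
    by (rule subgroup_card_dvd[OF D normalizer_imp_subgroup[OF Tc]]) (auto simp: normalizer_in_def)
  then have "card (normalizer_in G C T) dvd subgroup_index G (normalizer G T) T * card T"
    unfolding normalizer_index_card(1)[OF fin Ts] .
  moreover have "coprime (card (normalizer_in G C T)) (card T)"
  proof -
    have "card (normalizer_in G C T) dvd card C"
      by (rule subgroup_card_dvd[OF D C_subgroup]) (auto simp: normalizer_in_def)
    moreover have "card T dvd p ^ s" using subgroup_card_dvd[OF Ts P_subgroup T(2)] by (simp add: card_P)
    moreover have "coprime (card C) (p ^ s)" using card_C by simp
    ultimately show ?thesis by (meson coprime_divisors)
  qed
  ultimately show ?thesis by (simp add: coprime_dvd_mult_left_iff)
qed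

text \<open>A fixed point of a subgroup of prime power order on the cosets of \<open>C\<close> replaces the
  conjugacy part of the Schur-Zassenhaus theorem.\<close>

lemma conj_into_C:
  assumes Q: "subgroup Q G" "card Q = q ^ n" and q: "Factorial_Ring.prime q" "q \<noteq> p"
  obtains g where "g \<in> carrier G" "conj_set G g Q \<subseteq> C"
proof -
  let ?E = "(\<lambda>g. g <# C) ` carrier G" and ?GQ = "G\<lparr>carrier := Q\<rparr>"
  have Qc: "Q \<subseteq> carrier G" using Q(1) by (rule subgroup.subset)
  \<comment> \<open>\<open>P\<close> is a set of representatives for the left cosets of
    \<open>C\<close>, so their number is a power of \<open>p\<close> and hence prime to
    \<open>q\<close>.\<close>
  have E: "?E = (\<lambda>x. x <# C) ` P"
  proof (intro equalityI subsetI)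
    fix A assume "A \<in> ?E"
    then obtain g where g: "g \<in> carrier G" "A = g <# C" by auto
    then have "g \<in> P <#> C" using PC by simp
    then obtain x c where xc: "x \<in> P" "c \<in> C" "g = x \<otimes> c" by (auto simp: set_mult_def)
    have "g <# C = x <# C"
      using xc P_carrier C_carrier by (subst l_coset_eq_iff[OF C_subgroup]) (auto simp: inv_mult_cancel subset_iff)
    then show "A \<in> (\<lambda>x. x <# C) ` P" using g xc by auto
  qed (use P_carrier in auto)
  have "inj_on (\<lambda>x. x <# C) P"
  proof (rule inj_onI)
    fix x y assume xy: "x \<in> P" "y \<in> P" "x <# C = y <# C"
    have c: "x \<in> carrier G" "y \<in> carrier G" using xy P_carrier by auto
    have "inv y \<otimes> x \<in> C" using xy(3) l_coset_eq_iff[OF C_subgroup c] by simp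
    moreover have "inv y \<otimes> x \<in> P" using xy P_subgroup by (simp add: subgroup.m_closed subgroup.m_inv_closed)
    ultimately have "inv y \<otimes> x = \<one>" using P_Int_C by auto
    then show "x = y" using c by (metis inv_mult_cancel(2) r_one)
  qed
  then have "card ?E = p ^ s" unfolding E by (simp add: card_image card_P)
  then have nd: "\<not> q dvd card ?E"
    using q prime_p by (metis prime_dvd_power primes_dvd_imp_eq)
  interpret Q: group ?GQ using Q(1) by (rule subgroup_imp_group)
  interpret A: group_action ?GQ ?E "\<lambda>h. restrict (\<lambda>A. h <# A) ?E"
  proof (rule Q.group_action_restrict)
    fix h A assume "h \<in> carrier ?GQ" "A \<in> ?E"
    then show "h <# A \<in> ?E" using Qc C_carrier by (auto simp: lcos_m_assoc subset_iff)
  next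
    fix A assume "A \<in> ?E"
    then show "\<one>\<^bsub>?GQ\<^esub> <# A = A" using C_carrier by (auto simp: lcos_m_assoc)
  next
    fix g h A assume "g \<in> carrier ?GQ" "h \<in> carrier ?GQ" "A \<in> ?E"
    then show "(g \<otimes>\<^bsub>?GQ\<^esub> h) <# A = g <# (h <# A)" using Qc C_carrier by (auto simp: lcos_m_assoc m_assoc subset_iff)
  qed
  have "finite (carrier ?GQ)" using finite_subset[OF Qc fin] by simp
  then obtain A where A: "A \<in> ?E" "stabilizer ?GQ (\<lambda>h. restrict (\<lambda>A. h <# A) ?E) A = carrier ?GQ"
    using A.p_group_fixed_point[of q n] fin q(1) Q(2) nd by (auto simp: Coset.order_def)
  then obtain g where g: "g \<in> carrier G" "A = g <# C" by auto
  \<comment> \<open>That every element of \<open>Q\<close> fixes the coset of \<open>g\<close> means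
    that conjugation by the inverse of \<open>g\<close> carries \<open>Q\<close> into
    \<open>C\<close>.\<close>
  have "inv g \<otimes> h \<otimes> g \<in> C" if h: "h \<in> Q" for h
  proof -
    have hc: "h \<in> carrier G" using h Qc by auto
    have "h \<in> stabilizer ?GQ (\<lambda>h. restrict (\<lambda>A. h <# A) ?E) A" using A(2) h by simp
    then have "h <# (g <# C) = g <# C" using A(1) g(2) by (simp add: stabilizer_def)
    then show ?thesis
      using l_coset_eq_iff[OF C_subgroup, of "h \<otimes> g" g] hc g(1) C_carrier by (simp add: lcos_m_assoc m_assoc)
  qed
  then have "conj_set G (inv g) Q \<subseteq> C" using g(1) by (auto simp: conj_set_def)
  then show thesis using that[of "inv g"] g(1) by simp
qed

lemma p_power_in_P:
  assumes "x \<in> carrier G" "x [^] (p ^ j) = \<one>"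
  shows "x \<in> P"
proof -
  have "theta_0 x ^ p ^ j = 1" using theta_0_pow[OF assms(1), of "p ^ j"] assms(2) by simp
  then have "theta_0 x = 1" using power_CHAR_power_eq_1[of "theta_0 x" j] prime_p by (simp add: char_p)
  then show ?thesis using theta_0_eq_1_iff[OF assms(1)] P_eq by simp
qed

end

section \<open>The conditions on characters in (d)\<close>

context tame_extension
begin

lemma power_p_power_of_int: "(of_int a :: 'k) ^ p ^ e = of_int a"
proof -
  have "[a ^ p ^ e = a] (mod int p)"
  proof (induction e)
    case (Suc e)
    have "[(a ^ p ^ e) ^ p = a ^ p] (mod int p)" using Suc by (rule cong_pow)
    also have "[a ^ p = a] (mod int p)" by (rule fermat_int[OF prime_p])
    finally show ?case by (simp add: mult.commute flip: power_mult)
  qed simp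
  then have "(of_int (a ^ p ^ e) :: 'k) = of_int a" by (simp only: of_int_eq_iff_cong_CHAR char_p)
  then show ?thesis by simp
qed

text \<open>Writing \<open>\<chi>\<close> for the character through which an element of \<open>C\<close> acts on \<open>T\<close>, the theory of
  ramification gives \<open>\<chi> = \<theta>\<^sub>0 ^ (i - 1)\<close> modulo \<open>p\<close> with \<open>i\<close> the depth of \<open>T\<close>, so that
  \<open>\<chi> = \<theta>\<^sub>0\<inverse>\<close> amounts to \<open>\<theta>\<^sub>0 ^ i = 1\<close>; and \<open>\<theta>\<close> is a Frobenius twist of \<open>\<theta>\<^sub>0\<close>.\<close>

lemma theta_conditions_iff:
  assumes T: "cyclic_subgroup T G" "T \<subseteq> P" "T \<noteq> {\<one>}"
  defines "D \<equiv> normalizer_in G C T"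
  shows "inj_on (theta_char \<phi> P) D \<and> theta_char \<phi> P ` D \<subseteq> of_nat ` {1..<p} \<and>
      (\<forall>x\<in>D. teichmueller_lift G p D (theta_char \<phi> P) x = inv\<^bsub>padic_units p\<^esub> (chi_char G p C T x))
    \<longleftrightarrow> card D dvd lower_depth T"
proof -
  have ppos: "p > 0" and p1: "p > 1" using prime_gt_0_nat[OF prime_p] prime_gt_1_nat[OF prime_p] by simp_all
  interpret U: comm_group "padic_units p" by (rule padic_units_comm_group[OF ppos])
  have Tc: "T \<subseteq> carrier G" and Ts: "subgroup T G" using T cyclic_carrier cyclic_subgroup_imp_subgroup by auto
  have D: "subgroup D G" unfolding D_def by (rule subgroup_normalizer_in[OF Tc C_subgroup])
  have D_mem: "x \<in> D \<longleftrightarrow> x \<in> C \<and> conj_set G x T = T" for x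
    unfolding D_def using normalizer_in_eq[OF Tc C_carrier] by auto
  have DC: "D \<subseteq> C" using D_mem by auto
  have Dc: "x \<in> carrier G" if "x \<in> D" for x using that DC C_carrier by auto
  have finD: "finite D" using finite_subgroupD(1)[OF fin D] .
  have copD: "coprime (card D) p"
    using subgroup_card_dvd[OF D C_subgroup DC] card_C by (meson coprime_divisors dvd_refl)
  obtain \<sigma> where \<sigma>: "\<sigma> \<in> carrier G" "\<sigma> \<noteq> \<one>" "T = generate G {\<sigma>}" "\<sigma> \<in> T"
    using T(1,3) by (rule cyclic_generator)
  have "card T dvd p ^ s" using subgroup_card_dvd[OF Ts P_subgroup T(2)] by (simp add: card_P)
  then obtain j where j: "card T = p ^ j" using divides_primepow_nat[OF prime_p] by blast
  then have ord: "ord \<sigma> = p ^ j" using generate_pow_card[OF \<sigma>(1)] \<sigma>(3) by simp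
  have j0: "j > 0"
  proof (rule ccontr)
    assume "\<not> j > 0"
    then have "ord \<sigma> = 1" using ord by simp
    then show False using ord_eq_1[OF \<sigma>(1)] \<sigma>(2) by simp
  qed
  have "\<exists>r::int. x \<otimes> \<sigma> \<otimes> inv x = \<sigma> [^] r" if "x \<in> D" for x
    using conj_generator[OF \<sigma>(1) Dc[OF that]] that D_mem \<sigma>(3) by metis
  then obtain r :: "'g \<Rightarrow> int" where r: "\<And>x. x \<in> D \<Longrightarrow> x \<otimes> \<sigma> \<otimes> inv x = \<sigma> [^] r x" by metis
  have T_mem: "y \<in> T \<longleftrightarrow> (\<exists>i::int. y = \<sigma> [^] i)" for y
    unfolding \<sigma>(3) generate_pow[OF \<sigma>(1)] by auto
  note chi_rule = chi_char_eq[OF is_group prime_p D[unfolded D_def] finD[unfolded D_def] copD[unfolded D_def]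
      \<sigma>(1) ord j0, folded D_def]
  have chi_eq: "chi_char G p C T = (\<lambda>x\<in>D. teichmueller_padic p (r x))"
    by (rule chi_rule(1)) (rule T_mem, rule r)
  have cop_r: "coprime (r x) (int p)" if "x \<in> D" for x
    by (rule chi_rule(2)[OF T_mem _ that]) (rule r)
  have cong_iff: "(of_int a :: 'k) = of_int b \<longleftrightarrow> [a = b] (mod int p)" for a b
    by (simp add: of_int_eq_iff_cong_CHAR char_p)
  have i2: "lower_depth T \<ge> 2" by (rule F_in_P[OF T])
  have r_theta: "of_int (r x) * theta_0 x = theta_0 x ^ lower_depth T" if "x \<in> D" for x
  proof -
    have "theta_0 x ^ (lower_depth T - 1) = of_int (r x)"
      unfolding \<sigma>(3) by (rule theta_0_power_lower_depth) (use \<sigma> T r Dc that in auto)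
    then show ?thesis using i2 by (metis Suc_diff_1 less_le_trans pos2 power_Suc2)
  qed
  obtain e where e: "ramification_index = p ^ e" using ramification_index_eq by blast
  have theta: "theta_char \<phi> P x = theta_0 x ^ p ^ e" if "x \<in> D" for x
    using theta_char_eq[OF Dc[OF that]] e by simp
  have theta_mult: "theta_char \<phi> P (x \<otimes> y) = theta_char \<phi> P x * theta_char \<phi> P y" if "x \<in> D" "y \<in> D" for x y
    using that D Dc by (simp add: theta subgroup.m_closed theta_0_mult power_mult_distrib)
  \<comment> \<open>As \<open>theta_0\<close> is injective on the cyclic group \<open>D\<close>, its
    power with exponent the depth is trivial on \<open>D\<close> exactly if the order of a generator
    divides the depth.\<close>
  have dvd_iff: "card D dvd lower_depth T \<longleftrightarrow> (\<forall>x\<in>D. theta_0 x ^ lower_depth T = 1)"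
  proof -
    have one: "theta_0 x ^ lower_depth T = 1 \<longleftrightarrow> ord x dvd lower_depth T" if "x \<in> D" for x
      using theta_0_power_eq_iff[of x "lower_depth T" 0] that DC by auto
    obtain x where x: "x \<in> D" "ord x = card D" using D DC by (rule subgroup_C_generator)
    have "ord y dvd card D" if "y \<in> D" for y
      using pow_card_subgroup[OF D that] pow_eq_id[OF Dc[OF that]] by simp
    then show ?thesis using one x by (metis dvd_trans)
  qed
  \<comment> \<open>Products of Teichmueller representatives are again such, so this identity
    between p-adic units can be tested on residues.\<close>
  have inv_iff: "teichmueller_padic p a = inv\<^bsub>padic_units p\<^esub> (teichmueller_padic p b) \<longleftrightarrow> [a * b = 1] (mod int p)"
    if "coprime a (int p)" "coprime b (int p)" for a b
  proof -
    have units: "teichmueller_padic p a \<in> carrier (padic_units p)" "teichmueller_padic p b \<in> carrier (padic_units p)"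
      using teichmueller_padic_Units[OF prime_p] that by (simp_all add: padic_units_simps)
    have "teichmueller_padic p a = inv\<^bsub>padic_units p\<^esub> (teichmueller_padic p b) \<longleftrightarrow>
        teichmueller_padic p (a * b) = teichmueller_padic p 1"
      using U.inv_equality[OF _ units(2,1)] U.l_inv[OF units(2)]
      by (auto simp: teichmueller_padic_mult teichmueller_padic_one simp flip: padic_units_simps)
    also have "\<dots> \<longleftrightarrow> [a * b = 1] (mod int p)"
      using teichmueller_padic_cong[of "a * b" 1] teichmueller_padic_residue[OF prime_p, of "a * b"]
        teichmueller_padic_residue[OF prime_p, of 1] by (metis cong_sym cong_trans)
    finally show ?thesis .
  qed
  show ?thesis
  proof
    assume L: "inj_on (theta_char \<phi> P) D \<and> theta_char \<phi> P ` D \<subseteq> of_nat ` {1..<p} \<and>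
      (\<forall>x\<in>D. teichmueller_lift G p D (theta_char \<phi> P) x = inv\<^bsub>padic_units p\<^esub> (chi_char G p C T x))"
    have "\<exists>n\<in>{1..<p}. theta_char \<phi> P x = of_nat n" if "x \<in> D" for x using L that by blast
    then obtain n where n: "\<And>x. x \<in> D \<Longrightarrow> n x \<in> {1..<p}" "\<And>x. x \<in> D \<Longrightarrow> theta_char \<phi> P x = of_nat (n x)"
      by metis
    define a where "a x = int (n x)" for x
    have a: "theta_char \<phi> P x = of_int (a x)" if "x \<in> D" for x using n(2)[OF that] by (simp add: a_def)
    have cop: "coprime (a x) (int p)" if "x \<in> D" for x
    proof -
      have "\<not> p dvd n x" using n(1)[OF that] by (auto dest: dvd_imp_le)
      then have "coprime (n x) p" using prime_p by (metis coprime_commute prime_imp_coprime)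
      then show ?thesis by (simp add: a_def)
    qed
    have hom: "[a (x \<otimes> y) = a x * a y] (mod int p)" if "x \<in> D" "y \<in> D" for x y
      using theta_mult[OF that] a[OF that(1)] a[OF that(2)] a[OF subgroup.m_closed[OF D that]]
      by (simp flip: cong_iff)
    have lift: "teichmueller_lift G p D (theta_char \<phi> P) = (\<lambda>x\<in>D. teichmueller_padic p (a x))"
      by (rule teichmueller_lift_eq[OF is_group prime_p D finD copD char_p cop hom a])
    show "card D dvd lower_depth T"
      unfolding dvd_iff
    proof
      fix x assume x: "x \<in> D"
      have "[a x * r x = 1] (mod int p)"
        using L x inv_iff[OF cop[OF x] cop_r[OF x]] by (simp add: lift chi_eq)
      then have "(of_int (a x * r x) :: 'k) = of_int 1" by (simp only: cong_iff)
      then have 1: "theta_0 x ^ p ^ e * of_int (r x) = 1" using a[OF x] theta[OF x] by simp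
      \<comment> \<open>The hypothesis involves the Frobenius twist of \<open>theta_0\<close>. Since
        \<open>of_int (r x)\<close> is fixed by Frobenius, it gives that
        \<open>of_int (r x) * theta_0 x\<close> is a \<open>p\<close>-power root of unity, hence
        1.\<close>
      have "(theta_0 x ^ lower_depth T) ^ p ^ e = (of_int (r x) * theta_0 x) ^ p ^ e" by (simp add: r_theta[OF x])
      also have "\<dots> = 1" using 1 by (simp add: power_mult_distrib power_p_power_of_int mult.commute)
      finally show "theta_0 x ^ lower_depth T = 1"
        using power_CHAR_power_eq_1[of "theta_0 x ^ lower_depth T" e] prime_p char_p by simp
    qed
  next
    assume "card D dvd lower_depth T"
    then have one: "of_int (r x) * theta_0 x = 1" if "x \<in> D" for x
      using r_theta[OF that] that unfolding dvd_iff by simp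
    \<comment> \<open>An inverse of \<open>r x\<close> modulo \<open>p\<close> represents
      \<open>theta_0 x\<close>. So \<open>theta_0\<close> takes values in the prime field on
      \<open>D\<close>, where the Frobenius twist leading to \<theta> is invisible.\<close>
    have "\<exists>b. [r x * b = 1] (mod int p)" if "x \<in> D" for x
      using cong_solve_coprime_int[OF cop_r[OF that]] .
    then obtain b where b: "\<And>x. x \<in> D \<Longrightarrow> [r x * b x = 1] (mod int p)" by metis
    have theta_0_b: "theta_0 x = of_int (b x)" if "x \<in> D" for x
    proof -
      have "(of_int (r x * b x) :: 'k) = of_int 1" using b[OF that] by (simp only: cong_iff)
      then have "(of_int (r x) :: 'k) * of_int (b x) = of_int (r x) * theta_0 x" using one[OF that] by simp
      moreover have "(of_int (r x) :: 'k) \<noteq> 0" using one[OF that] by auto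
      ultimately show ?thesis by simp
    qed
    have theta_b: "theta_char \<phi> P x = of_int (b x)" if "x \<in> D" for x
      using theta[OF that] theta_0_b[OF that] by (simp add: power_p_power_of_int)
    have cop: "coprime (b x) (int p)" if "x \<in> D" for x
    proof -
      have "coprime (r x * b x) (int p)" using b[OF that] by (metis cong_imp_coprime cong_sym coprime_1_left)
      then show ?thesis by simp
    qed
    have hom: "[b (x \<otimes> y) = b x * b y] (mod int p)" if "x \<in> D" "y \<in> D" for x y
      using theta_mult[OF that] theta_b[OF that(1)] theta_b[OF that(2)] theta_b[OF subgroup.m_closed[OF D that]]
      by (simp flip: cong_iff)
    have lift: "teichmueller_lift G p D (theta_char \<phi> P) = (\<lambda>x\<in>D. teichmueller_padic p (b x))"
      by (rule teichmueller_lift_eq[OF is_group prime_p D finD copD char_p cop hom theta_b])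
    show "inj_on (theta_char \<phi> P) D \<and> theta_char \<phi> P ` D \<subseteq> of_nat ` {1..<p} \<and>
      (\<forall>x\<in>D. teichmueller_lift G p D (theta_char \<phi> P) x = inv\<^bsub>padic_units p\<^esub> (chi_char G p C T x))"
    proof (intro conjI ballI subsetI)
      have "theta_char \<phi> P x = theta_0 x" if "x \<in> D" for x
        using theta_b[OF that] theta_0_b[OF that] by simp
      moreover have "inj_on theta_0 D" using theta_0_inj_on_C DC by (rule inj_on_subset)
      ultimately show "inj_on (theta_char \<phi> P) D" by (simp add: inj_on_def)
    next
      fix y assume "y \<in> theta_char \<phi> P ` D"
      then obtain x where x: "x \<in> D" "y = of_int (b x)" using theta_b by auto
      define n where "n = nat (b x mod int p)"
      have n: "int n = b x mod int p" using ppos by (simp add: n_def)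
      have "y = of_int (int n)" unfolding x(2) cong_iff n by (simp add: cong_def)
      then have y: "y = of_nat n" by (simp only: of_int_of_nat_eq)
      have "b x mod int p \<noteq> 0"
      proof
        assume "b x mod int p = 0"
        then have "int p dvd b x" by (simp add: dvd_eq_mod_eq_0)
        then have "is_unit (int p)" using cop[OF x(1)] by (simp add: coprime_absorb_right)
        then show False using p1 by simp
      qed
      moreover have "b x mod int p < int p" using ppos by simp
      ultimately have "n \<in> {1..<p}" unfolding n[symmetric] by auto
      with y show "y \<in> of_nat ` {1..<p}" by (rule image_eqI)
    next
      fix x assume x: "x \<in> D"
      show "teichmueller_lift G p D (theta_char \<phi> P) x = inv\<^bsub>padic_units p\<^esub> (chi_char G p C T x)"
        using x inv_iff[OF cop[OF x] cop_r[OF x]] b[OF x] by (simp add: lift chi_eq mult.commute)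
    qed
  qed
qed

subsection \<open>Centralizers of elements of C\<close>

text \<open>The part of (b) that carries the information; \<open>centralizer_direct_product\<close>
  derives the decompositions from it.\<close>

abbreviation cyclic_centralizers :: bool where
  "cyclic_centralizers \<equiv> \<forall>t\<in>C - {\<one>}. cyclic_subgroup (centralizer_in G (carrier G) {t}) G"

lemma C_commute: "x \<in> C \<Longrightarrow> y \<in> C \<Longrightarrow> x \<otimes> y = y \<otimes> x"
  by (rule cyclic_subgroup_comm[OF C_cyclic])

text \<open>Some non-trivial \<open>t\<close> in \<open>C\<close> centralizes \<open>T\<close>, and
  its cyclic centralizer contains both \<open>C\<close> and \<open>T\<close>; so all of
  \<open>C\<close> centralizes \<open>T\<close>. The ramification relation then holds with exponent
  \<open>r = 1\<close> and yields that \<open>card C\<close> divides \<open>F T - 1\<close>.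
  Consequently all depths may be replaced by 1 modulo \<open>card C\<close>, which turns the Moebius
  sum into \<open>b_double_prime\<close>.\<close>

lemma central_case:
  assumes cent: cyclic_centralizers and T: "cyclic_subgroup T G" "T \<subseteq> P" "T \<noteq> {\<one>}"
    and nontriv: "centralizer_in G C T \<noteq> {\<one>}"
  shows "normalizer_in G C T = C" "int (card C) dvd moebius_sum G F T - b_double_prime G T"
proof -
  have Tc: "T \<subseteq> carrier G" using T(1) by (rule cyclic_carrier)
  have "\<one> \<in> centralizer_in G C T"
    by (rule subgroup.one_closed[OF subgroup_centralizer_in[OF C_subgroup Tc]])
  then obtain t where t: "t \<in> C - {\<one>}" "\<And>y. y \<in> T \<Longrightarrow> t \<otimes> y = y \<otimes> t"
    using nontriv by (auto simp: centralizer_in_def)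
  let ?Z = "centralizer_in G (carrier G) {t}"
  have "T \<subseteq> ?Z" "C \<subseteq> ?Z"
    using t Tc C_carrier C_commute by (auto simp: centralizer_in_def)
  then have comm: "c \<otimes> y = y \<otimes> c" if "c \<in> C" "y \<in> T" for c y
    using cyclic_subgroup_comm[of ?Z c y] cent t(1) that by blast
  have fixed: "c \<otimes> y \<otimes> inv c = y" if "c \<in> C" "y \<in> T" for c y
  proof -
    have "c \<in> carrier G" "y \<in> carrier G" using that Tc C_carrier by auto
    then show ?thesis using comm[OF that] by (simp add: m_assoc)
  qed
  have "conj_set G c T = T" if "c \<in> C" for c
    using fixed[OF that] by (simp add: conj_set_def)
  then show N: "normalizer_in G C T = C"
    using normalizer_in_eq[OF Tc C_carrier] by auto
  obtain \<sigma> where \<sigma>: "\<sigma> \<in> carrier G" "\<sigma> \<noteq> \<one>" "T = generate G {\<sigma>}" "\<sigma> \<in> T"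
    using T(1,3) by (rule cyclic_generator)
  obtain c where c: "c \<in> C" "ord c = card C" using C_subgroup subset_refl by (rule subgroup_C_generator)
  have "theta_0 c ^ (lower_depth T - 1) = of_int 1"
    unfolding \<sigma>(3) by (rule theta_0_power_lower_depth) (use \<sigma> T(2) c(1) C_carrier fixed in auto)
  then have "int (card C) dvd int (lower_depth T - 1)"
    using theta_0_power_eq_iff[OF c(1), of "lower_depth T - 1" 0] c(2) by simp
  then have F1: "int (card C) dvd F T - 1" using F_in_P[OF T] by (simp add: of_nat_diff)
  let ?M = "\<Sum>\<Gamma>\<in>cyclic_over GP T. moebius (subgroup_index G \<Gamma> T)"
  have "moebius_sum G F T - b_double_prime G T = (moebius_sum GP F T - F T * ?M) + (F T - 1) * ?M"
    by (simp add: moebius_sum_split b_double_prime_split algebra_simps)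
  also have "int (card C) dvd \<dots>"
    using moebius_sum_P_cong[OF T] F1 unfolding N by (intro dvd_add dvd_mult2)
  finally show "int (card C) dvd moebius_sum G F T - b_double_prime G T" .
qed

lemma moebius_sum_dvd_if_depth_dvd:
  assumes T: "cyclic_subgroup T G" "T \<subseteq> P" "T \<noteq> {\<one>}" and "card (normalizer_in G C T) dvd lower_depth T"
  shows "int (card (normalizer_in G C T)) dvd moebius_sum GP F T"
proof -
  let ?M = "\<Sum>\<Gamma>\<in>cyclic_over GP T. moebius (subgroup_index G \<Gamma> T)"
  have "int (card (normalizer_in G C T)) dvd (moebius_sum GP F T - F T * ?M) + F T * ?M"
    using moebius_sum_P_cong[OF T] assms(4) by (intro dvd_add dvd_mult2) auto
  then show ?thesis by simp
qed

text \<open>Cyclic groups containing \<open>t\<close> lie in the cyclic centralizer of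
  \<open>t\<close> and not in \<open>P\<close>, so all depths are 1 and the sum runs over an
  interval of cyclic subgroups. Its value is 1 if \<open>T\<close> is that centralizer and 0
  otherwise; in the first case \<open>T\<close> has to be its own normalizer.\<close>

lemma moebius_sum_outside_P:
  assumes cent: cyclic_centralizers and T: "cyclic_subgroup T G" and t: "t \<in> T" "t \<in> C" "t \<noteq> \<one>"
  shows "0 \<le> moebius_sum G F T" "int (subgroup_index G (normalizer G T) T) dvd moebius_sum G F T"
proof -
  let ?Z = "centralizer_in G (carrier G) {t}"
  have Z: "cyclic_subgroup ?Z G" using cent t by simp
  have Ts: "subgroup T G" and Zs: "subgroup ?Z G" using T Z cyclic_subgroup_imp_subgroup by auto
  have tc: "t \<in> carrier G" using t(2) C_carrier by auto
  have tP: "t \<notin> P" using t P_Int_C by auto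
  have sub: "\<Gamma> \<subseteq> ?Z" if "cyclic_subgroup \<Gamma> G" "t \<in> \<Gamma>" for \<Gamma>
    using cyclic_subgroup_comm[OF that(1) _ that(2)] cyclic_carrier[OF that(1)] by (auto simp: centralizer_in_def)
  have "moebius_sum G F T = (\<Sum>\<Gamma> | \<Gamma> \<in> cyclic_over G T \<and> \<Gamma> \<subseteq> ?Z. moebius (subgroup_index G \<Gamma> T))"
    unfolding moebius_sum_def
  proof (rule sum.cong)
    show "cyclic_over G T = {\<Gamma> \<in> cyclic_over G T. \<Gamma> \<subseteq> ?Z}" using sub t(1) by (auto simp: cyclic_over_def)
    fix \<Gamma> assume "\<Gamma> \<in> {\<Gamma> \<in> cyclic_over G T. \<Gamma> \<subseteq> ?Z}"
    then have "cyclic_subgroup \<Gamma> G" "\<not> \<Gamma> \<subseteq> P" using t(1) tP by (auto simp: cyclic_over_def)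
    then show "moebius (subgroup_index G \<Gamma> T) * F \<Gamma> = moebius (subgroup_index G \<Gamma> T)"
      by (simp add: F_outside_P)
  qed
  also have "\<dots> = (if T = ?Z then 1 else 0)"
    by (rule sum_moebius_above[OF fin Z Ts sub[OF T t(1)]])
  finally have sum: "moebius_sum G F T = (if T = ?Z then 1 else 0)" .
  then show "0 \<le> moebius_sum G F T" by simp
  have "subgroup_index G (normalizer G T) T = 1" if TZ: "T = ?Z"
  proof -
    have CZ: "C \<subseteq> ?Z" using t(2) C_carrier C_commute by (auto simp: centralizer_in_def)
    have "normalizer G ?Z \<subseteq> ?Z"
    proof
      have N: "subgroup (normalizer G ?Z) G" by (rule normalizer_imp_subgroup[OF subgroup.subset[OF Zs]])
      fix g assume g: "g \<in> normalizer G ?Z"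
      then have gc: "g \<in> carrier G" using subgroup.mem_carrier[OF N] by blast
      then have "g \<in> P <#> C" using PC by simp
      then obtain x c where xc: "x \<in> P" "c \<in> C" "g = x \<otimes> c" by (auto simp: set_mult_def)
      have car: "x \<in> carrier G" "c \<in> carrier G" using xc P_carrier C_carrier by auto
      have "c \<in> normalizer G ?Z" using xc(2) CZ subset_normalizer[OF Zs] by auto
      then have "g \<otimes> inv c \<in> normalizer G ?Z" using g N by (simp add: subgroup.m_closed subgroup.m_inv_closed)
      then have "x \<in> normalizer G ?Z" using car by (simp add: xc(3) m_assoc)
      then have xZ: "conj_set G x ?Z = ?Z" using normalizer_eq[OF subgroup.subset[OF Zs]] by simp
      \<comment> \<open>Since \<open>x\<close> normalizes the cyclic centralizer, it preserves the
        subgroup generated by \<open>t\<close>, the only one of its order. So the conjugate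
        \<open>?u\<close> of \<open>t\<close> lies in \<open>C\<close>, and the commutator
        \<open>?u \<otimes> inv t\<close> in \<open>C\<close> and in \<open>P\<close>; it is trivial
        and \<open>x\<close> commutes with \<open>t\<close>.\<close>
      let ?u = "x \<otimes> t \<otimes> inv x"
      have gt: "generate G {t} \<subseteq> ?Z" using sub[OF cyclic_subgroup_generate[OF tc]] by (simp add: generate.incl)
      have gu_eq: "generate G {?u} = conj_set G x (generate G {t})" using conj_set_generate[OF car(1) tc] by simp
      then have gu: "generate G {?u} \<subseteq> ?Z" using conj_set_mono[OF gt, of x] xZ by simp
      have "generate G {?u} = generate G {t}"
      proof (rule subgroup_of_cyclic_unique[OF fin Z _ gu _ gt])
        show "card (generate G {?u}) = card (generate G {t})"
          unfolding gu_eq by (rule card_conj_set[OF car(1)]) (use generate_incl tc in simp)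
      qed (use car tc generate_is_subgroup in simp_all)
      moreover have "?u \<in> generate G {?u}" by (simp add: generate.incl)
      moreover have "generate G {t} \<subseteq> C" using generate_subset_iff[OF tc C_subgroup] t(2) by simp
      ultimately have "?u \<in> C" by auto
      then have "?u \<otimes> inv t \<in> C" using t(2) C_subgroup by (simp add: subgroup.m_closed subgroup.m_inv_closed)
      moreover have "?u \<otimes> inv t \<in> P"
      proof -
        have "t \<otimes> inv x \<otimes> inv t \<in> P"
          using normal.inv_op_closed2[OF P_normal tc, of "inv x"] xc(1) P_subgroup by (simp add: subgroup.m_inv_closed)
        then have "x \<otimes> (t \<otimes> inv x \<otimes> inv t) \<in> P" using xc(1) P_subgroup by (simp add: subgroup.m_closed)
        then show ?thesis using car tc by (simp add: m_assoc)
      qed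
      ultimately have "?u \<otimes> inv t = \<one>" using P_Int_C by auto
      then have "?u = t" using car tc by (metis inv_equality inv_inv inv_closed m_closed)
      then have "x \<otimes> t = t \<otimes> x" using car tc by (metis inv_solve_right' m_closed)
      then have "x \<in> ?Z" using car by (simp add: centralizer_in_def)
      then show "g \<in> ?Z" unfolding xc(3) using xc(2) CZ Zs by (auto simp: subgroup.m_closed)
    qed
    then have "normalizer G ?Z = ?Z" using subset_normalizer[OF Zs] by auto
    then show ?thesis
      using subgroup_index_eq[OF Zs Zs subset_refl finite_subgroupD(1)[OF fin Zs]] finite_subgroupD(3)[OF fin Zs]
      unfolding TZ by simp
  qed
  then show "int (subgroup_index G (normalizer G T) T) dvd moebius_sum G F T"
    using sum by (cases "T = ?Z") simp_all
qed

end

subsection \<open>The criterion\<close>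

context tame_extension
begin

text \<open>The centralizer of \<open>t\<close> permutes the fixed points of \<open>t\<close>. There
  is just one, as \<open>t\<close> has depth 1, so the centralizer is contained in a cyclic
  stabilizer.\<close>

lemma bertin_imp_cyclic_centralizers:
  assumes "bertin_obstruction_vanishes G \<phi>"
  shows cyclic_centralizers
proof
  fix t assume t: "t \<in> C - {\<one>}"
  obtain S :: "nat set" and act where S: "finite S" "group_action G S act"
    "\<And>s. s \<in> S \<Longrightarrow> cyclic_subgroup (stabilizer G act s) G"
    "\<And>\<sigma>. \<sigma> \<in> carrier G \<Longrightarrow> \<sigma> \<noteq> \<one> \<Longrightarrow> card {s \<in> S. generate G {\<sigma>} \<subseteq> stabilizer G act s} = depth \<sigma>"
    using assms by (rule bertin_obstruction_vanishesE) (rule that)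
  interpret A: group_action G S act by fact
  let ?Z = "centralizer_in G (carrier G) {t}"
  have tc: "t \<in> carrier G" "t \<noteq> \<one>" "t \<notin> P" using t C_carrier P_Int_C by auto
  have "card {s \<in> S. generate G {t} \<subseteq> stabilizer G act s} = 1"
    using S(4)[OF tc(1,2)] depth_outside_P[OF tc(1,3)] by simp
  then obtain s where s: "{s \<in> S. generate G {t} \<subseteq> stabilizer G act s} = {s}" by (auto simp: card_1_singleton_iff)
  have fix_iff: "u \<in> S \<Longrightarrow> act t u = u \<Longrightarrow> u = s" for u
    using s generate_subset_iff[OF tc(1) A.stabilizer_subgroup[of u]] tc(1) by (auto simp: stabilizer_def)
  have sS: "s \<in> S" "act t s = s"
    using s generate_subset_iff[OF tc(1) A.stabilizer_subgroup[of s]] by (auto simp: stabilizer_def)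
  have "?Z \<subseteq> stabilizer G act s"
  proof
    fix x assume "x \<in> ?Z"
    then have x: "x \<in> carrier G" "x \<otimes> t = t \<otimes> x" by (auto simp: centralizer_in_def)
    have "act t (act x s) = act x (act t s)"
      unfolding A.composition_rule[OF sS(1) tc(1) x(1), symmetric]
        A.composition_rule[OF sS(1) x(1) tc(1), symmetric] x(2) ..
    then have "act t (act x s) = act x s" unfolding sS(2) .
    then have "act x s = s" by (rule fix_iff[OF A.element_image[OF x(1) sS(1) refl]])
    then show "x \<in> stabilizer G act s" using x(1) by (simp add: stabilizer_def)
  qed
  then show "cyclic_subgroup ?Z G"
    by (rule subgroup_of_cyclic[OF fin S(3)[OF sS(1)] subgroup_centralizer_in[OF subgroup_self], rotated]) (simp add: tc(1))
qed

text \<open>The centralizer of \<open>t\<close> is commutative and contains \<open>C\<close>. Hence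
  elements of \<open>P\<close> commuting with \<open>t\<close> commute with all of \<open>C\<close>,
  and in the decomposition of an element of the centralizer along \<open>P\<close> and
  \<open>C\<close> both factors centralize \<open>t\<close>.\<close>

lemma centralizer_direct_product:
  assumes cent: cyclic_centralizers and t: "t \<in> C - {\<one>}"
  shows "is_internal_direct_product G (centralizer_in G (carrier G) {t}) (centralizer_in G P {t}) C"
    and "centralizer_in G P C = centralizer_in G P {t}"
proof -
  let ?Z = "centralizer_in G (carrier G) {t}" and ?A = "centralizer_in G P {t}"
  have tc: "t \<in> carrier G" using t C_carrier by auto
  have Z: "cyclic_subgroup ?Z G" using cent t by blast
  have Zs: "subgroup ?Z G" using Z by (rule cyclic_subgroup_imp_subgroup)
  have As: "subgroup ?A G" using subgroup_centralizer_in[OF P_subgroup, of "{t}"] tc by simp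
  have CZ: "C \<subseteq> ?Z" using t C_carrier C_commute by (auto simp: centralizer_in_def)
  have AZ: "?A \<subseteq> ?Z" "?A \<subseteq> P" using P_carrier by (auto simp: centralizer_in_def)
  have comm: "x \<otimes> y = y \<otimes> x" if "x \<in> ?Z" "y \<in> ?Z" for x y by (rule cyclic_subgroup_comm[OF Z that])
  have car: "x \<in> ?Z \<Longrightarrow> x \<in> carrier G" for x by (simp add: centralizer_in_def)
  have "centralizer_in G P C \<subseteq> ?A" using t by (auto simp: centralizer_in_def)
  moreover have "?A \<subseteq> centralizer_in G P C"
    using comm[OF subsetD[OF AZ(1)] subsetD[OF CZ]] AZ(2) by (auto simp: centralizer_in_def[of G P C])
  ultimately show "centralizer_in G P C = ?A" by blast
  have "(\<lambda>(x, y). x \<otimes> y) \<in> hom (G\<lparr>carrier := ?A\<rparr> \<times>\<times> G\<lparr>carrier := C\<rparr>) (G\<lparr>carrier := ?Z\<rparr>)"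
  proof (rule homI)
    fix a assume "a \<in> carrier (G\<lparr>carrier := ?A\<rparr> \<times>\<times> G\<lparr>carrier := C\<rparr>)"
    then show "(\<lambda>(x, y). x \<otimes> y) a \<in> carrier (G\<lparr>carrier := ?Z\<rparr>)"
      using AZ CZ subgroup.m_closed[OF Zs] by (auto simp: DirProd_def subset_iff)
  next
    fix a b assume "a \<in> carrier (G\<lparr>carrier := ?A\<rparr> \<times>\<times> G\<lparr>carrier := C\<rparr>)"
      "b \<in> carrier (G\<lparr>carrier := ?A\<rparr> \<times>\<times> G\<lparr>carrier := C\<rparr>)"
    then obtain x y x' y' where ab: "a = (x, y)" "b = (x', y')" "x \<in> ?A" "x' \<in> ?A" "y \<in> C" "y' \<in> C"
      by (auto simp: DirProd_def)
    then have z: "x \<in> ?Z" "x' \<in> ?Z" "y \<in> ?Z" "y' \<in> ?Z" using AZ CZ by blast+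
    note zc = z[THEN car]
    have "x \<otimes> x' \<otimes> (y \<otimes> y') = x \<otimes> (x' \<otimes> y) \<otimes> y'" using zc by (simp add: m_assoc)
    also have "x' \<otimes> y = y \<otimes> x'" by (rule comm[OF z(2,3)])
    also have "x \<otimes> (y \<otimes> x') \<otimes> y' = (x \<otimes> y) \<otimes> (x' \<otimes> y')" using zc by (simp add: m_assoc)
    finally show "(\<lambda>(x, y). x \<otimes> y) (a \<otimes>\<^bsub>G\<lparr>carrier := ?A\<rparr> \<times>\<times> G\<lparr>carrier := C\<rparr>\<^esub> b) =
        (\<lambda>(x, y). x \<otimes> y) a \<otimes>\<^bsub>G\<lparr>carrier := ?Z\<rparr>\<^esub> (\<lambda>(x, y). x \<otimes> y) b"
      by (simp add: ab(1,2))
  qed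
  moreover have "bij_betw (\<lambda>(x, y). x \<otimes> y) (?A \<times> C) ?Z"
    unfolding bij_betw_def
  proof
    show "inj_on (\<lambda>(x, y). x \<otimes> y) (?A \<times> C)"
    proof (rule inj_onI, clarsimp)
      fix x y x' y' assume h: "x \<in> ?A" "y \<in> C" "x' \<in> ?A" "y' \<in> C" "x \<otimes> y = x' \<otimes> y'"
      have c: "x \<in> carrier G" "y \<in> carrier G" "x' \<in> carrier G" "y' \<in> carrier G"
        using h AZ C_carrier P_carrier by auto
      have "inv x' \<otimes> (x \<otimes> y) \<otimes> inv y = inv x' \<otimes> (x' \<otimes> y') \<otimes> inv y" using h(5) by simp
      then have eq: "inv x' \<otimes> x = y' \<otimes> inv y" using c by (simp add: m_assoc inv_mult_cancel)
      have "inv x' \<otimes> x \<in> P" using h(1,3) AZ(2)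
        by (intro subgroup.m_closed[OF P_subgroup] subgroup.m_inv_closed[OF P_subgroup]) auto
      moreover have "inv x' \<otimes> x \<in> C"
        unfolding eq using h(2,4) C_subgroup by (simp add: subgroup.m_closed subgroup.m_inv_closed)
      ultimately have 1: "inv x' \<otimes> x = \<one>" using P_Int_C by auto
      then have "x = x'" using c by (metis inv_mult_cancel(2) r_one)
      then show "x = x' \<and> y = y'" using h(5) c by simp
    qed
    show "(\<lambda>(x, y). x \<otimes> y) ` (?A \<times> C) = ?Z"
    proof (intro equalityI subsetI)
      fix g assume g: "g \<in> ?Z"
      then have "g \<in> P <#> C" using PC car by simp
      then obtain x c where xc: "x \<in> P" "c \<in> C" "g = x \<otimes> c" by (auto simp: set_mult_def)
      have c: "x \<in> carrier G" "c \<in> carrier G" using xc P_carrier C_carrier by auto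
      have "g \<otimes> inv c \<in> ?Z" using g xc(2) CZ Zs by (auto simp: subgroup.m_closed subgroup.m_inv_closed)
      then have "x \<in> ?Z" using c by (simp add: xc(3) m_assoc)
      then have "x \<in> ?A" using xc(1) by (simp add: centralizer_in_def)
      then show "g \<in> (\<lambda>(x, y). x \<otimes> y) ` (?A \<times> C)" using xc(2,3) by auto
    qed (use AZ CZ subgroup.m_closed[OF Zs] in \<open>auto simp: subset_iff\<close>)
  qed
  ultimately show "is_internal_direct_product G ?Z ?A C"
    using As C_subgroup by (simp add: is_internal_direct_product_def iso_def DirProd_def)
qed

text \<open>An element of \<open>N_C(T)\<close> fixing a point that \<open>T\<close> fixes lies with
  \<open>T\<close> in a cyclic, hence commutative, stabilizer. It therefore centralizes
  \<open>T\<close> and is trivial, so the action on the fixed points of \<open>T\<close> is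
  free.\<close>

lemma bertin_imp_dvd_depth:
  assumes bertin: "bertin_obstruction_vanishes G \<phi>" and T: "cyclic_subgroup T G" "T \<noteq> {\<one>}"
    and triv: "centralizer_in G C T = {\<one>}"
  shows "card (normalizer_in G C T) dvd lower_depth T"
proof -
  obtain S :: "nat set" and act where S: "finite S" "group_action G S act"
    "\<And>s. s \<in> S \<Longrightarrow> cyclic_subgroup (stabilizer G act s) G"
    "\<And>\<sigma>. \<sigma> \<in> carrier G \<Longrightarrow> \<sigma> \<noteq> \<one> \<Longrightarrow> card {s \<in> S. generate G {\<sigma>} \<subseteq> stabilizer G act s} = depth \<sigma>"
    using bertin by (rule bertin_obstruction_vanishesE) (rule that)
  interpret A: group_action G S act by fact
  let ?D = "normalizer_in G C T" and ?E = "{s \<in> S. T \<subseteq> stabilizer G act s}"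
  let ?GD = "G\<lparr>carrier := ?D\<rparr>" and ?act = "\<lambda>g. restrict (act g) {s \<in> S. T \<subseteq> stabilizer G act s}"
  have Tc: "T \<subseteq> carrier G" using T(1) by (rule cyclic_carrier)
  have D: "subgroup ?D G" by (rule subgroup_normalizer_in[OF Tc C_subgroup])
  have D_mem: "x \<in> ?D \<longleftrightarrow> x \<in> C \<and> conj_set G x T = T" for x
    using normalizer_in_eq[OF Tc C_carrier] by auto
  have Dc: "x \<in> carrier G" if "x \<in> ?D" for x using that D_mem C_carrier by auto
  interpret D: group ?GD using D by (rule subgroup_imp_group)
  interpret B: group_action ?GD ?E ?act
  proof (rule D.group_action_restrict)
    fix g s assume g: "g \<in> carrier ?GD" and s: "s \<in> ?E"
    have gc: "g \<in> carrier G" using g Dc by simp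
    have "conj_set G g T \<subseteq> stabilizer G act (act g s)"
      using conj_set_mono[of T "stabilizer G act s" g] s A.stabilizer_translate[OF gc, of s] by simp
    then show "act g s \<in> ?E" using g s D_mem A.element_image[OF gc, of s] by simp
  next
    fix s assume "s \<in> ?E" then show "act \<one>\<^bsub>?GD\<^esub> s = s" by (simp flip: A.id_eq_one)
  next
    fix g h s assume "g \<in> carrier ?GD" "h \<in> carrier ?GD" "s \<in> ?E"
    then show "act (g \<otimes>\<^bsub>?GD\<^esub> h) s = act g (act h s)" using Dc A.composition_rule[of s g h] by simp
  qed
  have free: "stabilizer ?GD ?act s = {\<one>}" if s: "s \<in> ?E" for s
  proof -
    have "x = \<one>" if x: "x \<in> stabilizer ?GD ?act s" for x
    proof -
      have xD: "x \<in> ?D" and "act x s = s" using x s by (auto simp: stabilizer_def)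
      then have xs: "x \<in> stabilizer G act s" using Dc by (simp add: stabilizer_def)
      have "x \<otimes> y = y \<otimes> x" if "y \<in> T" for y
        using cyclic_subgroup_comm[OF S(3) xs, of y] s that by auto
      then have "x \<in> centralizer_in G C T" using xD D_mem by (simp add: centralizer_in_def)
      then show ?thesis using triv by simp
    qed
    moreover have "\<one> \<in> stabilizer ?GD ?act s" using B.stabilizer_one_closed[OF s] by simp
    ultimately show ?thesis by blast
  qed
  have "int (card ?D) dvd (\<Sum>s\<in>?E. 1)"
  proof (rule B.dvd_sum_if_dvd_orbit_sums)
    fix s assume s: "s \<in> ?E"
    have "card (orbit ?GD ?act s) = card ?D"
      using B.orbit_stabilizer_theorem[OF s] free[OF s] by (simp add: Coset.order_def)
    then show "int (card ?D) dvd int (card (orbit ?GD ?act s)) * 1" by simp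
  qed (use S(1) in simp_all)
  moreover obtain \<sigma> where \<sigma>: "\<sigma> \<in> carrier G" "\<sigma> \<noteq> \<one>" "T = generate G {\<sigma>}" "\<sigma> \<in> T"
    using T by (rule cyclic_generator)
  have "card ?E = lower_depth T" using S(4)[OF \<sigma>(1,2)] \<sigma> by (simp add: lower_depth_generate)
  ultimately show ?thesis by simp
qed

lemma prime_power_dvd_moebius_sum:
  assumes T: "cyclic_subgroup T G" "T \<subseteq> P" "T \<noteq> {\<one>}"
    and local: "\<And>U. cyclic_subgroup U G \<Longrightarrow> U \<subseteq> P \<Longrightarrow> U \<noteq> {\<one>} \<Longrightarrow>
      int (card (normalizer_in G C U)) dvd moebius_sum G F U"
    and index_P: "int (subgroup_index G (normalizer_in G P T) T) dvd moebius_sum G F T"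
  shows "int (subgroup_index G (normalizer G T) T) dvd moebius_sum G F T"
proof (rule int_dvd_if_prime_power_dvd)
  have Ts: "subgroup T G" and Tc: "T \<subseteq> carrier G" using T cyclic_subgroup_imp_subgroup cyclic_carrier by auto
  let ?N = "normalizer G T"
  have N: "subgroup ?N G" by (rule normalizer_imp_subgroup[OF Tc])
  have NP: "subgroup (normalizer_in G P T) G" by (rule subgroup_normalizer_in[OF Tc P_subgroup])
  have idx: "subgroup_index G ?N T * card T = card ?N" by (rule normalizer_index_card(1)[OF fin Ts])
  show "subgroup_index G ?N T > 0" by (rule normalizer_index_card(2)[OF fin Ts])
  interpret GN: group "G\<lparr>carrier := ?N\<rparr>" using N by (rule subgroup_imp_group)
  \<comment> \<open>The first Sylow theorem in the form that provides a subgroup for every prime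
    power dividing the order.\<close>
  have sylow: "\<exists>Q. subgroup Q G \<and> Q \<subseteq> ?N \<and> card Q = q ^ k"
    if q: "Factorial_Ring.prime q" and qk: "q ^ k dvd card ?N" for q k
  proof -
    obtain m where "Coset.order (G\<lparr>carrier := ?N\<rparr>) = q ^ k * m" using qk by (auto simp: Coset.order_def)
    moreover have "finite (carrier (G\<lparr>carrier := ?N\<rparr>))" using finite_subgroupD(1)[OF fin N] by simp
    ultimately obtain Q where Q: "subgroup Q (G\<lparr>carrier := ?N\<rparr>)" "card Q = q ^ k"
      using sylow_thm[OF q GN.is_group] by blast
    then show ?thesis using incl_subgroup[OF N Q(1)] subgroup.subset[OF Q(1)] by auto
  qed
  fix q k assume q: "Factorial_Ring.prime q" and qk: "q ^ k dvd subgroup_index G ?N T"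
  show "int q ^ k dvd moebius_sum G F T"
  proof (cases "q = p")
    case True
    have "card T dvd p ^ s" using subgroup_card_dvd[OF Ts P_subgroup T(2)] by (simp add: card_P)
    then obtain j where j: "card T = p ^ j" using divides_primepow_nat[OF prime_p] by blast
    \<comment> \<open>The order of \<open>T\<close>, a power of \<open>p\<close>, is multiplied back
      in: a subgroup of order \<open>p ^ (k + j)\<close> of the normalizer lies in
      \<open>N_P(T)\<close>, and cancelling \<open>p ^ j\<close> leaves \<open>p ^ k\<close>
      dividing the index in \<open>N_P(T)\<close>.\<close>
    have "q ^ k * card T dvd card ?N" unfolding idx[symmetric] by (rule mult_dvd_mono[OF qk dvd_refl])
    then have "p ^ (k + j) dvd card ?N" by (simp only: True j power_add)
    then obtain Q where Q: "subgroup Q G" "Q \<subseteq> ?N" "card Q = p ^ (k + j)" using sylow[OF prime_p] by blast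
    have "Q \<subseteq> P"
    proof
      fix x assume x: "x \<in> Q"
      then show "x \<in> P"
        using p_power_in_P[of x "k + j"] pow_card_subgroup[OF Q(1) x] Q(3) subgroup.mem_carrier[OF Q(1) x] by simp
    qed
    then have QN: "Q \<subseteq> normalizer_in G P T" using Q(2) by (auto simp: normalizer_in_def)
    have TN: "T \<subseteq> normalizer_in G P T" using T(2) subset_normalizer[OF Ts] by (auto simp: normalizer_in_def)
    have "subgroup_index G (normalizer_in G P T) T * p ^ j = card (normalizer_in G P T)"
      using subgroup_index_eq[OF Ts NP TN finite_subgroupD(1)[OF fin Ts]] subgroup_card_dvd[OF Ts NP TN] by (simp add: j)
    then have "p ^ k * p ^ j dvd subgroup_index G (normalizer_in G P T) T * p ^ j"
      using subgroup_card_dvd[OF Q(1) NP QN] Q(3) by (simp add: power_add)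
    then have "p ^ k dvd subgroup_index G (normalizer_in G P T) T"
      using prime_gt_0_nat[OF prime_p] by simp
    then show ?thesis using index_P True by (metis dvd_trans int_dvd_int_iff of_nat_power)
  next
    case False
    have "q ^ k dvd card ?N" using qk idx by (metis dvd_mult2)
    then obtain Q where Q: "subgroup Q G" "Q \<subseteq> ?N" "card Q = q ^ k" using sylow[OF q] by blast
    have Qc: "Q \<subseteq> carrier G" using Q(1) by (rule subgroup.subset)
    obtain g where g: "g \<in> carrier G" "conj_set G g Q \<subseteq> C" using Q(1,3) q False by (rule conj_into_C)
    \<comment> \<open>After conjugation the \<open>q\<close>-subgroup normalizes \<open>?U\<close>
      and lies in \<open>C\<close>, so the local divisibility applies at \<open>?U\<close>; the
      Moebius sum is the same at \<open>T\<close>.\<close>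
    let ?U = "conj_set G g T"
    have Uc: "?U \<subseteq> carrier G" by (rule conj_set_subset_carrier[OF g(1) Tc])
    have U: "cyclic_subgroup ?U G" by (rule cyclic_conj_set[OF g(1) T(1)])
    have UP: "?U \<subseteq> P" using T(2) normal.inv_op_closed2[OF P_normal g(1)] by (auto simp: conj_set_def)
    have U1: "?U \<noteq> {\<one>}"
    proof
      assume "?U = {\<one>}"
      then have "T = conj_set G (inv g) {\<one>}" using conj_set_inv(1)[OF g(1) Tc] by simp
      then show False using T(3) g(1) by (simp add: conj_set_def)
    qed
    have "conj_set G g Q \<subseteq> normalizer_in G C ?U"
    proof
      fix y assume y: "y \<in> conj_set G g Q"
      then obtain x where x: "x \<in> Q" "y = g \<otimes> x \<otimes> inv g" by (auto simp: conj_set_def)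
      have xc: "x \<in> carrier G" "conj_set G x T = T" using x(1) Q(2) by (auto simp: normalizer_eq[OF Tc])
      have "conj_set G y ?U = conj_set G (y \<otimes> g) T" using x xc g(1) Tc by (simp add: conj_set_mult)
      also have "y \<otimes> g = g \<otimes> x" using x(2) xc g(1) by (simp add: m_assoc)
      also have "conj_set G (g \<otimes> x) T = ?U" using xc g(1) Tc by (simp add: conj_set_mult)
      finally show "y \<in> normalizer_in G C ?U" using y g(2) normalizer_in_eq[OF Uc C_carrier] by auto
    qed
    then have "q ^ k dvd card (normalizer_in G C ?U)"
      using subgroup_card_dvd[OF subgroup_conj_set[OF g(1) Q(1)] subgroup_normalizer_in[OF Uc C_subgroup]]
        card_conj_set[OF g(1) Qc] Q(3) by simp
    then have "int q ^ k dvd moebius_sum G F ?U"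
      using local[OF U UP U1] by (metis dvd_trans int_dvd_int_iff of_nat_power)
    also have "moebius_sum G F ?U = moebius_sum G F T"
      by (rule moebius_sum_conj_set[OF fin g(1) Ts]) (rule F_conj_set[OF g(1) cyclic_carrier])
    finally show ?thesis .
  qed
qed

text \<open>The order of a generator of \<open>T\<close> is not a power of \<open>p\<close>, so
  \<open>T\<close> has an element of prime order different from \<open>p\<close>. Conjugating it
  into \<open>C\<close> leads to the situation of \<open>moebius_sum_outside_P\<close>.\<close>

lemma moebius_sum_not_in_P:
  assumes cent: cyclic_centralizers and T: "cyclic_subgroup T G" "\<not> T \<subseteq> P"
  shows "0 \<le> moebius_sum G F T" "int (subgroup_index G (normalizer G T) T) dvd moebius_sum G F T"
proof -
  have Ts: "subgroup T G" using T(1) by (rule cyclic_subgroup_imp_subgroup)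
  have "T \<noteq> {\<one>}" using T(2) subgroup.one_closed[OF P_subgroup] by auto
  with T(1) obtain \<gamma> where \<gamma>: "\<gamma> \<in> carrier G" "\<gamma> \<noteq> \<one>" "T = generate G {\<gamma>}" "\<gamma> \<in> T" by (rule cyclic_generator)
  have \<gamma>P: "\<gamma> \<notin> P" using T(2) generate_subset_iff[OF \<gamma>(1) P_subgroup] \<gamma>(3) by simp
  have ord0: "ord \<gamma> > 0" using ord_ge_1[OF fin \<gamma>(1)] by simp
  obtain q where q: "Factorial_Ring.prime q" "q \<noteq> p" "q dvd ord \<gamma>"
  proof -
    have "ord \<gamma> \<noteq> 0" "\<not> is_unit p" using ord0 prime_p not_prime_unit by auto
    then obtain u where u: "ord \<gamma> = p ^ multiplicity p (ord \<gamma>) * u" "\<not> p dvd u"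
      by (rule multiplicity_decompose')
    have "u \<noteq> 1"
    proof
      assume "u = 1"
      then have "\<gamma> [^] (p ^ multiplicity p (ord \<gamma>)) = \<one>" using u(1) pow_ord_eq_1[OF \<gamma>(1)] by simp
      then show False using p_power_in_P[OF \<gamma>(1)] \<gamma>P by blast
    qed
    then obtain q where "Factorial_Ring.prime q" "q dvd u" using prime_factor_nat by blast
    then show thesis using that[of q] u by (metis dvd_mult)
  qed
  define \<tau> where "\<tau> = \<gamma> [^] (ord \<gamma> div q)"
  have \<tau>c: "\<tau> \<in> carrier G" using \<gamma>(1) by (simp add: \<tau>_def)
  have \<tau>T: "\<tau> \<in> T" using subgroup_int_pow_closed[OF Ts \<gamma>(4), of "int (ord \<gamma> div q)"] by (simp add: \<tau>_def int_pow_int)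
  obtain m where m: "ord \<gamma> = q * m" using q(3) by auto
  have "ord \<tau> = q"
    unfolding \<tau>_def using ord_pow[OF \<gamma>(1), of m] m ord0 prime_gt_0_nat[OF q(1)] by simp
  then have card: "card (generate G {\<tau>}) = q ^ 1" using generate_pow_card[OF \<tau>c] by simp
  have "subgroup (generate G {\<tau>}) G" using \<tau>c by (simp add: generate_is_subgroup)
  then obtain g where g: "g \<in> carrier G" "conj_set G g (generate G {\<tau>}) \<subseteq> C"
    using card q(1,2) by (rule conj_into_C)
  let ?t = "g \<otimes> \<tau> \<otimes> inv g" and ?U = "conj_set G g T"
  have t: "?t \<in> ?U" using \<tau>T by (simp add: conj_set_def)
  have tC: "?t \<in> C" using g(2) by (auto simp: conj_set_def intro: generate.incl)
  have "\<tau> \<noteq> \<one>" using \<open>ord \<tau> = q\<close> q(1) by (metis ord_id not_prime_1)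
  then have t1: "?t \<noteq> \<one>" using conj_eq_one_iff[OF g(1) \<tau>c] by simp
  have M: "moebius_sum G F ?U = moebius_sum G F T"
    by (rule moebius_sum_conj_set[OF fin g(1) Ts]) (rule F_conj_set[OF g(1) cyclic_carrier])
  show "0 \<le> moebius_sum G F T" "int (subgroup_index G (normalizer G T) T) dvd moebius_sum G F T"
    using moebius_sum_outside_P[OF cent cyclic_conj_set[OF g(1) T(1)] t tC t1]
      normalizer_index_conj_set[OF fin g(1) Ts] M by simp_all
qed

end

theorem theorem6p6:
  fixes G :: "('g, 'b) monoid_scheme"
    and \<phi> :: "'g \<Rightarrow> 'k::alg_closed_field fps \<Rightarrow> 'k fps"
    and P C :: "'g set"
    and p :: nat
  assumes char: "CHAR('k) = p" "p > 0"
    and G: "group G" "finite (carrier G)"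
    and phi: "\<phi> \<in> hom G fps_aut" "inj_on \<phi> (carrier G)"
    and P: "P \<lhd> G" "card P = p ^ multiplicity p (Coset.order G)"
    and C: "cyclic_subgroup C G" "coprime (card C) p"
    and semidirect: "P <#>\<^bsub>G\<^esub> C = carrier G" "P \<inter> C = {\<one>\<^bsub>G\<^esub>}"
  shows "bertin_obstruction_vanishes G \<phi> \<longleftrightarrow>
    bertin_obstruction_vanishes (G\<lparr>carrier := P\<rparr>) \<phi> \<and>
    (\<forall>t \<in> C - {\<one>\<^bsub>G\<^esub>}.
       cyclic_subgroup (centralizer_in G (carrier G) {t}) G \<and>
       is_internal_direct_product G (centralizer_in G (carrier G) {t}) (centralizer_in G P {t}) C \<and>
       is_internal_direct_product G (centralizer_in G (carrier G) {t}) (centralizer_in G P C) C) \<and>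
    (\<forall>T. cyclic_subgroup T G \<and> T \<subseteq> P \<and> T \<noteq> {\<one>\<^bsub>G\<^esub>} \<longrightarrow>
       [b_prime G P T = 0] (mod int (subgroup_index G (normalizer_in G P T) T)) \<and>
       of_nat (subgroup_index G (normalizer_in G P T) T) * artin_coeff (G\<lparr>carrier := P\<rparr>) \<phi> T
         \<ge> - of_int (b_prime G P T)) \<and>
    (\<forall>T. cyclic_subgroup T G \<and> T \<subseteq> P \<and> T \<noteq> {\<one>\<^bsub>G\<^esub>} \<longrightarrow>
       (centralizer_in G C T \<noteq> {\<one>\<^bsub>G\<^esub>} \<and>
        [b_double_prime G T = 0] (mod int (card (normalizer_in G C T)))) \<or>
       (centralizer_in G C T = {\<one>\<^bsub>G\<^esub>} \<and>
        inj_on (theta_char \<phi> P) (normalizer_in G C T) \<and>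
        theta_char \<phi> P ` normalizer_in G C T \<subseteq> of_nat ` {1..<p} \<and>
        (\<forall>x \<in> normalizer_in G C T.
           teichmueller_lift G p (normalizer_in G C T) (theta_char \<phi> P) x =
             inv\<^bsub>padic_units p\<^esub> (chi_char G p C T x)) \<and>
        [b_prime G P T = 0] (mod int (card (normalizer_in G C T)))))"
    (is "?bertin \<longleftrightarrow> ?a \<and> ?b \<and> (\<forall>T. ?sub T \<longrightarrow> ?c1 T \<and> ?c2 T) \<and> (\<forall>T. ?sub T \<longrightarrow> ?d1 T \<or> ?d2 T)")
proof -
  have prime: "Factorial_Ring.prime p" using prime_CHAR_semidom[where 'a = 'k] char by simp
  interpret tame_extension G \<phi> P C p "multiplicity p (Coset.order G)"
    by (intro tame_extension.intro fps_aut_group.intro fps_aut_group_axioms.intro tame_extension_axioms.intro)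
      (fact assms prime)+
  have c2: "?c2 T \<longleftrightarrow> 0 \<le> moebius_sum G F T" if "?sub T" for T
  proof -
    have "?c2 T \<longleftrightarrow> (of_int (- b_prime G P T) :: rat) \<le> of_int (moebius_sum GP F T)"
      using artin_coeff_P[of T] that by simp
    then show ?thesis unfolding of_int_le_iff moebius_sum_split by linarith
  qed
  have d2: "?d2 T \<longleftrightarrow> centralizer_in G C T = {\<one>\<^bsub>G\<^esub>} \<and> card (normalizer_in G C T) dvd lower_depth T \<and>
      int (card (normalizer_in G C T)) dvd b_prime G P T" if "?sub T" for T
    using theta_conditions_iff[of T] that unfolding cong_0_iff by blast
  show ?thesis
  proof
    assume bertin: ?bertin
    have a: ?a using bertin by (rule bertin_G_imp_P)
    have cent: cyclic_centralizers using bertin by (rule bertin_imp_cyclic_centralizers)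
    have G: "0 \<le> moebius_sum G F T \<and> int (subgroup_index G (normalizer G T) T) dvd moebius_sum G F T" if "?sub T" for T
      using bertin that unfolding bertin_G_iff by blast
    have C_dvd: "int (card (normalizer_in G C T)) dvd moebius_sum G F T" if "?sub T" for T
      using card_normalizer_in_C_dvd_index[of T] G[OF that] that by (meson dvd_trans int_dvd_int_iff)
    have ?b using cent centralizer_direct_product[OF cent] by simp
    moreover have "?c1 T \<and> ?c2 T" if T: "?sub T" for T
    proof
      have Ts: "subgroup T G" and Tc: "T \<subseteq> carrier G" using T cyclic_subgroup_imp_subgroup cyclic_carrier by auto
      let ?NP = "normalizer_in G P T"
      have NP: "subgroup ?NP G" by (rule subgroup_normalizer_in[OF Tc P_subgroup])
      have N: "subgroup (normalizer G T) G" by (rule normalizer_imp_subgroup[OF Tc])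
      have sub: "T \<subseteq> ?NP" "?NP \<subseteq> normalizer G T" using T subset_normalizer[OF Ts] by (auto simp: normalizer_in_def)
      have "subgroup_index G ?NP T dvd subgroup_index G (normalizer G T) T"
        unfolding subgroup_index_eq[OF Ts NP sub(1) finite_subgroupD(1)[OF fin Ts]]
          subgroup_index_eq[OF Ts N subset_normalizer[OF Ts] finite_subgroupD(1)[OF fin Ts]]
        by (rule div_dvd_div[THEN iffD2, OF subgroup_card_dvd[OF Ts NP sub(1)]
              subgroup_card_dvd[OF Ts N subset_normalizer[OF Ts]] subgroup_card_dvd[OF NP N sub(2)]])
      then have "int (subgroup_index G ?NP T) dvd moebius_sum G F T"
        using G[OF T] by (meson dvd_trans int_dvd_int_iff)
      moreover have "int (subgroup_index G ?NP T) dvd moebius_sum GP F T"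
        using a T unfolding bertin_P_iff by blast
      \<comment> \<open>The index in \<open>N_P(T)\<close> divides the Moebius sums for
        \<open>G\<close> and for \<open>P\<close>, and \<open>b_prime\<close> is their
        difference.\<close>
      ultimately have "int (subgroup_index G ?NP T) dvd b_prime G P T"
        unfolding moebius_sum_split by (simp add: dvd_add_right_iff)
      then show "?c1 T" by (simp add: cong_0_iff)
      show "?c2 T" using c2[OF T] G[OF T] by blast
    qed
    moreover have "?d1 T \<or> ?d2 T" if T: "?sub T" for T
    proof (cases "centralizer_in G C T = {\<one>\<^bsub>G\<^esub>}")
      case True
      have "card (normalizer_in G C T) dvd lower_depth T"
        using bertin_imp_dvd_depth[OF bertin _ _ True] T by blast
      moreover from this have "int (card (normalizer_in G C T)) dvd moebius_sum GP F T"
        using moebius_sum_dvd_if_depth_dvd[of T] T by blast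
      then have "int (card (normalizer_in G C T)) dvd b_prime G P T"
        using C_dvd[OF T] unfolding moebius_sum_split by (simp add: dvd_add_right_iff)
      ultimately have "?d2 T" using d2[OF T] True by blast
      then show ?thesis ..
    next
      case False
      have T1: "cyclic_subgroup T G" "T \<subseteq> P" "T \<noteq> {\<one>\<^bsub>G\<^esub>}" using T by blast+
      note cc = central_case[OF cent T1 False]
      \<comment> \<open>Here \<open>N_C(T)\<close> is all of \<open>C\<close>, so
        \<open>card C\<close> divides the Moebius sum itself as well as its difference from
        \<open>b_double_prime\<close>.\<close>
      have "int (card C) dvd moebius_sum G F T - (moebius_sum G F T - b_double_prime G T)"
        using C_dvd[OF T] cc(2) unfolding cc(1) by (rule dvd_diff)
      then have "?d1 T" using cc(1) False by (simp add: cong_0_iff)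
      then show ?thesis ..
    qed
    ultimately show "?a \<and> ?b \<and> (\<forall>T. ?sub T \<longrightarrow> ?c1 T \<and> ?c2 T) \<and> (\<forall>T. ?sub T \<longrightarrow> ?d1 T \<or> ?d2 T)"
      using a by blast
  next
    assume R: "?a \<and> ?b \<and> (\<forall>T. ?sub T \<longrightarrow> ?c1 T \<and> ?c2 T) \<and> (\<forall>T. ?sub T \<longrightarrow> ?d1 T \<or> ?d2 T)"
    note a = R[THEN conjunct1] and b = R[THEN conjunct2, THEN conjunct1]
      and c' = R[THEN conjunct2, THEN conjunct2, THEN conjunct1] and d' = R[THEN conjunct2, THEN conjunct2, THEN conjunct2]
    have c: "?c1 T \<and> ?c2 T" if "?sub T" for T using c'[rule_format, OF that] .
    have d: "?d1 T \<or> ?d2 T" if "?sub T" for T using d'[rule_format, OF that] .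
    have cent: cyclic_centralizers using b by blast
    \<comment> \<open>Either alternative of (d) yields this one divisibility: the first since the
      Moebius sum is \<open>b_double_prime\<close> modulo \<open>card C\<close>, the second since
      \<open>#N_C(T)\<close> divides the depth, hence the Moebius sum for \<open>P\<close>, as well
      as \<open>b_prime\<close>.\<close>
    have local: "int (card (normalizer_in G C T)) dvd moebius_sum G F T" if T: "?sub T" for T
    proof (cases "?d1 T")
      case True
      have T1: "cyclic_subgroup T G" "T \<subseteq> P" "T \<noteq> {\<one>\<^bsub>G\<^esub>}" using T by blast+
      note cc = central_case[OF cent T1 conjunct1[OF True]]
      have "int (card C) dvd b_double_prime G T" using True cc(1) by (simp add: cong_0_iff)
      with cc(2) have "int (card C) dvd (moebius_sum G F T - b_double_prime G T) + b_double_prime G T"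
        by (rule dvd_add)
      then show ?thesis unfolding cc(1) by simp
    next
      case False
      then have "?d2 T" using d[OF T] by blast
      then have "card (normalizer_in G C T) dvd lower_depth T" "int (card (normalizer_in G C T)) dvd b_prime G P T"
        using d2[OF T] by blast+
      then show ?thesis
        unfolding moebius_sum_split using moebius_sum_dvd_if_depth_dvd[of T] T by (intro dvd_add) auto
    qed
    show ?bertin
      unfolding bertin_G_iff
    proof (intro allI impI)
      fix T assume T: "cyclic_subgroup T G \<and> T \<noteq> {\<one>\<^bsub>G\<^esub>}"
      show "0 \<le> moebius_sum G F T \<and> int (subgroup_index G (normalizer G T) T) dvd moebius_sum G F T"
      proof (cases "T \<subseteq> P")
        case True
        then have T': "?sub T" using T by blast
        have "int (subgroup_index G (normalizer_in G P T) T) dvd moebius_sum G F T"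
          unfolding moebius_sum_split using a c[OF T'] T' unfolding bertin_P_iff cong_0_iff by (intro dvd_add) blast+
        then have "int (subgroup_index G (normalizer G T) T) dvd moebius_sum G F T"
          using T' local by (intro prime_power_dvd_moebius_sum) blast+
        then show ?thesis using c2[OF T'] c[OF T'] by blast
      next
        case False
        then show ?thesis using moebius_sum_not_in_P[OF cent] T by blast
      qed
    qed
  qed
qed

end
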